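(* Let $G$ be a countably infinite discrete group and let $G \curvearrowright X$ be a free Borel action of $G$ on a standard Borel space $X$. Then there exists a $G$-equivariant Borel map $f : X\to 2^G$ with $\overline{f(X)}\subseteq \mathrm{Free}(2^G)$. Furthermore: (1) Suppose that $Y\subseteq X$ is a Borel set such that $X\setminus Y$ is syndetic, and $\phi : Y\to 2$ is a Borel function. Then there exists a $G$-equivariant Borel map $f : X\to 2^G$ with $\overline{f(X)}\subseteq \mathrm{Free}(2^G)$ and $f(y)(1_G) = \phi (y)$ for all $y\in Y$. (2) Let $Y\subseteq X$ be a Borel set such that $X\setminus Y$ is syndetic, and let $\phi : Y\to 2$ be a Borel function. Then there exists a family $\{ f_w \}_{w\in 2^{\mathbb{N}}}$ of $G$-equivariant Borel maps $f_w : X\to 2^G$, each satisfying $\overline{f_w(X)}\subseteq \mathrm{Free}(2^G)$ and $f_w(y)(1_G) = \phi(y)$ for all $y\in Y$, and with the further property that $\overline{f_w(X)}\cap \overline{f_z(X)} = \emptyset$ for all distinct $w,z\in 2^{\mathbb{N}}$. In addition, the map $(w,x) \mapsto f_w(x)$ from $2^{\mathbb{N}}\times X$ to $2^G$ is Borel, and for each fixed $x\in X$ the map $w \mapsto f_w(x)$ is continuous. (3) For any $G$-quasi-invariant Borel probability measure $\mu$ on $X$, the set $$\{ [A]_\mu : A\subseteq X\text{ is Borel and }f_A(X)\subseteq \mathrm{Free}(2^G)\}$$ is a dense $G_\delta$ subset of $\mathrm{MALG}_{\mu}$.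
   Context: Here $2=\{0,1\}$, and $2^G=\prod_{g\in G}\{0,1\}$ carries the product topology. $G$ acts on $2^G$ by the left shift: $(g\cdot w)(h) = w(g^{-1}h)$ for $g,h\in G$, $w\in 2^G$. The free part is $\mathrm{Free}(2^G)=\{w\in 2^G : \forall g\in G\ (g\neq 1_G \Rightarrow g\cdot w\neq w)\}$. For $W\subseteq 2^G$, $\overline{W}$ is the closure of $W$ in $2^G$. An action of $G$ is free if $g\cdot x\ne x$ for all $x$ and all $g\neq 1_G$. A subset $M\subseteq X$ is syndetic if $X=F\cdot M$ for some finite $F\subseteq G$. For a Borel set $A\subseteq X$, $f_A : X\to 2^G$ is the $G$-equivariant Borel map given by $f_A(x)(g) = 1_{g\cdot A}(x)$, where $1_{g\cdot A}$ is the indicator function of $g\cdot A$. For a Borel probability measure $\mu$ on $X$, $\mathrm{MALG}_\mu$ is the collection of Borel subsets of $X$ modulo $\mu$-null sets, a Polish space under the metric $d([A]_\mu,[B]_\mu)=\mu(A\triangle B)$, where $[A]_\mu$ is the class of $A$. The measure $\mu$ is $G$-quasi-invariant if every $g\in G$ maps $\mu$-null sets to $\mu$-null sets. *)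

theory Defs
  imports "HOL-Probability.Probability"
begin

(* Conventions.  The group is the type 'g of class group_add, which is not assumed to be
   commutative; it is written additively, so 0 stands for the identity, g + h for the product gh
   and - g for the inverse.  The space 2^G is the function type 'g => bool: bool carries the
   discrete topology and function types the product topology of HOL-Analysis, so "closure" and
   "borel" refer to the product topology.
   A standard Borel space X is a term of type 'x measure of which only "space X" and "sets X" are
   used; functions on X are total functions on 'x whose values outside "space X" are ignored. *)

definition standard_borel :: "'x measure \<Rightarrow> bool" where
  "standard_borel X \<longleftrightarrow>
     (\<exists>T. completely_metrizable_space T \<and> separable_space T \<and> topspace T = space X \<and>
          sets X = sigma_sets (space X) {U. openin T U})"

definition borel_action :: "'x measure \<Rightarrow> ('g::group_add \<Rightarrow> 'x \<Rightarrow> 'x) \<Rightarrow> bool" where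
  "borel_action X act \<longleftrightarrow>
     (\<lambda>(g, x). act g x) \<in> (count_space UNIV \<Otimes>\<^sub>M X) \<rightarrow>\<^sub>M X \<and>
     (\<forall>x\<in>space X. act 0 x = x) \<and>
     (\<forall>g h. \<forall>x\<in>space X. act (g + h) x = act g (act h x))"

definition free_action :: "'x measure \<Rightarrow> ('g::group_add \<Rightarrow> 'x \<Rightarrow> 'x) \<Rightarrow> bool" where
  "free_action X act \<longleftrightarrow> (\<forall>x\<in>space X. \<forall>g. g \<noteq> 0 \<longrightarrow> act g x \<noteq> x)"

definition syndetic :: "'x measure \<Rightarrow> ('g::group_add \<Rightarrow> 'x \<Rightarrow> 'x) \<Rightarrow> 'x set \<Rightarrow> bool" where
  "syndetic X act S \<longleftrightarrow>
     S \<subseteq> space X \<and> (\<exists>F. finite F \<and> space X = (\<Union>g\<in>F. act g ` S))"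

definition shift :: "'g::group_add \<Rightarrow> ('g \<Rightarrow> bool) \<Rightarrow> ('g \<Rightarrow> bool)" where
  "shift g w = (\<lambda>h. w (- g + h))"

definition Free_part :: "('g::group_add \<Rightarrow> bool) set" where
  "Free_part = {w. \<forall>g. g \<noteq> 0 \<longrightarrow> shift g w \<noteq> w}"

definition borel_equivariant ::
    "'x measure \<Rightarrow> ('g::{group_add,countable} \<Rightarrow> 'x \<Rightarrow> 'x) \<Rightarrow> ('x \<Rightarrow> 'g \<Rightarrow> bool) \<Rightarrow> bool" where
  "borel_equivariant X act f \<longleftrightarrow>
     f \<in> X \<rightarrow>\<^sub>M borel \<and> (\<forall>g. \<forall>x\<in>space X. f (act g x) = shift g (f x))"

definition set_map :: "('g \<Rightarrow> 'x \<Rightarrow> 'x) \<Rightarrow> 'x set \<Rightarrow> 'x \<Rightarrow> 'g \<Rightarrow> bool" where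
  "set_map act A x = (\<lambda>g. x \<in> act g ` A)"

definition quasi_invariant :: "('g \<Rightarrow> 'x \<Rightarrow> 'x) \<Rightarrow> 'x measure \<Rightarrow> bool" where
  "quasi_invariant act \<mu> \<longleftrightarrow> (\<forall>g. \<forall>N\<in>null_sets \<mu>. act g ` N \<in> null_sets \<mu>)"

definition malg_rel :: "'x measure \<Rightarrow> ('x set \<times> 'x set) set" where
  "malg_rel \<mu> = {(A, B). A \<in> sets \<mu> \<and> B \<in> sets \<mu> \<and> sym_diff A B \<in> null_sets \<mu>}"

definition malg :: "'x measure \<Rightarrow> 'x set set set" where
  "malg \<mu> = sets \<mu> // malg_rel \<mu>"

definition malg_class :: "'x measure \<Rightarrow> 'x set \<Rightarrow> 'x set set" where
  "malg_class \<mu> A = malg_rel \<mu> `` {A}"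

(* The choice of representatives is immaterial, see malg_dist_class. *)
definition malg_dist :: "'x measure \<Rightarrow> 'x set set \<Rightarrow> 'x set set \<Rightarrow> real" where
  "malg_dist \<mu> P Q = measure \<mu> (sym_diff (SOME A. A \<in> P) (SOME B. B \<in> Q))"

definition malg_topology :: "'x measure \<Rightarrow> 'x set set topology" where
  "malg_topology \<mu> = Metric_space.mtopology (malg \<mu>) (malg_dist \<mu>)"

lemma equiv_malg_rel: "equiv (sets \<mu>) (malg_rel \<mu>)"
proof (rule equivI)
  show "malg_rel \<mu> \<subseteq> sets \<mu> \<times> sets \<mu>" by (auto simp: malg_rel_def)
  show "refl_on (sets \<mu>) (malg_rel \<mu>)" by (auto simp: refl_on_def malg_rel_def)
  show "sym (malg_rel \<mu>)" by (auto simp: sym_def malg_rel_def Un_commute)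
  show "trans (malg_rel \<mu>)"
  proof (rule transI)
    fix A B C assume "(A, B) \<in> malg_rel \<mu>" "(B, C) \<in> malg_rel \<mu>"
    then have s: "A \<in> sets \<mu>" "C \<in> sets \<mu>"
      and n: "sym_diff A B \<union> sym_diff B C \<in> null_sets \<mu>"
      by (auto simp: malg_rel_def)
    have "sym_diff A C \<in> null_sets \<mu>"
      by (rule null_sets_subset[OF n]) (use s in auto)
    then show "(A, C) \<in> malg_rel \<mu>" using s by (simp add: malg_rel_def)
  qed
qed

lemma malg_class_in: "A \<in> sets \<mu> \<Longrightarrow> malg_class \<mu> A \<in> malg \<mu>"
  by (auto simp: malg_class_def malg_def intro: quotientI)

lemma malg_cases:
  assumes "P \<in> malg \<mu>" obtains A where "A \<in> sets \<mu>" "P = malg_class \<mu> A"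
  using assms by (auto simp: malg_class_def malg_def elim: quotientE)

lemma malg_class_eq_iff:
  assumes "A \<in> sets \<mu>" "B \<in> sets \<mu>"
  shows "malg_class \<mu> A = malg_class \<mu> B \<longleftrightarrow> sym_diff A B \<in> null_sets \<mu>"
  using eq_equiv_class_iff[OF equiv_malg_rel assms] assms
  by (simp add: malg_class_def malg_rel_def)

lemma measure_sym_diff_triangle:
  assumes "finite_measure \<mu>" "A \<in> sets \<mu>" "B \<in> sets \<mu>" "C \<in> sets \<mu>"
  shows "measure \<mu> (sym_diff A C) \<le> measure \<mu> (sym_diff A B) + measure \<mu> (sym_diff B C)"
proof -
  interpret finite_measure \<mu> by fact
  have "measure \<mu> (sym_diff A C) \<le> measure \<mu> (sym_diff A B \<union> sym_diff B C)"
    by (rule finite_measure_mono) (use assms in auto)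
  also have "\<dots> \<le> measure \<mu> (sym_diff A B) + measure \<mu> (sym_diff B C)"
    by (rule measure_Un_le) (use assms in auto)
  finally show ?thesis .
qed

lemma malg_dist_class:
  assumes fin: "finite_measure \<mu>" and A: "A \<in> sets \<mu>" and B: "B \<in> sets \<mu>"
  shows "malg_dist \<mu> (malg_class \<mu> A) (malg_class \<mu> B) = measure \<mu> (sym_diff A B)"
proof -
  define A' where "A' = (SOME A'. A' \<in> malg_class \<mu> A)"
  define B' where "B' = (SOME B'. B' \<in> malg_class \<mu> B)"
  have "A \<in> malg_class \<mu> A" "B \<in> malg_class \<mu> B"
    using A B by (auto simp: malg_class_def malg_rel_def)
  then have "A' \<in> malg_class \<mu> A" "B' \<in> malg_class \<mu> B"
    unfolding A'_def B'_def by (metis someI)+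
  then have s: "A' \<in> sets \<mu>" "B' \<in> sets \<mu>"
    and "sym_diff A A' \<in> null_sets \<mu>" "sym_diff B B' \<in> null_sets \<mu>"
    by (auto simp: malg_class_def malg_rel_def)
  then have z: "measure \<mu> (sym_diff A A') = 0" "measure \<mu> (sym_diff A' A) = 0"
    "measure \<mu> (sym_diff B B') = 0" "measure \<mu> (sym_diff B' B) = 0"
    by (simp_all add: measure_def null_setsD1 Un_commute)
  have "measure \<mu> (sym_diff A' B') = measure \<mu> (sym_diff A B)"
    using measure_sym_diff_triangle[OF fin s(1) A s(2)] measure_sym_diff_triangle[OF fin A B s(2)]
      measure_sym_diff_triangle[OF fin A s(1) B] measure_sym_diff_triangle[OF fin s(1) s(2) B] z
    by linarith
  then show ?thesis by (simp add: malg_dist_def A'_def B'_def)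
qed

lemma Metric_space_malg:
  assumes fin: "finite_measure \<mu>"
  shows "Metric_space (malg \<mu>) (malg_dist \<mu>)"
proof
  interpret finite_measure \<mu> by fact
  show "0 \<le> malg_dist \<mu> P Q" for P Q by (simp add: malg_dist_def)
  show "malg_dist \<mu> P Q = malg_dist \<mu> Q P" for P Q by (simp add: malg_dist_def Un_commute)
  show "malg_dist \<mu> P Q = 0 \<longleftrightarrow> P = Q" if "P \<in> malg \<mu>" "Q \<in> malg \<mu>" for P Q
  proof -
    obtain A B where "A \<in> sets \<mu>" "P = malg_class \<mu> A" "B \<in> sets \<mu>" "Q = malg_class \<mu> B"
      using \<open>P \<in> malg \<mu>\<close> \<open>Q \<in> malg \<mu>\<close> by (metis malg_cases)
    then show ?thesis
      by (auto simp: malg_dist_class[OF fin] malg_class_eq_iff null_sets_def emeasure_eq_measure)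
  qed
  show "malg_dist \<mu> P R \<le> malg_dist \<mu> P Q + malg_dist \<mu> Q R"
    if "P \<in> malg \<mu>" "Q \<in> malg \<mu>" "R \<in> malg \<mu>" for P Q R
  proof -
    obtain A B C where "A \<in> sets \<mu>" "P = malg_class \<mu> A" "B \<in> sets \<mu>" "Q = malg_class \<mu> B"
      "C \<in> sets \<mu>" "R = malg_class \<mu> C"
      using \<open>P \<in> malg \<mu>\<close> \<open>Q \<in> malg \<mu>\<close> \<open>R \<in> malg \<mu>\<close> by (metis malg_cases)
    then show ?thesis
      by (simp add: malg_dist_class[OF fin] measure_sym_diff_triangle[OF fin])
  qed
qed

end

(*
  An equivariant map X -> 2^G is given by a Borel set A via f(x)(g) = [g^-1 x in A], and the closure
  of its image is free if for every g <> 1 there is a finite set E such that every x has some e in E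
  for which exactly one of ex and egx lies in A. Such an A is coloured in stages. Before each stage the
  uncoloured points form a syndetic set M; stage n deals with the n-th group element and with the n-th
  bit of w, and keeps a sparser but still syndetic subset of M uncoloured, so that the process never
  gets stuck. At a stage one chooses a sparse maximal discrete set of centres and colours the
  uncoloured points of M in a large finite window around each centre. A window contains b free points
  and a number of constraints polynomial in b, while each constraint excludes only an exponentially
  small fraction of the 2^b colourings. Since the blocks are sparse, each constraint involves at most
  two of them, and the blocks can be coloured one after the other along a countable Borel partition of
  the centres.

  For a quasi-invariant measure, A can be altered on an invariant null set, so the class of A is in the
  set of part (3) iff almost every point has a free image; this is a G_delta condition by absolute
  continuity, and it is dense because the complement of Y in (1) can have arbitrarily small measure.
*)
theory Submission
  imports Defs
begin

section \<open>Counting in finite blocks\<close>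

text \<open>The obstacle is Borel choice: every choice must be uniform over uncountably many orbits.
  A block has only finitely many patterns, so a good one can be selected measurably; and points
  within finitely many given displacements of each other can be separated by a countable Borel
  partition, so all blocks of one class can be coloured at once. Each stage guarantees its property
  for every \<open>B\<close> with \<open>agree_off M' A' B\<close>, that is, for every completion of
  the colouring. Hence a constraint may rely only on points coloured by the end of the stage, the
  open points must be so sparse that a window loses a bounded number of them, and the guarantees
  survive all later stages and the limit. The free parameter is \<open>k\<close>. Window sizes are
  linear in \<open>k\<close>, so the number of constraints is polynomial in \<open>k\<close> while
  each excludes at most the fraction 1 / 2^k; a plain union bound at each block then suffices. Open
  sets and finite tests are fixed before the colouring. Only the colouring depends on
  \<open>w\<close>, through finitely many bits at each stage, so all members of the family are
  compared by the same tests.\<close>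

lemma union_bound:
  assumes "finite V" "finite J" "card J < 2 ^ k"
    and bad: "\<And>j. j \<in> J \<Longrightarrow> card {q \<in> Pow V. bad j q} * 2 ^ k \<le> 2 ^ card V"
  shows "\<exists>q\<subseteq>V. \<forall>j\<in>J. \<not> bad j q"
proof (rule ccontr)
  assume "\<not> ?thesis"
  then have "Pow V \<subseteq> (\<Union>j\<in>J. {q \<in> Pow V. bad j q})" by blast
  then have "card (Pow V) \<le> card (\<Union>j\<in>J. {q \<in> Pow V. bad j q})"
    using assms(1,2) by (intro card_mono) auto
  also have "\<dots> \<le> (\<Sum>j\<in>J. card {q \<in> Pow V. bad j q})"
    by (rule card_UN_le[OF assms(2)])
  finally have "2 ^ card V * 2 ^ k \<le> (\<Sum>j\<in>J. card {q \<in> Pow V. bad j q} * 2 ^ k)"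
    using assms(1) by (simp add: card_Pow sum_distrib_right[symmetric])
  also have "\<dots> \<le> (\<Sum>j\<in>J. 2 ^ card V)" by (rule sum_mono) (rule bad)
  also have "\<dots> = card J * 2 ^ card V" by simp
  also have "\<dots> < 2 ^ k * 2 ^ card V" using assms(3) by simp
  finally show False by (simp add: mult.commute)
qed

text \<open>Erasing \<open>B\<close> is injective on \<open>F\<close>, so \<open>F\<close> has at
  most as many members as \<open>V - B\<close> has subsets. Each point whose colour is forced by the
  others halves the count.\<close>

lemma card_determined_le:
  assumes "finite V" "B \<subseteq> V" "k \<le> card B" "F \<subseteq> Pow V"
    and det: "\<And>p q. p \<in> F \<Longrightarrow> q \<in> F \<Longrightarrow> p - B = q - B \<Longrightarrow> p = q"
  shows "card F * 2 ^ k \<le> 2 ^ card V"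
proof -
  have "card F \<le> card (Pow (V - B))"
    using assms by (intro card_inj_on_le[where f="\<lambda>q. q - B"]) (auto simp: inj_on_def)
  also have "\<dots> = 2 ^ (card V - card B)"
    using assms by (simp add: card_Pow card_Diff_subset finite_subset)
  finally have "card F * 2 ^ k \<le> 2 ^ (card V - card B) * 2 ^ card B"
    by (intro mult_mono power_increasing assms) auto
  also have "\<dots> = 2 ^ card V"
    using card_mono[OF assms(1,2)] by (simp add: power_add[symmetric])
  finally show ?thesis .
qed

text \<open>Pairs may form chains, the end of one being the start of another. By injectivity an
  index is linked to at most one index on either side, so a greedy choice discards at most three
  indices for each one kept, itself included.\<close>

lemma ex_large_unlinked_subset:
  assumes "finite I" "inj_on u I" "inj_on v I" "\<And>i. i \<in> I \<Longrightarrow> u i \<noteq> v i"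
  shows "\<exists>J\<subseteq>I. card I \<le> 3 * card J \<and> u ` J \<inter> v ` J = {}"
  using assms
proof (induction "card I" arbitrary: I rule: less_induct)
  case less
  show ?case
  proof (cases "I = {}")
    case True
    then show ?thesis by auto
  next
    case False
    then obtain i where i: "i \<in> I" by blast
    define R where "R = {j\<in>I. j = i \<or> u j = v i \<or> v j = u i}"
    define I' where "I' = I - R"
    have R: "R = {i} \<union> {j\<in>I. u j = v i} \<union> {j\<in>I. v j = u i}" using i by (auto simp: R_def)
    have c1: "card {j\<in>I. u j = v i} \<le> 1" "card {j\<in>I. v j = u i} \<le> 1"
      using less.prems by (auto simp: card_le_Suc0_iff_eq inj_on_def)
    have "card R \<le> card {i} + card {j\<in>I. u j = v i} + card {j\<in>I. v j = u i}"
      unfolding R by (meson add_le_mono card_Un_le order_refl order_trans)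
    then have cR: "card R \<le> 3" using c1 by simp
    have RI: "R \<subseteq> I" "finite R" using less.prems(1) by (auto simp: R_def)
    have iR: "i \<in> R" using i by (auto simp: R_def)
    have "card I' < card I"
      unfolding I'_def using less.prems(1) iR i by (intro psubset_card_mono) auto
    moreover have "finite I'" "inj_on u I'" "inj_on v I'"
      using less.prems by (auto simp: I'_def inj_on_diff)
    ultimately obtain J where J: "J \<subseteq> I'" "card I' \<le> 3 * card J" "u ` J \<inter> v ` J = {}"
      using less.hyps[of I'] less.prems(4) by (auto simp: I'_def)
    have "card I \<le> card I' + 3"
      using cR RI less.prems(1) by (simp add: I'_def card_Diff_subset)
    moreover have "card (insert i J) = Suc (card J)"
      using J(1) \<open>finite I'\<close> iR by (subst card_insert_disjoint) (auto simp: I'_def finite_subset)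
    ultimately have "card I \<le> 3 * card (insert i J)" using J(2) by simp
    moreover have "u ` insert i J \<inter> v ` insert i J = {}"
      using J less.prems(4)[OF i] unfolding I'_def R_def by auto
    moreover have "insert i J \<subseteq> I" using i J(1) by (auto simp: I'_def)
    ultimately show ?thesis by blast
  qed
qed

text \<open>
  On the unlinked pairs the values at the points \<^term>\<open>u i\<close> are forced by the remaining values, so
  each of them halves the number of colourings.
\<close>
lemma card_pairs_agree_aux:
  assumes "finite V" "finite I" "inj_on u I" "inj_on v I"
    and ne: "\<And>i. i \<in> I \<Longrightarrow> u i \<noteq> v i"
    and V: "\<And>i. i \<in> I \<Longrightarrow> u i \<in> V"
    and k: "3 * k \<le> card I"
  shows "card {q \<in> Pow V. \<forall>i\<in>I. u i \<in> (a - V) \<union> q \<longleftrightarrow> v i \<in> (a - V) \<union> q} * 2 ^ k \<le> 2 ^ card V"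
proof -
  obtain J where J: "J \<subseteq> I" "card I \<le> 3 * card J" "u ` J \<inter> v ` J = {}"
    using ex_large_unlinked_subset[OF assms(2-4) ne] by blast
  have "card (u ` J) = card J" using J(1) assms(3) by (metis card_image inj_on_subset)
  then have "k \<le> card (u ` J)" using k J(2) by linarith
  moreover have "u ` J \<subseteq> V" using J(1) V by auto
  ultimately show ?thesis
  proof (intro card_determined_le[OF assms(1)])
    fix p q
    assume p: "p \<in> {q \<in> Pow V. \<forall>i\<in>I. (u i \<in> a - V \<union> q) = (v i \<in> a - V \<union> q)}"
      and q: "q \<in> {q \<in> Pow V. \<forall>i\<in>I. (u i \<in> a - V \<union> q) = (v i \<in> a - V \<union> q)}"
      and e: "p - u ` J = q - u ` J"
    have "u i \<in> p \<longleftrightarrow> u i \<in> q" if "i \<in> J" for i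
    proof -
      have "v i \<notin> u ` J" "i \<in> I" "u i \<in> V" using that J V by auto
      then show ?thesis using p q e by blast
    qed
    then show "p = q" using e by blast
  qed auto
qed

text \<open>A pair with only one end in \<open>V\<close> may have either end there. One of the two
  kinds makes up at least half of the pairs, and exchanging \<open>u\<close> and \<open>v\<close>
  treats both alike; this doubles the factor 3 to 6.\<close>

lemma card_pairs_agree:
  assumes "finite V" "finite I" "inj_on u I" "inj_on v I"
    and ne: "\<And>i. i \<in> I \<Longrightarrow> u i \<noteq> v i"
    and V: "\<And>i. i \<in> I \<Longrightarrow> u i \<in> V \<or> v i \<in> V"
    and k: "6 * k \<le> card I"
  shows "card {q \<in> Pow V. \<forall>i\<in>I. u i \<in> (a - V) \<union> q \<longleftrightarrow> v i \<in> (a - V) \<union> q} * 2 ^ k \<le> 2 ^ card V"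
    (is "card ?F * _ \<le> _")
proof -
  define Iu where "Iu = {i\<in>I. u i \<in> V}"
  define Iv where "Iv = {i\<in>I. v i \<in> V}"
  have "card I \<le> card Iu + card Iv"
    using V assms(2) by (intro order_trans[OF card_mono card_Un_le]) (auto simp: Iu_def Iv_def)
  then consider "3 * k \<le> card Iu" | "3 * k \<le> card Iv" using k by linarith
  then show ?thesis
  proof cases
    case 1
    have "card ?F \<le> card {q \<in> Pow V. \<forall>i\<in>Iu. u i \<in> (a - V) \<union> q \<longleftrightarrow> v i \<in> (a - V) \<union> q}"
      using assms(1) by (intro card_mono) (auto simp: Iu_def)
    then have "card ?F * 2 ^ k \<le> card {q \<in> Pow V. \<forall>i\<in>Iu. u i \<in> (a - V) \<union> q \<longleftrightarrow> v i \<in> (a - V) \<union> q} * 2 ^ k"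
      by simp
    also have "\<dots> \<le> 2 ^ card V"
      using assms(2-4) ne
      by (intro card_pairs_agree_aux 1 assms(1)) (auto simp: Iu_def inj_on_def)
    finally show ?thesis .
  next
    case 2
    have "card ?F \<le> card {q \<in> Pow V. \<forall>i\<in>Iv. v i \<in> (a - V) \<union> q \<longleftrightarrow> u i \<in> (a - V) \<union> q}"
      using assms(1) by (intro card_mono) (auto simp: Iv_def)
    then have "card ?F * 2 ^ k \<le> card {q \<in> Pow V. \<forall>i\<in>Iv. v i \<in> (a - V) \<union> q \<longleftrightarrow> u i \<in> (a - V) \<union> q} * 2 ^ k"
      by simp
    also have "\<dots> \<le> 2 ^ card V"
      using assms(2-4) ne[symmetric]
      by (intro card_pairs_agree_aux 2 assms(1)) (auto simp: Iv_def inj_on_def)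
    finally show ?thesis .
  qed
qed

text \<open>Choose one point of \<open>V\<close> in each \<open>P i\<close>. Disjointness makes
  these points distinct and puts only one of them into each set, so evenness forces its colour once
  the remaining colours are known. No factor is lost here.\<close>

lemma card_parities_even:
  assumes "finite V" "finite I"
    and disj: "\<And>i j. i \<in> I \<Longrightarrow> j \<in> I \<Longrightarrow> i \<noteq> j \<Longrightarrow> P i \<inter> P j = {}"
    and fin: "\<And>i. i \<in> I \<Longrightarrow> finite (P i)"
    and V: "\<And>i. i \<in> I \<Longrightarrow> P i \<inter> V \<noteq> {}"
    and k: "k \<le> card I"
  shows "card {q \<in> Pow V. \<forall>i\<in>I. even (card (P i \<inter> ((a - V) \<union> q)))} * 2 ^ k \<le> 2 ^ card V"
proof -
  have "\<forall>i\<in>I. \<exists>z. z \<in> P i \<inter> V" using V by blast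
  then obtain y where y: "\<And>i. i \<in> I \<Longrightarrow> y i \<in> P i \<inter> V" by (metis bchoice)
  have "inj_on y I" using y disj by (fastforce simp: inj_on_def)
  then have "k \<le> card (y ` I)" using k by (simp add: card_image)
  moreover have "y ` I \<subseteq> V" using y by auto
  ultimately show ?thesis
  proof (intro card_determined_le[OF assms(1)])
    fix p q
    assume p: "p \<in> {q \<in> Pow V. \<forall>i\<in>I. even (card (P i \<inter> (a - V \<union> q)))}"
      and q: "q \<in> {q \<in> Pow V. \<forall>i\<in>I. even (card (P i \<inter> (a - V \<union> q)))}"
      and e: "p - y ` I = q - y ` I"
    have "y i \<in> p \<longleftrightarrow> y i \<in> q" if i: "i \<in> I" for i
    proof -
      \<comment> \<open>The parity splits into the contribution of \<open>y i\<close> and that of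
        the points outside the representatives; \<open>p\<close> and \<open>q\<close> agree on the
        latter.\<close>
      have par: "even (card (P i \<inter> (a - V \<union> r))) \<longleftrightarrow>
        (y i \<in> r \<longleftrightarrow> odd (card (P i \<inter> (a - V \<union> (r - y ` I)))))" if "r \<subseteq> V" for r
      proof -
        have only: "z \<in> y ` I \<longleftrightarrow> z = y i" if "z \<in> P i" for z
          using y disj[OF i] i that by blast
        have "P i \<inter> (a - V \<union> r) = (if y i \<in> r then insert (y i) (P i \<inter> (a - V \<union> (r - y ` I)))
            else P i \<inter> (a - V \<union> (r - y ` I)))"
          using y[OF i] by (simp add: set_eq_iff) (metis only)
        moreover have "y i \<notin> P i \<inter> (a - V \<union> (r - y ` I))" using y i by auto
        ultimately show ?thesis using fin[OF i] by simp
      qed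
      show ?thesis using par[of p] par[of q] p q e i by auto
    qed
    then show "p = q" using e by blast
  qed auto
qed

text \<open>A finite set has finitely many traces, so an arbitrary condition \<open>Q\<close> on the
  trace, such as a cardinality bound or a parity, is a finite disjunction of measurable
  conditions.\<close>

lemma pred_finite_Collect:
  assumes "finite S" "\<And>s. s \<in> S \<Longrightarrow> Measurable.pred M (\<lambda>x. P s x)"
  shows "Measurable.pred M (\<lambda>x. Q {s\<in>S. P s x})"
proof -
  have "Q {s\<in>S. P s x} \<longleftrightarrow> (\<exists>L\<in>Pow S. Q L \<and> (\<forall>s\<in>S. P s x \<longleftrightarrow> s \<in> L))" for x
  proof
    assume "Q {s\<in>S. P s x}"
    then show "\<exists>L\<in>Pow S. Q L \<and> (\<forall>s\<in>S. P s x \<longleftrightarrow> s \<in> L)"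
      by (intro bexI[of _ "{s\<in>S. P s x}"]) auto
  next
    assume "\<exists>L\<in>Pow S. Q L \<and> (\<forall>s\<in>S. P s x \<longleftrightarrow> s \<in> L)"
    then obtain L where L: "L \<subseteq> S" "Q L" "\<forall>s\<in>S. P s x \<longleftrightarrow> s \<in> L" by blast
    then have "{s\<in>S. P s x} = L" by blast
    then show "Q {s\<in>S. P s x}" using L(2) by simp
  qed
  then show ?thesis using assms by simp
qed

lemma ex_poly_less_two_power: "\<exists>k>0. a * (b * k + c) ^ d < (2::nat) ^ k"
proof -
  \<comment> \<open>\<open>k\<close> is a multiple of \<open>e\<close> so that both sides become
    \<open>e\<close>-th powers and only \<open>C * (4 * C) < 2 ^ (4 * C)\<close> is left. Using
    \<open>Suc d\<close> and \<open>Suc a\<close> keeps \<open>e\<close> and \<open>C\<close>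
    positive and lets the factor \<open>a\<close> be absorbed into the power.\<close>
  define e where "e = Suc d"
  define C where "C = Suc a * (b + c + 1) * e"
  define k where "k = e * (4 * C)"
  have pos: "e > 0" "C > 0" "k > 0" by (simp_all add: e_def C_def k_def)
  have "a * (b * k + c) ^ d \<le> Suc a ^ e * ((b + c + 1) * k) ^ e"
  proof (rule mult_mono)
    show "a \<le> Suc a ^ e" using power_increasing[of 1 e "Suc a"] pos by simp
    have "c \<le> c * k" using pos by simp
    then have "b * k + c \<le> (b + c + 1) * k" unfolding add_mult_distrib by linarith
    moreover have "1 \<le> (b + c + 1) * k" using pos by simp
    ultimately have "(b * k + c) ^ d \<le> ((b + c + 1) * k) ^ d" "((b + c + 1) * k) ^ d \<le> ((b + c + 1) * k) ^ e"
      by (auto simp: e_def intro: power_mono power_increasing)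
    then show "(b * k + c) ^ d \<le> ((b + c + 1) * k) ^ e" by (rule order_trans)
  qed auto
  also have "\<dots> = (C * (4 * C)) ^ e"
    by (simp add: power_mult_distrib[symmetric] k_def C_def algebra_simps)
  also have "\<dots> < (2 ^ (4 * C)) ^ e"
  proof (rule power_strict_mono)
    have "C * (4 * C) = (2 * C) ^ 2" by (simp add: power2_eq_square)
    also have "\<dots> < (2 ^ (2 * C)) ^ 2"
      using less_exp[of "2 * C"] by (intro power_strict_mono) auto
    also have "\<dots> = 2 ^ (4 * C)" by (simp add: power_mult[symmetric])
    finally show "C * (4 * C) < 2 ^ (4 * C)" .
  qed (use pos in auto)
  also have "\<dots> = 2 ^ k" by (simp add: k_def power_mult[symmetric] mult.commute)
  finally show ?thesis using pos by blast
qed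

section \<open>Discrete Borel sets and choices on blocks\<close>

text \<open>Balls of radius 1 / (n + 1) around a countable dense set. A countable separating family
  is the form in which the standard Borel structure enters the construction.\<close>

lemma standard_borel_separating:
  assumes "standard_borel X"
  obtains B :: "nat \<Rightarrow> 'x set" where "\<And>n. B n \<in> sets X"
    "\<And>x y. x \<in> space X \<Longrightarrow> y \<in> space X \<Longrightarrow> x \<noteq> y \<Longrightarrow> \<exists>n. x \<in> B n \<and> y \<notin> B n"
proof -
  obtain T where T: "completely_metrizable_space T" "separable_space T" "topspace T = space X"
    and sX: "sets X = sigma_sets (space X) {U. openin T U}"
    using assms unfolding standard_borel_def by blast
  obtain M d where Md: "Metric_space M d" "T = Metric_space.mtopology M d"
    using T(1) unfolding completely_metrizable_space_def by blast
  interpret Metric_space M d by fact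
  have M: "M = space X" using T(3) Md(2) by simp
  obtain C where C: "countable C" "C \<subseteq> M" "mtopology closure_of C = M"
    using T(2) Md(2) unfolding separable_space_def by auto
  \<comment> \<open>The empty set is added so that \<open>from_nat_into\<close> has a nonempty range
    to enumerate even when the space is empty.\<close>
  define F where "F = insert {} ((\<lambda>(c, n). mball c (1 / real (Suc n))) ` (C \<times> UNIV))"
  have F: "countable F" "F \<noteq> {}" unfolding F_def using C(1) by auto
  show thesis
  proof (rule that[of "from_nat_into F"])
    fix n
    have "from_nat_into F n \<in> F" by (rule from_nat_into[OF F(2)])
    then have "openin T (from_nat_into F n)" unfolding F_def Md(2) by auto
    then show "from_nat_into F n \<in> sets X" unfolding sX by blast
  next
    fix x y assume xy: "x \<in> space X" "y \<in> space X" "x \<noteq> y"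
    then have "d x y > 0" using M by simp
    then obtain n where n: "1 / real (Suc n) < d x y / 2"
      using nat_approx_posE[of "d x y / 2"] by auto
    have "x \<in> mtopology closure_of C" using C xy M by simp
    then have dense: "\<forall>r>0. \<exists>y\<in>C. y \<in> mball x r" unfolding metric_closure_of by blast
    have "\<exists>c\<in>C. c \<in> mball x (1 / real (Suc n))" by (rule dense[rule_format]) simp
    then obtain c where c: "c \<in> C" "c \<in> mball x (1 / real (Suc n))" by blast
    have cM: "c \<in> M" using c C by auto
    have "mball c (1 / real (Suc n)) \<in> F" using c unfolding F_def by auto
    moreover have "x \<in> mball c (1 / real (Suc n))" using c by (simp add: commute)
    moreover have "y \<notin> mball c (1 / real (Suc n))"
    proof
      assume "y \<in> mball c (1 / real (Suc n))"
      then have "d x c < 1 / real (Suc n)" "d c y < 1 / real (Suc n)" using c(2) by (auto simp only: in_mball)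
      moreover have "d x y \<le> d x c + d c y" using triangle xy M cM by blast
      ultimately show False using n by linarith
    qed
    ultimately show "\<exists>n. x \<in> from_nat_into F n \<and> y \<notin> from_nat_into F n"
      by (metis F(1) from_nat_into_surj)
  qed
qed

section \<open>Free Borel actions, discrete Borel sets and simultaneous choice on blocks\<close>

locale free_borel_action =
  fixes X :: "'x measure" and act :: "'g::{group_add,countable} \<Rightarrow> 'x \<Rightarrow> 'x"
  assumes infinite_group: "infinite (UNIV :: 'g set)"
    and standard: "standard_borel X"
    and borel_act: "borel_action X act"
    and free_act: "free_action X act"
begin

lemma act_measurable [measurable]: "act g \<in> X \<rightarrow>\<^sub>M X"
proof -
  have "(\<lambda>(g, x). act g x) \<circ> Pair g \<in> X \<rightarrow>\<^sub>M X"
    using borel_act unfolding borel_action_def by (intro measurable_comp[OF measurable_Pair1']) auto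
  then show ?thesis by (simp add: comp_def)
qed

lemma act_space [simp]: "x \<in> space X \<Longrightarrow> act g x \<in> space X"
  by (rule measurable_space[OF act_measurable])

lemma act_zero [simp]: "x \<in> space X \<Longrightarrow> act 0 x = x"
  using borel_act unfolding borel_action_def by blast

lemma act_act [simp]: "x \<in> space X \<Longrightarrow> act g (act h x) = act (g + h) x"
  using borel_act unfolding borel_action_def by simp

lemma act_eq_iff: "x \<in> space X \<Longrightarrow> y \<in> space X \<Longrightarrow> act g x = act h y \<longleftrightarrow> y = act (- h + g) x"
proof
  assume "x \<in> space X" "y \<in> space X" "act g x = act h y"
  then have "act (- h) (act h y) = act (- h) (act g x)" by simp
  then show "y = act (- h + g) x" using \<open>x \<in> space X\<close> \<open>y \<in> space X\<close> by simp
qed (simp add: add.assoc[symmetric])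

lemma act_inject [simp]: "x \<in> space X \<Longrightarrow> act g x = act h x \<longleftrightarrow> g = h"
proof
  assume x: "x \<in> space X" and "act g x = act h x"
  then have "act (- h + g) x = x" using act_eq_iff[of x x g h] by simp
  then have "- h + g = 0" using free_act x unfolding free_action_def by blast
  then show "g = h" by (metis add.right_neutral add_minus_cancel)
qed simp

text \<open>If \<open>T\<close> contains all differences - s + s' of elements of a window
  \<open>S\<close>, then discreteness says that the windows around distinct points of
  \<open>C\<close> are disjoint.\<close>

definition discrete :: "'g set \<Rightarrow> 'x set \<Rightarrow> bool" where
  "discrete T C \<longleftrightarrow> (\<forall>c\<in>C. \<forall>t\<in>T. act t c \<in> C \<longrightarrow> t = 0)"

lemma discreteD: "discrete T C \<Longrightarrow> c \<in> C \<Longrightarrow> act t c \<in> C \<Longrightarrow> t \<in> T \<Longrightarrow> t = 0"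
  by (auto simp: discrete_def)

lemma discrete_mono: "discrete T C \<Longrightarrow> T' \<subseteq> T \<Longrightarrow> C' \<subseteq> C \<Longrightarrow> discrete T' C'"
  by (auto simp: discrete_def)

text \<open>By freeness \<open>x\<close> differs from its finitely many translates by nonzero
  elements of \<open>T\<close>, so some finite intersection of separating sets contains
  \<open>x\<close> and none of them. There are only countably many finite intersections; each is cut
  down to its points having no other translate in it.\<close>

lemma countable_discrete_cover:
  assumes "finite T"
  obtains B :: "nat \<Rightarrow> 'x set" where "\<And>n. B n \<in> sets X" "\<And>n. discrete T (B n)" "space X = (\<Union>n. B n)"
proof -
  obtain S :: "nat \<Rightarrow> 'x set" where S [measurable]: "\<And>n. S n \<in> sets X"
    and sep: "\<And>x y. x \<in> space X \<Longrightarrow> y \<in> space X \<Longrightarrow> x \<noteq> y \<Longrightarrow> \<exists>n. x \<in> S n \<and> y \<notin> S n"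
    using standard_borel_separating[OF standard] by metis
  define e where "e = from_nat_into {J :: nat set. finite J}"
  have cnt: "countable {J :: nat set. finite J}" by (rule countable_Collect_finite)
  have fin: "finite (e n)" for n
    using from_nat_into[of "{J :: nat set. finite J}" n] by (auto simp: e_def)
  define P where "P J x \<longleftrightarrow> x \<in> space X \<and> (\<forall>n\<in>J. x \<in> S n)" for J x
  define B where "B n = {x \<in> space X. P (e n) x \<and> (\<forall>t\<in>T - {0}. \<not> P (e n) (act t x))}" for n
  show thesis
  proof (rule that[of B])
    show "B n \<in> sets X" for n
      unfolding B_def P_def by measurable
    show "discrete T (B n)" for n
      by (auto simp: discrete_def B_def)
    show "space X = (\<Union>n. B n)"
    proof (intro equalityI subsetI)
      fix x assume x: "x \<in> space X"
      have "\<forall>t\<in>T - {0}. \<exists>n. x \<in> S n \<and> act t x \<notin> S n"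
      proof
        fix t assume "t \<in> T - {0}"
        then have "act t x \<noteq> act 0 x" using x by (subst act_inject) auto
        then show "\<exists>n. x \<in> S n \<and> act t x \<notin> S n" using x by (intro sep) auto
      qed
      then obtain f where f: "\<forall>t\<in>T - {0}. x \<in> S (f t) \<and> act t x \<notin> S (f t)"
        by (auto dest: bchoice)
      have "f ` (T - {0}) \<in> {J. finite J}" using assms by simp
      from from_nat_into_surj[OF cnt this] obtain n where "e n = f ` (T - {0})"
        unfolding e_def ..
      then have "x \<in> B n" using x f by (auto simp: B_def P_def)
      then show "x \<in> (\<Union>n. B n)" by blast
    qed (auto simp: B_def)
  qed
qed

text \<open>A greedy construction in countably many rounds. In round \<open>n\<close> all admissible
  points of \<open>B n\<close> enter together, which is safe because \<open>B n\<close> is itself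
  discrete. Conflicts between rounds are excluded from the side of the later point, and symmetry of
  \<open>T\<close> covers both directions.\<close>

lemma maximal_discrete_subset:
  assumes T: "finite T" "0 \<in> T" "\<And>t. t \<in> T \<Longrightarrow> - t \<in> T" and M [measurable]: "M \<in> sets X"
  obtains C where "C \<in> sets X" "C \<subseteq> M" "discrete T C" "\<And>x. x \<in> M \<Longrightarrow> \<exists>t\<in>T. act t x \<in> C"
proof -
  obtain B :: "nat \<Rightarrow> 'x set" where B [measurable]: "\<And>n. B n \<in> sets X"
    and disc: "\<And>n. discrete T (B n)" and cover: "space X = (\<Union>n. B n)"
    using countable_discrete_cover[OF T(1)] by blast
  define step where "step n I = {x \<in> space X. x \<in> B n \<and> x \<in> M \<and> (\<forall>t\<in>T. act t x \<notin> I)}" for n I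
  define I where "I = rec_nat {} (\<lambda>n I. I \<union> step n I)"
  have I0: "I 0 = {}" and ISuc: "I (Suc n) = I n \<union> step n (I n)" for n
    by (simp_all add: I_def)
  have sets: "I n \<in> sets X" for n
  proof (induction n)
    case (Suc n)
    note Suc [measurable]
    have "step n (I n) \<in> sets X" unfolding step_def by measurable
    with Suc show ?case by (simp add: ISuc)
  qed (simp add: I0)
  have mono: "n \<le> k \<Longrightarrow> I n \<subseteq> I k" for n k
    by (rule lift_Suc_mono_le[where f=I]) (auto simp: ISuc)
  have enter: "\<exists>n. x \<in> step n (I n)" if "x \<in> I k" for x k
    using that by (induction k) (auto simp: I0 ISuc)
  show thesis
  proof (rule that[of "\<Union>n. I n"])
    show "(\<Union>n. I n) \<in> sets X" using sets by blast
    show "(\<Union>n. I n) \<subseteq> M" using enter by (fastforce simp: step_def)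
    show "discrete T (\<Union>n. I n)"
      unfolding discrete_def
    proof (intro ballI impI)
      fix c t assume "c \<in> (\<Union>n. I n)" "act t c \<in> (\<Union>n. I n)" and t: "t \<in> T"
      then obtain n k where n: "c \<in> step n (I n)" and k: "act t c \<in> step k (I k)"
        using enter by blast
      have c: "c \<in> space X" using n by (simp add: step_def)
      consider "n = k" | "n < k" | "k < n" by linarith
      then show "t = 0"
      proof cases
        case 1
        then show ?thesis using n k disc[of n] t by (auto simp: step_def dest: discreteD)
      next
        case 2
        then have "c \<in> I k" using n mono[of "Suc n" k] ISuc by auto
        moreover have "act (- t) (act t c) \<notin> I k" using k T(3)[OF t] by (auto simp: step_def)
        ultimately show ?thesis using c by simp
      next
        case 3
        then have "act t c \<in> I n" using k mono[of "Suc k" n] ISuc by auto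
        then show ?thesis using n t by (auto simp: step_def)
      qed
    qed
    fix x assume x: "x \<in> M"
    then have xs: "x \<in> space X" using sets.sets_into_space[OF M] by blast
    then obtain n where n: "x \<in> B n" using cover by blast
    show "\<exists>t\<in>T. act t x \<in> (\<Union>n. I n)"
    proof (cases "\<exists>t\<in>T. act t x \<in> I n")
      case False
      then have "x \<in> I (Suc n)" using x xs n by (auto simp: ISuc step_def)
      then show ?thesis using T(2) xs by (intro bexI[of _ 0]) auto
    qed blast
  qed
qed

definition block :: "'g set \<Rightarrow> 'x set \<Rightarrow> 'x \<Rightarrow> 'x set" where
  "block S D c = {y \<in> D. \<exists>s\<in>S. y = act s c}"

text \<open>
  There are finitely many patterns on a block. The trace of a fixed pattern on all blocks at once is a
  Borel set, so by locality the centres for which a given pattern is good form a Borel set.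
\<close>
lemma block_choice:
  assumes S: "finite S" "S \<subseteq> W"
    and [measurable]: "A \<in> sets X" "C \<in> sets X" "D \<in> sets X"
    and disj: "\<And>c c' s w. c \<in> C \<Longrightarrow> c' \<in> C \<Longrightarrow> s \<in> S \<Longrightarrow> w \<in> W \<Longrightarrow> act s c = act w c' \<Longrightarrow> c = c'"
    and meas: "\<And>A. A \<in> sets X \<Longrightarrow> {x \<in> space X. good x A} \<in> sets X"
    and loc: "\<And>c A B. c \<in> C \<Longrightarrow> (\<And>w. w \<in> W \<Longrightarrow> act w c \<in> A \<longleftrightarrow> act w c \<in> B) \<Longrightarrow> good c A \<Longrightarrow> good c B"
    and ex: "\<And>c. c \<in> C \<Longrightarrow> \<exists>q\<subseteq>block S D c. good c ((A - block S D c) \<union> q)"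
  obtains A' where "A' \<in> sets X" "\<And>x. \<forall>c\<in>C. x \<notin> block S D c \<Longrightarrow> x \<in> A' \<longleftrightarrow> x \<in> A"
    "\<And>c. c \<in> C \<Longrightarrow> good c A'"
proof -
  have CX: "c \<in> space X" if "c \<in> C" for c
    using that sets.sets_into_space[of C X] by auto
  \<comment> \<open>All blocks are recoloured at once: the point \<open>act s c\<close> of
    \<open>D\<close> receives the colour \<open>P s c\<close>, its centre being recovered as
    \<open>act (- s) x\<close>.\<close>
  define upd where "upd P = {x \<in> space X. (x \<in> A \<and> \<not> (x \<in> D \<and> (\<exists>s\<in>S. act (- s) x \<in> C))) \<or>
    (x \<in> D \<and> (\<exists>s\<in>S. act (- s) x \<in> C \<and> P s (act (- s) x)))}" for P
  have upd_block: "act s c \<in> upd P \<longleftrightarrow> P s c"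
    if c: "c \<in> C" and s: "s \<in> S" and D: "act s c \<in> D" for c s P
  proof
    assume "act s c \<in> upd P"
    moreover have "act (- s) (act s c) \<in> C" using CX[OF c] c by simp
    ultimately obtain s' where s': "s' \<in> S" "act (- s') (act s c) \<in> C" "P s' (act (- s') (act s c))"
      using s D unfolding upd_def by blast
    have "act s c = act s' (act (- s') (act s c))" using CX[OF c] by (simp add: add.assoc[symmetric])
    then have "act (- s') (act s c) = c" using disj[of c "act (- s') (act s c)" s s'] s' c s S by auto
    moreover from this have "s' = s"
      using CX[OF c] act_inject[of c "- s' + s" 0] by (simp add: neg_eq_iff_add_eq_0[symmetric])
    ultimately show "P s c" using s' by simp
  qed (use c s D CX in \<open>auto simp: upd_def intro!: bexI[of _ s]\<close>)
  \<comment> \<open>By \<open>disj\<close> the block of another centre never reaches the window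
    \<open>W\<close> of \<open>c\<close>, so within this window only the block of \<open>c\<close>
    itself changes.\<close>
  have upd_off: "act w c \<in> upd P \<longleftrightarrow> act w c \<in> A"
    if c: "c \<in> C" and w: "w \<in> W" and n: "act w c \<notin> block S D c" for c w P
  proof -
    have "\<not> (act w c \<in> D \<and> act (- s) (act w c) \<in> C)" if s: "s \<in> S" for s
    proof
      assume a: "act w c \<in> D \<and> act (- s) (act w c) \<in> C"
      have "act s (act (- s) (act w c)) = act w c" using CX[OF c] by (simp add: add.assoc[symmetric])
      then have "act (- s) (act w c) = c" using disj[of "act (- s) (act w c)" c s w] a c s w by auto
      then have "act w c = act s c" using CX[OF c] by (metis \<open>act s (act (- s) (act w c)) = act w c\<close>)
      then show False using n a s by (auto simp: block_def)
    qed
    then show ?thesis using CX[OF c] by (auto simp: upd_def)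
  qed
  have cong: "act w c \<in> upd P \<longleftrightarrow> act w c \<in> upd Q"
    if "c \<in> C" "w \<in> W" "\<And>s. s \<in> S \<Longrightarrow> P s c \<longleftrightarrow> Q s c" for c w P Q
  proof (cases "act w c \<in> block S D c")
    case True
    then obtain s where "s \<in> S" "act w c = act s c" "act s c \<in> D" by (auto simp: block_def)
    then show ?thesis using that upd_block by simp
  qed (use that upd_off in simp)
  \<comment> \<open>The finitely many patterns are enumerated along the naturals, so that
    \<open>disjointed\<close> gives each centre the first pattern that is good for it, in a Borel
    way.\<close>
  define e where "e = from_nat_into (Pow S)"
  have e: "range e = Pow S" 
    using S(1) unfolding e_def by (intro range_from_nat_into) (auto intro: countable_finite)
  define Cp where "Cp i = {c \<in> space X. c \<in> C \<and> good c (upd (\<lambda>s _. s \<in> e i))}" for i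
  have upd_sets: "upd (\<lambda>s _. s \<in> E) \<in> sets X" for E unfolding upd_def by measurable
  have Cp [measurable]: "Cp i \<in> sets X" for i
  proof -
    have "Cp i = C \<inter> {c \<in> space X. good c (upd (\<lambda>s _. s \<in> e i))}" by (auto simp: Cp_def)
    then show ?thesis using meas[OF upd_sets] by auto
  qed
  have Cd [measurable]: "disjointed Cp i \<in> sets X" for i
    using sets.range_disjointed_sets[of Cp X] Cp by (metis image_subset_iff iso_tuple_UNIV_I)
  define A' where "A' = upd (\<lambda>s c. \<exists>i. c \<in> disjointed Cp i \<and> s \<in> e i)"
  show thesis
  proof (rule that[of A'])
    show "A' \<in> sets X" unfolding A'_def upd_def by measurable
    show "x \<in> A' \<longleftrightarrow> x \<in> A" if n: "\<forall>c\<in>C. x \<notin> block S D c" for x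
    proof -
      have "\<not> (x \<in> D \<and> act (- s) x \<in> C)" if "s \<in> S" "x \<in> space X" for s
      proof
        assume a: "x \<in> D \<and> act (- s) x \<in> C"
        then have "x \<in> block S D (act (- s) x)" using that by (auto simp: block_def intro!: bexI[of _ s])
        then show False using n a by blast
      qed
      then show ?thesis using sets.sets_into_space[of A X] by (auto simp: A'_def upd_def)
    qed
    fix c assume c: "c \<in> C"
    obtain q where q: "q \<subseteq> block S D c" "good c ((A - block S D c) \<union> q)" using ex[OF c] by blast
    have "{s\<in>S. act s c \<in> q} \<in> range e" using e by auto
    then obtain k where k: "{s\<in>S. act s c \<in> q} = e k" by (rule rangeE)
    have "good c (upd (\<lambda>s _. s \<in> e k))"
    proof (rule loc[OF c _ q(2)])
      fix w assume w: "w \<in> W"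
      show "act w c \<in> A - block S D c \<union> q \<longleftrightarrow> act w c \<in> upd (\<lambda>s _. s \<in> e k)"
      proof (cases "act w c \<in> block S D c")
        case True
        then obtain s where "s \<in> S" "act w c = act s c" "act s c \<in> D" by (auto simp: block_def)
        then show ?thesis using c k[symmetric] True upd_block[of c s] by simp
      next
        case False
        then show ?thesis using c w q(1) upd_off by auto
      qed
    qed
    then have "c \<in> (\<Union>i. disjointed Cp i)" unfolding UN_disjointed_eq using c CX by (auto simp: Cp_def)
    then obtain i where i: "c \<in> disjointed Cp i" by blast
    have u: "j = i" if "c \<in> disjointed Cp j" for j
      using disjoint_family_disjointed[of Cp] i that unfolding disjoint_family_on_def by blast
    have gi: "good c (upd (\<lambda>s _. s \<in> e i))" using i disjointed_subset[of Cp i] by (auto simp: Cp_def)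
    show "good c A'"
    proof (rule loc[OF c _ gi])
      fix w assume w: "w \<in> W"
      show "act w c \<in> upd (\<lambda>s _. s \<in> e i) \<longleftrightarrow> act w c \<in> A'"
        unfolding A'_def by (rule cong[OF c w]) (use i u in blast)
    qed
  qed
qed

end

section \<open>Breaking a period\<close>

definition sumset :: "'a::plus set \<Rightarrow> 'a set \<Rightarrow> 'a set" (infixl "\<oplus>" 65) where
  "A \<oplus> B = (\<lambda>(a, b). a + b) ` (A \<times> B)"

lemma sumsetI: "a \<in> A \<Longrightarrow> b \<in> B \<Longrightarrow> a + b \<in> A \<oplus> B"
  by (auto simp: sumset_def)

lemma sumsetE: "c \<in> A \<oplus> B \<Longrightarrow> (\<And>a b. c = a + b \<Longrightarrow> a \<in> A \<Longrightarrow> b \<in> B \<Longrightarrow> P) \<Longrightarrow> P"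
  by (auto simp: sumset_def)

lemma finite_sumset [simp]: "finite A \<Longrightarrow> finite B \<Longrightarrow> finite (A \<oplus> B)"
  by (simp add: sumset_def)

lemma card_sumset_le: "finite A \<Longrightarrow> finite B \<Longrightarrow> card (A \<oplus> B) \<le> card A * card B"
  unfolding sumset_def by (metis card_cartesian_product card_image_le finite_cartesian_product)

context free_borel_action begin

text \<open>Here \<open>M\<close> is the set of points whose colour is still open; \<open>B\<close>
  ranges over the possible completions.\<close>

definition agree_off :: "'x set \<Rightarrow> 'x set \<Rightarrow> 'x set \<Rightarrow> bool" where
  "agree_off M A B \<longleftrightarrow> (\<forall>x\<in>space X - M. x \<in> A \<longleftrightarrow> x \<in> B)"

lemma agree_offD: "agree_off M A B \<Longrightarrow> x \<in> space X \<Longrightarrow> x \<notin> M \<Longrightarrow> x \<in> A \<longleftrightarrow> x \<in> B"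
  by (auto simp: agree_off_def)

lemma agree_off_trans:
  "agree_off M A B \<Longrightarrow> agree_off M' B C \<Longrightarrow> M \<subseteq> M'' \<Longrightarrow> M' \<subseteq> M'' \<Longrightarrow> agree_off M'' A C"
  by (auto simp: agree_off_def)

lemma block_finite: "finite S \<Longrightarrow> finite (block S D c)"
  by (rule finite_subset[of _ "(\<lambda>s. act s c) ` S"]) (auto simp: block_def)

lemma act_in_block_iff: "c \<in> space X \<Longrightarrow> act e c \<in> block S D c \<longleftrightarrow> e \<in> S \<and> act e c \<in> D"
  by (auto simp: block_def)

text \<open>
  The pattern at \<^term>\<open>c\<close> is to be distinguished from the pattern at \<^term>\<open>act \<gamma> c\<close>. By the uniqueness
  hypothesis the translate of the window at \<^term>\<open>act \<gamma> c\<close> meets at most one block. So among the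
  \<^term>\<open>12 * k\<close> pairs of points either half is settled as soon as the block of \<^term>\<open>c\<close> is coloured,
  or half is settled when the later one of two blocks is coloured. The block coloured last takes care
  of the constraint; it has fewer than \<^term>\<open>2 ^ k\<close> constraints, each violated by at most the fraction
  \<^term>\<open>1 / 2 ^ k\<close> of its colourings. The set \<^term>\<open>P\<close> consists of points whose colour stays open.
\<close>
lemma greedy_pairs:
  assumes S: "finite S" and \<Gamma>: "finite \<Gamma>" "0 \<notin> \<Gamma>"
    and [measurable]: "C \<in> sets X" "D \<in> sets X" "P \<in> sets X" and A: "A \<in> sets X"
    and DP: "D \<inter> P = {}"
    and unique: "\<And>y c c' s s' t t'. y \<in> space X \<Longrightarrow> c \<in> C \<Longrightarrow> c' \<in> C \<Longrightarrow> s \<in> S \<Longrightarrow> s' \<in> S \<Longrightarrow>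
      t \<in> S \<Longrightarrow> t' \<in> S \<Longrightarrow> act s y = act t c \<Longrightarrow> act s' y = act t' c' \<Longrightarrow> c = c'"
    and N: "N = insert 0 (uminus ` \<Gamma> \<oplus> (uminus ` S \<oplus> S))"
    and k: "0 < k" "card N * card \<Gamma> < 2 ^ k"
    and count: "\<And>c \<gamma>. c \<in> C \<Longrightarrow> \<gamma> \<in> \<Gamma> \<Longrightarrow> 12 * k \<le> card {s\<in>S. act s c \<in> D \<and> act (s + \<gamma>) c \<notin> P}"
  obtains A' where "A' \<in> sets X" "agree_off D A A'"
    "\<And>B c \<gamma>. agree_off P A' B \<Longrightarrow> c \<in> C \<Longrightarrow> \<gamma> \<in> \<Gamma> \<Longrightarrow> \<exists>s\<in>S. (act s c \<in> B) \<noteq> (act (s + \<gamma>) c \<in> B)"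
proof -
  have CX: "c \<in> space X" if "c \<in> C" for c
    using that sets.sets_into_space[of C X] by auto
  have finN: "finite N" using S \<Gamma> N by simp
  \<comment> \<open>\<open>N\<close> contains every displacement from a centre to another one whose
    translated window meets its block. So \<open>W\<close> contains all positions that a constraint
    charged to a centre may inspect.\<close>
  define W where "W = (S \<oplus> insert 0 \<Gamma>) \<oplus> N"
  have W1: "s + \<delta> \<in> W" if "s \<in> S" "\<delta> \<in> N" for s \<delta>
    using sumsetI[OF sumsetI[of s S 0 "insert 0 \<Gamma>"] that(2)] that by (simp add: W_def)
  have W2: "s + \<gamma> + \<delta> \<in> W" if "s \<in> S" "\<delta> \<in> N" "\<gamma> \<in> \<Gamma>" for s \<gamma> \<delta>
    using that by (auto simp: W_def intro!: sumsetI)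
  have SW: "S \<subseteq> W" using W1[of _ 0] N by auto
  have finW: "finite W" using S \<Gamma> finN by (simp add: W_def)
  \<comment> \<open>Discreteness for the differences - s + w keeps the blocks of one class out of
    each other's windows \<open>W\<close>; hence each class can be coloured in a single
    step.\<close>
  obtain B0 :: "nat \<Rightarrow> 'x set" where B0: "\<And>n. B0 n \<in> sets X" "\<And>n. discrete (uminus ` S \<oplus> W) (B0 n)"
    "space X = (\<Union>n. B0 n)"
    using countable_discrete_cover[of "uminus ` S \<oplus> W"] S finW by auto
  define R where "R = disjointed B0"
  have R [measurable]: "R n \<in> sets X" for n
    unfolding R_def using sets.range_disjointed_sets[of B0 X] B0(1) by (metis image_subset_iff iso_tuple_UNIV_I)
  have R_disc: "discrete (uminus ` S \<oplus> W) (R n)" for n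
    unfolding R_def by (rule discrete_mono[OF B0(2)[of n]]) (auto intro: disjointed_subset[THEN subsetD])
  have R_cover: "\<exists>n. c \<in> R n" if "c \<in> space X" for c
    using that B0(3) UN_disjointed_eq[of B0] by (auto simp: R_def)
  have R_unique: "n = j" if "c \<in> R n" "c \<in> R j" for c n j
    using disjoint_family_disjointed[of B0] that unfolding R_def disjoint_family_on_def by blast
  \<comment> \<open>the points not yet coloured before stage \<open>n\<close>\<close>
  define und where "und n y \<longleftrightarrow> y \<in> D \<and> (\<exists>s\<in>S. act (- s) y \<in> C \<and> (\<exists>j. n \<le> j \<and> act (- s) y \<in> R j))" for n y
  \<comment> \<open>The points whose colour is final before stage \<open>n\<close>: neither reserved
    nor waiting for their block.\<close>
  define Q where "Q n = {y \<in> space X. y \<notin> P \<and> \<not> und n y}" for n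
  have [measurable]: "Q n \<in> sets X" for n unfolding Q_def und_def by measurable
  have und_mono: "und j y" if "und n y" "j \<le> n" for n j y
    using that unfolding und_def by (meson order_trans)
  have block_act: "\<exists>s\<in>S. y = act s c \<and> act (- s) y = c" if "y \<in> block S D c" "c \<in> C" for y c
    using that CX by (auto simp: block_def)
  have und_block: "und n y" if y: "y \<in> block S D c" and c: "c \<in> C" "c \<in> R n" for n y c
  proof -
    obtain s where "s \<in> S" "act (- s) y = c" using block_act[OF y c(1)] by blast
    moreover have "y \<in> D" using y by (simp add: block_def)
    ultimately show ?thesis using c unfolding und_def by blast
  qed
  have decided: "\<not> und j y" if y: "y \<in> block S D c" and c: "c \<in> C" "c \<in> R n" and "n < j" for n j y c
  proof
    assume "und j y"
    then obtain s' i where s': "s' \<in> S" "act (- s') y \<in> C" "j \<le> i" "act (- s') y \<in> R i"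
      by (auto simp: und_def)
    obtain s where s: "s \<in> S" "y = act s c" using block_act[OF y c(1)] by blast
    have "act s c = act s' (act (- s') y)" using s CX[OF c(1)] by (simp add: add.assoc[symmetric])
    from unique[OF CX[OF c(1)] c(1) s'(2) s(1) s(1) s(1) s'(1) refl this] have "c = act (- s') y" .
    then show False using R_unique[of c n i] s' c \<open>n < j\<close> by auto
  qed
  \<comment> \<open>The constraint for \<gamma> at \<open>act \<delta> c\<close>, seen from the
    centre \<open>c\<close>: the pairs with both ends final after stage \<open>n\<close> and at
    least one end in the block of \<open>c\<close>. Only when 6 * k such pairs exist is
    \<open>c\<close> responsible for the constraint.\<close>
  define I where "I n c \<delta> \<gamma> = {s\<in>S. act (s + \<delta>) c \<in> Q (Suc n) \<and> act (s + \<gamma> + \<delta>) c \<in> Q (Suc n) \<and>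
    (s + \<delta> \<in> S \<and> act (s + \<delta>) c \<in> D \<or> s + \<gamma> + \<delta> \<in> S \<and> act (s + \<gamma> + \<delta>) c \<in> D)}" for n c \<delta> \<gamma>
  define good where "good n c A \<longleftrightarrow> (\<forall>\<delta>\<in>N. \<forall>\<gamma>\<in>\<Gamma>. 6 * k \<le> card (I n c \<delta> \<gamma>) \<longrightarrow>
    (\<exists>s\<in>S. act (s + \<delta>) c \<in> Q (Suc n) \<and> act (s + \<gamma> + \<delta>) c \<in> Q (Suc n) \<and>
      (act (s + \<delta>) c \<in> A) \<noteq> (act (s + \<gamma> + \<delta>) c \<in> A)))" for n c A
  have step: "\<exists>A'. A' \<in> sets X \<and> ((\<forall>x. (\<forall>c\<in>C \<inter> R n. x \<notin> block S D c) \<longrightarrow> (x \<in> A' \<longleftrightarrow> x \<in> A)) \<and>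
    (\<forall>c\<in>C \<inter> R n. good n c A'))" if A: "A \<in> sets X" for A n
  proof (rule block_choice[OF S SW A, of "C \<inter> R n" D "good n"])
    show "C \<inter> R n \<in> sets X" "D \<in> sets X" by measurable
    show "c = c'" if "c \<in> C \<inter> R n" "c' \<in> C \<inter> R n" and s: "s \<in> S" "w \<in> W" "act s c = act w c'" for c c' s w
    proof -
      have "c = act (- s + w) c'" using s(3) act_eq_iff[of c' c w s] that(1,2) CX by auto
      moreover from this have "- s + w = 0"
        using that s by (intro discreteD[OF R_disc[of n], of c']) (auto intro: sumsetI)
      ultimately show ?thesis using that CX by auto
    qed
    show "{x \<in> space X. good n x A} \<in> sets X" if [measurable]: "A \<in> sets X" for A
    proof -
      have [measurable]: "Measurable.pred X (\<lambda>x. 6 * k \<le> card (I n x \<delta> \<gamma>))" for \<delta> \<gamma>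
        unfolding I_def by (rule pred_finite_Collect[OF S]) measurable
      show ?thesis unfolding good_def by measurable
    qed
    show "good n c B" if "c \<in> C \<inter> R n" "\<And>w. w \<in> W \<Longrightarrow> act w c \<in> A \<longleftrightarrow> act w c \<in> B" "good n c A" for c A B
      unfolding good_def
    proof (intro ballI impI)
      fix \<delta> \<gamma> assume d: "\<delta> \<in> N" "\<gamma> \<in> \<Gamma>" "6 * k \<le> card (I n c \<delta> \<gamma>)"
      with that(3) obtain s where "s \<in> S" "act (s + \<delta>) c \<in> Q (Suc n)" "act (s + \<gamma> + \<delta>) c \<in> Q (Suc n)"
        "(act (s + \<delta>) c \<in> A) \<noteq> (act (s + \<gamma> + \<delta>) c \<in> A)"
        unfolding good_def by blast
      then show "\<exists>s\<in>S. act (s + \<delta>) c \<in> Q (Suc n) \<and> act (s + \<gamma> + \<delta>) c \<in> Q (Suc n) \<and>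
          (act (s + \<delta>) c \<in> B) \<noteq> (act (s + \<gamma> + \<delta>) c \<in> B)"
        using that(2)[OF W1[of s \<delta>]] that(2)[OF W2[of s \<delta> \<gamma>]] d by blast
    qed
    show "\<exists>q\<subseteq>block S D c. good n c (A - block S D c \<union> q)" if "c \<in> C \<inter> R n" for c
    proof -
      have c: "c \<in> space X" using that CX by auto
      define V where "V = block S D c"
      define J where "J = {(\<delta>, \<gamma>) \<in> N \<times> \<Gamma>. 6 * k \<le> card (I n c \<delta> \<gamma>)}"
      define bad where "bad = (\<lambda>(\<delta>, \<gamma>) q. \<forall>s\<in>I n c \<delta> \<gamma>.
        act (s + \<delta>) c \<in> (A - V) \<union> q \<longleftrightarrow> act (s + \<gamma> + \<delta>) c \<in> (A - V) \<union> q)"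
      have "\<exists>q\<subseteq>V. \<forall>j\<in>J. \<not> bad j q"
      proof (rule union_bound)
        show "finite V" unfolding V_def by (rule block_finite[OF S])
        show "finite J" unfolding J_def by (rule finite_subset[of _ "N \<times> \<Gamma>"]) (use finN \<Gamma> in auto)
        have "card J \<le> card (N \<times> \<Gamma>)" unfolding J_def using finN \<Gamma> by (intro card_mono) auto
        then show "card J < 2 ^ k" using k by (simp add: card_cartesian_product)
        fix j assume "j \<in> J"
        then obtain \<delta> \<gamma> where j: "j = (\<delta>, \<gamma>)" "\<delta> \<in> N" "\<gamma> \<in> \<Gamma>" "6 * k \<le> card (I n c \<delta> \<gamma>)"
          by (auto simp: J_def)
        have "finite (I n c \<delta> \<gamma>)" using S by (simp add: I_def)
        moreover have "\<delta> \<noteq> \<gamma> + \<delta>" using j \<Gamma> add_right_cancel[of 0 \<delta> \<gamma>] by auto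
        ultimately show "card {q \<in> Pow V. bad j q} * 2 ^ k \<le> 2 ^ card V"
          unfolding bad_def j(1) prod.case
          using j(4) c \<open>finite V\<close>
          by (intro card_pairs_agree) (auto simp: inj_on_def V_def I_def act_in_block_iff add.assoc)
      qed
      then obtain q where q: "q \<subseteq> V" "\<And>j. j \<in> J \<Longrightarrow> \<not> bad j q" by blast
      have "good n c (A - V \<union> q)"
        unfolding good_def
      proof (intro ballI impI)
        fix \<delta> \<gamma> assume "\<delta> \<in> N" "\<gamma> \<in> \<Gamma>" "6 * k \<le> card (I n c \<delta> \<gamma>)"
        then have "\<not> bad (\<delta>, \<gamma>) q" by (intro q(2)) (simp add: J_def)
        then obtain s where "s \<in> I n c \<delta> \<gamma>"
          "(act (s + \<delta>) c \<in> A - V \<union> q) \<noteq> (act (s + \<gamma> + \<delta>) c \<in> A - V \<union> q)"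
          unfolding bad_def prod.case by blast
        then show "\<exists>s\<in>S. act (s + \<delta>) c \<in> Q (Suc n) \<and> act (s + \<gamma> + \<delta>) c \<in> Q (Suc n) \<and>
            (act (s + \<delta>) c \<in> A - V \<union> q) \<noteq> (act (s + \<gamma> + \<delta>) c \<in> A - V \<union> q)"
          unfolding I_def by blast
      qed
      then show ?thesis using q(1) unfolding V_def by blast
    qed
  qed blast
  define state where "state n A' \<longleftrightarrow> A' \<in> sets X \<and> (n = 0 \<longrightarrow> A' = A)" for n :: nat and A'
  define next_state where "next_state n A1 A2 \<longleftrightarrow>
      (\<forall>x. (\<forall>c\<in>C \<inter> R n. x \<notin> block S D c) \<longrightarrow> (x \<in> A2 \<longleftrightarrow> x \<in> A1)) \<and>
      (\<forall>c\<in>C \<inter> R n. good n c A2)" for n A1 A2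
  have "\<exists>f. \<forall>n. state n (f n) \<and> next_state n (f n) (f (Suc n))"
  proof (rule dependent_nat_choice[of state next_state])
    show "\<exists>A'. state 0 A'" using A by (auto simp: state_def)
    show "\<exists>A2. state (Suc n) A2 \<and> next_state n A1 A2" if "state n A1" for A1 n
      using step[of A1 n] that by (auto simp: state_def next_state_def)
  qed
  then obtain f where f: "\<And>n. state n (f n)" "\<And>n. next_state n (f n) (f (Suc n))" by blast
  have [measurable]: "\<And>n. f n \<in> sets X" and f0: "f 0 = A"
    using f(1) by (auto simp: state_def)
  have f_off: "x \<in> f (Suc n) \<longleftrightarrow> x \<in> f n" if "\<forall>c\<in>C \<inter> R n. x \<notin> block S D c" for n x
    using f(2)[of n] that by (auto simp: next_state_def)
  have f_good: "good n c (f (Suc n))" if "c \<in> C" "c \<in> R n" for n c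
    using f(2)[of n] that by (auto simp: next_state_def)
  \<comment> \<open>A point lies in at most one block and changes colour only when that block is
    treated, so the colourings \<open>f n\<close> converge pointwise.\<close>
  define A' where "A' = {y \<in> space X. \<exists>n. \<not> und n y \<and> y \<in> f n}"
  have stable: "y \<in> f j \<longleftrightarrow> y \<in> f n" if "\<not> und n y" "n \<le> j" for n j y
    using that(2)
  proof (induction j rule: dec_induct)
    case (step j)
    have "\<forall>c\<in>C \<inter> R j. y \<notin> block S D c"
      using und_block und_mono[OF _ step(1)] that(1) by blast
    then show ?case using f_off step by blast
  qed simp
  have limit: "y \<in> A' \<longleftrightarrow> y \<in> f n" if "\<not> und n y" "y \<in> space X" for n y
  proof
    assume "y \<in> A'"
    then obtain j where "\<not> und j y" "y \<in> f j" by (auto simp: A'_def)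
    then show "y \<in> f n" using stable[of n y "max n j"] stable[of j y "max n j"] that by simp
  qed (use that in \<open>auto simp: A'_def\<close>)
  show thesis
  proof (rule that[of A'])
    show "A' \<in> sets X" unfolding A'_def und_def by measurable
    have "\<not> und 0 x" if "x \<notin> D" for x using that by (simp add: und_def)
    then show "agree_off D A A'" using limit[of 0] f0 by (auto simp: agree_off_def)
  next
    fix B c \<gamma> assume B: "agree_off P A' B" and c: "c \<in> C" and \<gamma>: "\<gamma> \<in> \<Gamma>"
    have cX: "c \<in> space X" using CX[OF c] .
    have transfer: "\<exists>s\<in>S. (act (s + \<delta>) c0 \<in> B) \<noteq> (act (s + \<gamma> + \<delta>) c0 \<in> B)"
      if c0: "c0 \<in> C" "c0 \<in> R n" and large: "\<delta> \<in> N" "6 * k \<le> card (I n c0 \<delta> \<gamma>)" for c0 n \<delta>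
    proof -
      have "good n c0 (f (Suc n))" using c0 by (intro f_good)
      then obtain s where s: "s \<in> S" "act (s + \<delta>) c0 \<in> Q (Suc n)" "act (s + \<gamma> + \<delta>) c0 \<in> Q (Suc n)"
        "(act (s + \<delta>) c0 \<in> f (Suc n)) \<noteq> (act (s + \<gamma> + \<delta>) c0 \<in> f (Suc n))"
        using large \<gamma> unfolding good_def by blast
      have "y \<in> B \<longleftrightarrow> y \<in> f (Suc n)" if "y \<in> Q (Suc n)" for y
        using that limit[of "Suc n" y] agree_offD[OF B, of y] by (auto simp: Q_def)
      then show ?thesis using s by blast
    qed
    obtain n where n: "c \<in> R n" using R_cover[OF cX] by blast
    \<comment> \<open>The pairs are sorted by whether the second end lies in some block
      (\<open>Pr2\<close>) or in none (\<open>Pr1\<close>). In the latter case that end is final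
      from the start, and the block of \<open>c\<close> alone decides.\<close>
    define Pr where "Pr = {s\<in>S. act s c \<in> D \<and> act (s + \<gamma>) c \<notin> P}"
    define Pr1 where "Pr1 = {s\<in>Pr. \<not> und 0 (act (s + \<gamma>) c)}"
    define Pr2 where "Pr2 = {s\<in>Pr. und 0 (act (s + \<gamma>) c)}"
    have Pr_block: "act s c \<in> block S D c" if "s \<in> Pr" for s
      using that by (auto simp: Pr_def block_def)
    have finPr: "finite Pr" using S by (simp add: Pr_def)
    have Pr_eq: "Pr = Pr1 \<union> Pr2" by (auto simp: Pr1_def Pr2_def)
    have "12 * k \<le> card Pr1 + card Pr2"
      using count[OF c \<gamma>] card_Un_le[of Pr1 Pr2] unfolding Pr_eq[symmetric] Pr_def[symmetric] by simp
    then consider "6 * k \<le> card Pr1" | "6 * k \<le> card Pr2" by linarith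
    then show "\<exists>s\<in>S. (act s c \<in> B) \<noteq> (act (s + \<gamma>) c \<in> B)"
    proof cases
      case 1
      have "Pr1 \<subseteq> I n c 0 \<gamma>"
      proof
        fix s assume s: "s \<in> Pr1"
        then have "s \<in> Pr" by (simp add: Pr1_def)
        then show "s \<in> I n c 0 \<gamma>"
          using s und_mono[of "Suc n" "act (s + \<gamma>) c" 0] decided[OF Pr_block c n, of s "Suc n"] cX DP
          by (auto simp: I_def Pr_def Pr1_def Q_def)
      qed
      then have "card Pr1 \<le> card (I n c 0 \<gamma>)" using S by (intro card_mono) (auto simp: I_def)
      then show ?thesis using transfer[of c n 0] c n 1 N by auto
    next
      case 2
      then have "Pr2 \<noteq> {}" using k by auto
      then obtain s0 where s0: "s0 \<in> Pr2" by blast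
      have ex: "\<exists>t\<in>S. \<exists>c'\<in>C. act (s + \<gamma>) c = act t c' \<and> act (s + \<gamma>) c \<in> D" if "s \<in> Pr2" for s
      proof -
        obtain t where t: "t \<in> S" "act (- t) (act (s + \<gamma>) c) \<in> C" "act (s + \<gamma>) c \<in> D"
          using \<open>s \<in> Pr2\<close> by (auto simp: Pr2_def und_def)
        have "act (s + \<gamma>) c = act t (act (- t) (act (s + \<gamma>) c))" using cX by (simp add: add.assoc[symmetric])
        then show ?thesis using t by blast
      qed
      obtain t0 c0 where t0: "t0 \<in> S" "c0 \<in> C" "act (s0 + \<gamma>) c = act t0 c0" using ex[OF s0] by blast
      have c0X: "c0 \<in> space X" using CX t0 by blast
      have all: "\<exists>t\<in>S. act (s + \<gamma>) c = act t c0 \<and> act (s + \<gamma>) c \<in> D" if s: "s \<in> Pr2" for s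
      proof -
        obtain t c' where t: "t \<in> S" "c' \<in> C" "act (s + \<gamma>) c = act t c'" "act (s + \<gamma>) c \<in> D"
          using ex[OF s] by blast
        have "c' = c0"
          by (rule unique[of "act \<gamma> c" c' c0 s s0 t t0])
            (use t t0 s s0 cX in \<open>auto simp: Pr2_def Pr_def\<close>)
        then show ?thesis using t by blast
      qed
      obtain l where l: "c0 \<in> R l" using R_cover[OF c0X] by blast
      have blk0: "act (s + \<gamma>) c \<in> block S D c0" if "s \<in> Pr2" for s
        using all[OF that] by (auto simp: block_def)
      have dec: "\<not> und (Suc j) (act s c)" "\<not> und (Suc j) (act (s + \<gamma>) c)"
        if "s \<in> Pr2" "n \<le> j" "l \<le> j" for s j
        using decided[OF Pr_block c n, of s "Suc j"] decided[OF blk0 t0(2) l, of s "Suc j"] that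
        by (auto simp: Pr2_def)
      show ?thesis
      \<comment> \<open>All second ends lie in the block of the single centre \<open>c0\<close>. If
        that block is not treated after the one of \<open>c\<close>, the constraint is charged to
        \<open>c\<close>; otherwise it is charged to \<open>c0\<close>, which sees \<open>c\<close>
        at the displacement \<delta>.\<close>
      proof (cases "l \<le> n")
        case True
        have "Pr2 \<subseteq> I n c 0 \<gamma>"
        proof
          fix s assume s: "s \<in> Pr2"
          then show "s \<in> I n c 0 \<gamma>"
            using dec[OF s, of n] True cX DP by (auto simp: I_def Pr_def Pr2_def Q_def)
        qed
        then have "card Pr2 \<le> card (I n c 0 \<gamma>)" using S by (intro card_mono) (auto simp: I_def)
        then show ?thesis using transfer[of c n 0] c n 2 N by auto
      next
        case False
        define \<delta> where "\<delta> = - \<gamma> + (- s0 + t0)"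
        have c_eq: "c = act \<delta> c0"
          using t0(3)[symmetric] act_eq_iff[of c0 c t0 "s0 + \<gamma>"] cX c0X
          by (simp only: \<delta>_def minus_add add.assoc)
        have \<delta>N: "\<delta> \<in> N" using s0 t0 \<gamma> by (auto simp: N \<delta>_def Pr2_def Pr_def intro!: sumsetI)
        have e1: "act (s + \<delta>) c0 = act s c" "act (s + \<gamma> + \<delta>) c0 = act (s + \<gamma>) c" for s
          using c0X by (simp_all add: c_eq)
        have "Pr2 \<subseteq> I l c0 \<delta> \<gamma>"
        proof
          fix s assume s: "s \<in> Pr2"
          have "act (s + \<gamma> + \<delta>) c0 \<in> block S D c0" using blk0[OF s] e1 by simp
          then have "s + \<gamma> + \<delta> \<in> S \<and> act (s + \<gamma> + \<delta>) c0 \<in> D" using act_in_block_iff[OF c0X] by blast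
          then show "s \<in> I l c0 \<delta> \<gamma>"
            using dec[OF s, of l] s False cX DP unfolding I_def e1
            by (auto simp: Pr_def Pr2_def Q_def)
        qed
        then have "card Pr2 \<le> card (I l c0 \<delta> \<gamma>)" using S by (intro card_mono) (auto simp: I_def)
        then have "6 * k \<le> card (I l c0 \<delta> \<gamma>)" using 2 by linarith
        from transfer[OF t0(2) l \<delta>N this] show ?thesis unfolding e1 .
      qed
    qed
  qed
qed


text \<open>Syndeticity seen from the point: \<open>K\<close> plays the role of the inverses of the
  translating elements, so the window \<open>K\<close> of every point meets
  \<open>M\<close>.\<close>

definition covers :: "'g set \<Rightarrow> 'x set \<Rightarrow> bool" where
  "covers K M \<longleftrightarrow> finite K \<and> (\<forall>x\<in>space X. \<exists>k\<in>K. act k x \<in> M)"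

text \<open>The translates K + y are pairwise disjoint, so each of them can supply a point of
  \<open>M\<close> of its own.\<close>

definition separated :: "'g set \<Rightarrow> 'g set \<Rightarrow> bool" where
  "separated K Y \<longleftrightarrow> (\<forall>y\<in>Y. \<forall>y'\<in>Y. \<forall>k\<in>K. \<forall>k'\<in>K. k + y = k' + y' \<longrightarrow> y = y')"

lemma separatedD:
  "separated K Y \<Longrightarrow> k + y = k' + y' \<Longrightarrow> k \<in> K \<Longrightarrow> k' \<in> K \<Longrightarrow> y \<in> Y \<Longrightarrow> y' \<in> Y \<Longrightarrow> y = y'"
  by (auto simp: separated_def)

text \<open>A further element only has to avoid \<open>Y\<close> and the finitely many values - k +
  k' + y, which is possible because the group is infinite.\<close>

lemma ex_separated:
  assumes "finite K"
  shows "\<exists>Y. finite Y \<and> card Y = m \<and> separated K Y"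
proof (induction m)
  case 0
  show ?case by (rule exI[of _ "{}"]) (simp add: separated_def)
next
  case (Suc m)
  then obtain Y where Y: "finite Y" "card Y = m" "separated K Y" by blast
  have "finite (Y \<union> ((uminus ` K \<oplus> K) \<oplus> Y))" using assms Y by simp
  then obtain z where z: "z \<notin> Y \<union> ((uminus ` K \<oplus> K) \<oplus> Y)"
    using infinite_group ex_new_if_finite by blast
  have sep: False if "k + z = k' + y" "k \<in> K" "k' \<in> K" "y \<in> Y" for k k' y
  proof -
    have "z = (- k + k') + y" using that(1) by (metis add.assoc minus_add_cancel)
    then show False using z that(2-) by (auto intro!: sumsetI)
  qed
  have "separated K (insert z Y)"
    using Y(3) sep sep[OF sym] unfolding separated_def by blast
  then show ?case using Y z by (intro exI[of _ "insert z Y"]) auto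
qed

text \<open>Each translate K + y contributes a point of \<open>M\<close>, and separation makes these
  points distinct. The bound is the same for all \<open>x\<close>.\<close>

lemma window_count:
  assumes "covers K M" "finite Y" "separated K Y" "x \<in> space X"
  shows "card Y \<le> card {s \<in> K \<oplus> Y. act s x \<in> M}"
proof -
  have "\<forall>y\<in>Y. \<exists>k\<in>K. act (k + y) x \<in> M"
    using assms(1,4) unfolding covers_def by (metis act_act act_space)
  then obtain k where k: "\<forall>y\<in>Y. k y \<in> K \<and> act (k y + y) x \<in> M" by metis
  show ?thesis
  proof (rule card_inj_on_le[of "\<lambda>y. k y + y"])
    show "inj_on (\<lambda>y. k y + y) Y"
      using k by (auto simp: inj_on_def intro: separatedD[OF assms(3)])
    show "(\<lambda>y. k y + y) ` Y \<subseteq> {s \<in> K \<oplus> Y. act s x \<in> M}"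
      using k by (auto intro: sumsetI)
    show "finite {s \<in> K \<oplus> Y. act s x \<in> M}" using assms by (simp add: covers_def)
  qed
qed

text \<open>The reserved set keeps a syndetic set of colours open, at the cost of one point per window.\<close>
lemma sparse_reserve:
  assumes M: "M \<in> sets X" "covers K M" and S: "finite S"
  obtains M' K' where "M' \<in> sets X" "M' \<subseteq> M" "covers K' M'"
    "\<And>x s s'. x \<in> space X \<Longrightarrow> s \<in> S \<Longrightarrow> s' \<in> S \<Longrightarrow> act s x \<in> M' \<Longrightarrow> act s' x \<in> M' \<Longrightarrow> s = s'"
proof -
  \<comment> \<open>Two points of one window differ by s' - s, whereas two centres whose windows
    share a point differ by - s' + s; hence the order of the factors here is opposite to the one
    used for centres.\<close>
  define R where "R = insert 0 (S \<oplus> uminus ` S)"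
  have R: "finite R" "0 \<in> R" using S by (auto simp: R_def)
  have sym: "- t \<in> R" if "t \<in> R" for t
  proof (cases "t = 0")
    case False
    with that obtain a b where "t = a + - b" "a \<in> S" "b \<in> S" by (auto simp: R_def elim!: sumsetE)
    then show ?thesis
      using sumsetI[of b S "- a" "uminus ` S"] by (auto simp: R_def minus_add simp del: add_uminus_conv_diff)
  qed (simp add: R_def)
  obtain M' where M': "M' \<in> sets X" "M' \<subseteq> M" "discrete R M'" "\<And>x. x \<in> M \<Longrightarrow> \<exists>t\<in>R. act t x \<in> M'"
    using maximal_discrete_subset[OF R sym M(1)] by blast
  show thesis
  proof (rule that[OF M'(1,2)])
    show "covers (R \<oplus> K) M'"
      unfolding covers_def
    proof (intro conjI ballI)
      show "finite (R \<oplus> K)" using R M by (simp add: covers_def)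
      fix x assume x: "x \<in> space X"
      then obtain k where k: "k \<in> K" "act k x \<in> M" using M by (auto simp: covers_def)
      then obtain t where "t \<in> R" "act t (act k x) \<in> M'" using M'(4) by blast
      then show "\<exists>k\<in>R \<oplus> K. act k x \<in> M'"
        using k x by (intro bexI[of _ "t + k"]) (auto intro: sumsetI)
    qed
    fix x s s'
    assume x: "x \<in> space X" and s: "s \<in> S" "s' \<in> S" and m: "act s x \<in> M'" "act s' x \<in> M'"
    have "act (s' + - s) (act s x) = act s' x" using x by (simp add: add.assoc)
    moreover have "s' + - s \<in> R" using s unfolding R_def by (intro insertI2 sumsetI imageI)
    ultimately have "s' + - s = 0" using discreteD[OF M'(3) m(1)] m(2) by metis
    then show "s = s'" by (metis add.right_inverse add_right_imp_eq)
  qed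
qed

lemma maximal_centers:
  assumes "finite T0"
    and sym: "\<And>t. t \<in> T0 \<Longrightarrow> - t \<in> T0"
  obtains C where "C \<in> sets X" "discrete T0 C" "\<And>x. x \<in> space X \<Longrightarrow> \<exists>t\<in>insert 0 T0. act t x \<in> C"
proof -
  show thesis
  proof (rule maximal_discrete_subset[of "insert 0 T0" "space X"])
    fix C assume C: "C \<in> sets X" "discrete (insert 0 T0) C" "\<And>x. x \<in> space X \<Longrightarrow> \<exists>t\<in>insert 0 T0. act t x \<in> C"
    have "discrete T0 C" using C(2) by (rule discrete_mono) auto
    then show thesis using C that by blast
  qed (use assms in auto)
qed

lemma symmetric_difference_set:
  assumes "t \<in> uminus ` S \<oplus> S" shows "- t \<in> uminus ` S \<oplus> (S :: 'g set)"
proof -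
  obtain a b where "t = - a + b" "a \<in> S" "b \<in> S" using assms by (auto elim!: sumsetE)
  then show ?thesis using sumsetI[of "- b" "uminus ` S" a S] by (auto simp: minus_add)
qed

lemma card_difference_set_le: "finite (S :: 'g set) \<Longrightarrow> card (uminus ` S \<oplus> S) \<le> card S * card S"
  by (meson card_image_le card_sumset_le finite_imageI mult_le_mono1 order_trans)

text \<open>\<open>M'\<close> and \<open>E\<close> are chosen before \<open>A\<close>, so that one
  decreasing sequence of open sets serves all colourings. Every point has a centre at bounded
  displacement, and the constraints at the centres are passed on to it.\<close>

lemma break_symmetry:
  assumes M: "M \<in> sets X" "covers K M" and g: "g \<noteq> 0"
  obtains M' K' E where "M' \<in> sets X" "M' \<subseteq> M" "covers K' M'" "finite E"
    "\<And>A. A \<in> sets X \<Longrightarrow> \<exists>A'\<in>sets X. agree_off M A A' \<and>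
      (\<forall>B. agree_off M' A' B \<longrightarrow> (\<forall>x\<in>space X. \<exists>e\<in>E. (act e x \<in> B) \<noteq> (act (e + g) x \<in> B)))"
proof -
  have K: "finite K" using M by (simp add: covers_def)
  \<comment> \<open>With s = |S| + 1 the bounds below are |\<Gamma>| \<le> s^4 and |N| \<le> 2 s^6,
    whence 2 s^10 constraints; the base of the power bounds s.\<close>
  obtain k where k: "k > 0" "2 * (12 * card K * k + (2 * card K + 1)) ^ 10 < (2::nat) ^ k"
    using ex_poly_less_two_power by blast
  \<comment> \<open>Two points to spare: the reserve takes at most one from the window of the centre
    and at most one from its translate by \<gamma>, leaving 12 * k pairs.\<close>
  obtain Y where Y: "finite Y" "card Y = 12 * k + 2" "separated K Y" using ex_separated[OF K] by blast
  define S where "S = K \<oplus> Y"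
  have S: "finite S" using K Y by (simp add: S_def)
  \<comment> \<open>If the windows of two centres both meet the window of some \<open>y\<close>, the
    centres differ by a sum of two differences from -S + S. Discreteness for \<open>T0\<close>
    therefore gives \<open>unique\<close>.\<close>
  define T0 where "T0 = (uminus ` S \<oplus> S) \<oplus> (uminus ` S \<oplus> S)"
  have finT0: "finite T0" using S by (simp add: T0_def)
  have symT0: "- t \<in> T0" if t: "t \<in> T0" for t
  proof -
    obtain a b where "t = a + b" "a \<in> uminus ` S \<oplus> S" "b \<in> uminus ` S \<oplus> S"
      using t unfolding T0_def by (rule sumsetE) blast
    then show ?thesis unfolding T0_def by (simp only: minus_add sumsetI symmetric_difference_set)
  qed
  obtain C where C: "C \<in> sets X" "discrete T0 C" "\<And>x. x \<in> space X \<Longrightarrow> \<exists>t\<in>insert 0 T0. act t x \<in> C"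
    using maximal_centers[OF finT0 symT0] by blast
  have CX: "c \<in> space X" if "c \<in> C" for c using that sets.sets_into_space[OF C(1)] by blast
  \<comment> \<open>Passing from \<open>x\<close> to the centre \<open>act t x\<close> conjugates
    the period: s + t + g = s + (t + g - t) + t. So each centre must break all these conjugates of
    \<open>g\<close>.\<close>
  define \<Gamma> where "\<Gamma> = (\<lambda>t. t + g + - t) ` insert 0 T0"
  have \<Gamma>: "finite \<Gamma>" using finT0 by (simp add: \<Gamma>_def)
  have \<Gamma>0: "0 \<notin> \<Gamma>"
  proof
    assume "0 \<in> \<Gamma>"
    then obtain t where "0 = t + g + - t" unfolding \<Gamma>_def by (rule imageE)
    moreover have "t + g = (t + g + - t) + t" by (simp only: add.assoc left_minus add_0_right)
    ultimately have "t + g = t" by simp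
    then show False using g add_left_cancel[of t g 0] by simp
  qed
  define N where "N = insert 0 (uminus ` \<Gamma> \<oplus> (uminus ` S \<oplus> S))"
  define s where "s = Suc (card S)"
  have cT: "card (insert 0 T0) \<le> s ^ 4"
  proof -
    have "card T0 \<le> card (uminus ` S \<oplus> S) * card (uminus ` S \<oplus> S)"
      unfolding T0_def using S by (intro card_sumset_le) auto
    also have "\<dots> \<le> (card S * card S) * (card S * card S)"
      by (intro mult_le_mono card_difference_set_le S)
    finally have "card T0 \<le> (card S * card S) * (card S * card S)" .
    moreover have "card (insert 0 T0) \<le> Suc (card T0)" by (rule card_insert_le_m1) auto
    moreover have "Suc ((n * n) * (n * n)) \<le> Suc n ^ 4" for n :: nat
      by (simp add: power4_eq_xxxx algebra_simps)
    ultimately show ?thesis unfolding s_def by (meson Suc_le_mono order_trans)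
  qed
  have c\<Gamma>: "card \<Gamma> \<le> s ^ 4"
    unfolding \<Gamma>_def using cT finT0 by (meson card_image_le finite.insertI order_trans)
  have cN: "card N \<le> 2 * s ^ 6"
  proof -
    have "card (uminus ` \<Gamma> \<oplus> (uminus ` S \<oplus> S)) \<le> card (uminus ` \<Gamma>) * card (uminus ` S \<oplus> S)"
      using S \<Gamma> by (intro card_sumset_le) auto
    also have "\<dots> \<le> s ^ 4 * (s * s)"
      using c\<Gamma> \<Gamma> card_image_le[OF \<Gamma>, of uminus] card_difference_set_le[OF S]
      by (intro mult_le_mono) (auto simp: s_def)
    also have "\<dots> = s ^ 6" by (simp add: eval_nat_numeral)
    finally have "card N \<le> Suc (s ^ 6)" unfolding N_def by (intro card_insert_le_m1) auto
    moreover have "1 \<le> s ^ 6" by (simp add: s_def)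
    ultimately show ?thesis by linarith
  qed
  have "card S \<le> card K * (12 * k + 2)" using card_sumset_le[OF K Y(1)] Y(2) by (simp add: S_def)
  then have "s \<le> 12 * card K * k + (2 * card K + 1)" by (simp add: s_def algebra_simps)
  have "card N * card \<Gamma> \<le> 2 * s ^ 6 * s ^ 4" using cN c\<Gamma> by (intro mult_le_mono)
  also have "\<dots> = 2 * s ^ 10" by (simp add: power_add[symmetric])
  also have "\<dots> \<le> 2 * (12 * card K * k + (2 * card K + 1)) ^ 10"
    using \<open>s \<le> _\<close> by (intro mult_le_mono2 power_mono) auto
  finally have cardN\<Gamma>: "card N * card \<Gamma> < 2 ^ k" using k(2) by linarith
  obtain M' K' where M': "M' \<in> sets X" "M' \<subseteq> M" "covers K' M'"
    and sparse: "\<And>x s s'. x \<in> space X \<Longrightarrow> s \<in> S \<Longrightarrow> s' \<in> S \<Longrightarrow> act s x \<in> M' \<Longrightarrow> act s' x \<in> M' \<Longrightarrow> s = s'"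
    using sparse_reserve[OF M S] by blast
  define D where "D = M - M'"
  have one: "card {s\<in>S. act s x \<in> M'} \<le> 1" if "x \<in> space X" for x
    using S sparse[OF that] by (auto simp: card_le_Suc0_iff_eq)
  have count: "12 * k \<le> card {s\<in>S. act s c \<in> D \<and> act (s + \<gamma>) c \<notin> M'}" (is "_ \<le> card ?G") if "c \<in> C" for c \<gamma>
  proof -
    have c: "c \<in> space X" using CX[OF that] .
    have "card {s\<in>S. act s c \<in> M} \<le> card (?G \<union> {s\<in>S. act s c \<in> M'} \<union> {s\<in>S. act s (act \<gamma> c) \<in> M'})"
      using S c by (intro card_mono) (auto simp: D_def)
    also have "\<dots> \<le> card ?G + card {s\<in>S. act s c \<in> M'} + card {s\<in>S. act s (act \<gamma> c) \<in> M'}"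
      by (meson add_le_mono card_Un_le order_refl order_trans)
    finally show ?thesis
      using one[OF c] one[of "act \<gamma> c"] window_count[OF M(2) Y(1,3) c] Y(2) c by (simp add: S_def)
  qed
  have unique: "c = c'" if y: "y \<in> space X" and c: "c \<in> C" "c' \<in> C" and s: "s \<in> S" "s' \<in> S" "t \<in> S" "t' \<in> S"
    and e: "act s y = act t c" "act s' y = act t' c'" for y c c' s s' t t'
  proof -
    have 1: "y = act (- s + t) c" using e(1) act_eq_iff[of c y t s] y c CX by auto
    have 2: "c' = act (- t' + s') y" using e(2) act_eq_iff[of y c' s' t'] y c CX by auto
    have 3: "c' = act ((- t' + s') + (- s + t)) c" unfolding 2 by (subst 1) (use c CX in simp)
    have "(- t' + s') + (- s + t) \<in> T0" using s unfolding T0_def by (intro sumsetI) auto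
    then have "(- t' + s') + (- s + t) = 0" using c 3 by (intro discreteD[OF C(2) c(1)]) auto
    then show ?thesis using 3 c CX by simp
  qed
  show thesis
  proof (rule that[OF M', of "S \<oplus> insert 0 T0"])
    show "finite (S \<oplus> insert 0 T0)" using S finT0 by simp
    fix A assume A: "A \<in> sets X"
    have D: "D \<in> sets X" "D \<inter> M' = {}" using M M' by (auto simp: D_def)
    have "\<exists>A'. A' \<in> sets X \<and> agree_off D A A' \<and> (\<forall>B c \<gamma>. agree_off M' A' B \<longrightarrow> c \<in> C \<longrightarrow> \<gamma> \<in> \<Gamma> \<longrightarrow>
        (\<exists>s\<in>S. (act s c \<in> B) \<noteq> (act (s + \<gamma>) c \<in> B)))"
    proof (rule greedy_pairs[OF S \<Gamma> \<Gamma>0 C(1) D(1) M'(1) A D(2) _ N_def k(1) cardN\<Gamma>])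
      show "12 * k \<le> card {s \<in> S. act s c \<in> D \<and> act (s + \<gamma>) c \<notin> M'}" if "c \<in> C" for c \<gamma>
        using that by (rule count)
    qed (rule unique, assumption+, blast)
    then obtain A' where A': "A' \<in> sets X" "agree_off D A A'"
      "\<And>B c \<gamma>. agree_off M' A' B \<Longrightarrow> c \<in> C \<Longrightarrow> \<gamma> \<in> \<Gamma> \<Longrightarrow> \<exists>s\<in>S. (act s c \<in> B) \<noteq> (act (s + \<gamma>) c \<in> B)"
      by (elim exE conjE) simp
    have "\<exists>e\<in>S \<oplus> insert 0 T0. (act e x \<in> B) \<noteq> (act (e + g) x \<in> B)"
      if B: "agree_off M' A' B" and x: "x \<in> space X" for B x
    proof -
      obtain t where t: "t \<in> insert 0 T0" "act t x \<in> C" using C(3)[OF x] by blast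
      have "t + g + - t \<in> \<Gamma>" using t unfolding \<Gamma>_def by blast
      from A'(3)[OF B t(2) this] obtain s where s: "s \<in> S"
        "(act s (act t x) \<in> B) \<noteq> (act (s + (t + g + - t)) (act t x) \<in> B)" by blast
      have "s + (t + g + - t) + t = s + t + g" by (simp only: add.assoc left_minus add_0_right)
      then have "(act (s + t) x \<in> B) \<noteq> (act (s + t + g) x \<in> B)" using s(2) x by simp
      then show ?thesis using sumsetI[OF s(1) t(1)] by blast
    qed
    moreover have "agree_off M A A'" using A'(2) by (auto simp: agree_off_def D_def)
    ultimately show "\<exists>A'\<in>sets X. agree_off M A A' \<and>
      (\<forall>B. agree_off M' A' B \<longrightarrow> (\<forall>x\<in>space X. \<exists>e\<in>S \<oplus> insert 0 T0. (act e x \<in> B) \<noteq> (act (e + g) x \<in> B)))"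
      using A'(1) by blast
  qed
qed


section \<open>Encoding a bit\<close>

lemma ex_maximal_separated:
  assumes Z: "finite Z" and K: "K \<noteq> {}"
  obtains U where "U \<subseteq> Z" "separated K U" "\<And>z. z \<in> Z \<Longrightarrow> \<exists>u\<in>U. \<exists>k\<in>K. \<exists>k'\<in>K. k + u = k' + z"
proof -
  define F where "F = {U. U \<subseteq> Z \<and> separated K U}"
  have "finite F" "F \<noteq> {}" using Z by (auto simp: F_def separated_def)
  from finite_has_maximal[OF this] obtain U where "U \<in> F" and maxF: "\<forall>V\<in>F. U \<subseteq> V \<longrightarrow> U = V" by blast
  then have U: "U \<subseteq> Z" "separated K U" by (auto simp: F_def)
  have max: "V = U" if "V \<subseteq> Z" "separated K V" "U \<subseteq> V" for V
    using maxF that unfolding F_def by blast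
  have "\<exists>u\<in>U. \<exists>k\<in>K. \<exists>k'\<in>K. k + u = k' + z" if z: "z \<in> Z" for z
  proof (rule ccontr)
    assume n: "\<not> ?thesis"
    then have "separated K (insert z U)"
      using U(2) unfolding separated_def by (metis insert_iff)
    then have "z \<in> U" using max[of "insert z U"] U(1) z by blast
    then show False using n K by blast
  qed
  then show thesis using that U by blast
qed

text \<open>
  The prescribed colours off \<^term>\<open>M\<close> are arbitrary, so a bit cannot be stored in a fixed pattern; but
  the parity of the colours on a window \<^term>\<open>K\<close> that always meets \<^term>\<open>M\<close> can be adjusted. The
  windows \<^term>\<open>\<lambda>u. (\<lambda>a. a + u) ` K\<close> for \<^term>\<open>u \<in> U\<close> are disjoint. The bit is true if near every point all of these
  parities but one are even, and false if nowhere all but one are even. One parity is sacrificed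
  because its window may contain a point that stays uncoloured.
\<close>
lemma encode_bit:
  assumes M: "M \<in> sets X" "covers K0 M"
  obtains M' K' E \<Omega> where "M' \<in> sets X" "M' \<subseteq> M" "covers K' M'" "finite E"
    "\<And>A b. A \<in> sets X \<Longrightarrow> \<exists>A'\<in>sets X. agree_off M A A' \<and>
      (\<forall>B. agree_off M' A' B \<longrightarrow> (\<forall>x\<in>space X. {e\<in>E. act e x \<in> B} \<in> \<Omega> \<longleftrightarrow> b))"
proof -
  define K where "K = insert 0 K0"
  have K: "finite K" "K \<noteq> {}" "covers K M"
    using M by (auto simp: K_def covers_def)
  define \<kappa> where "\<kappa> = card K"
  have \<kappa>: "\<kappa> \<ge> 1" using K by (simp add: \<kappa>_def card_gt_0_iff Suc_le_eq)
  \<comment> \<open>The base is the number c = \<kappa>^3 * (k + 2) + 1 used below. It satisfies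
    |T1| \<le> c^2 and |U| \<le> c^3, and there is one constraint for each element of
    \<open>T1 \<times> U\<close>.\<close>
  obtain k where k: "k > 0" "1 * (\<kappa> ^ 3 * k + (2 * \<kappa> ^ 3 + 1)) ^ 5 < (2::nat) ^ k"
    using ex_poly_less_two_power by blast
  \<comment> \<open>Two windows to spare: the excepted \<open>u0\<close> and the at most one window
    containing a reserved point.\<close>
  define m where "m = k + 2"
  define L where "L = uminus ` K \<oplus> K"
  have L: "finite L" "card L \<le> \<kappa> * \<kappa>" using K card_difference_set_le[of K] by (auto simp: L_def \<kappa>_def)
  obtain Y where Y: "finite Y" "card Y = m" "separated L Y" using ex_separated[OF L(1)] by blast
  define S1 where "S1 = L \<oplus> Y"
  define S where "S = K \<oplus> S1"
  have S1: "finite S1" using L Y by (simp add: S1_def)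
  have S: "finite S" using S1 K by (simp add: S_def)
  have "card S1 \<le> \<kappa> * \<kappa> * m"
    using card_sumset_le[OF L(1) Y(1)] L(2) Y(2) unfolding S1_def by (meson mult_le_mono1 order_trans)
  then have cS: "card S \<le> \<kappa> * (\<kappa> * \<kappa> * m)"
    using card_sumset_le[OF K(1) S1] unfolding S_def \<kappa>_def by (meson mult_le_mono2 order_trans)
  define T0 where "T0 = uminus ` S \<oplus> S"
  define T1 where "T1 = insert 0 T0"
  have T1: "finite T0" "finite T1" using S by (simp_all add: T0_def T1_def)
  have symT0: "- t \<in> T0" if "t \<in> T0" for t using that symmetric_difference_set by (simp add: T0_def)
  have symT1: "- t \<in> T1" if "t \<in> T1" for t using that symT0 by (auto simp: T1_def)
  \<comment> \<open>One fixed \<open>U\<close> must work for every displacement \<open>t\<close>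
    from a point to its centre. \<open>Z\<close> contains all y - t, and by maximality some
    \<open>u\<close> in \<open>U\<close> has a window meeting K + (y - t), so u + t lies in L + y
    and thus in \<open>S1\<close>. As \<open>Y\<close> is \<open>L\<close>-separated, different
    \<open>y\<close> give different \<open>u\<close>, so at least \<open>m\<close> windows stay
    within reach of the centre.\<close>
  define Z where "Z = Y \<oplus> T1"
  have Z: "finite Z" "card Z \<le> m * card T1"
    using Y T1 card_sumset_le[of Y T1] by (auto simp: Z_def)
  obtain U where U: "U \<subseteq> Z" "separated K U" "\<And>z. z \<in> Z \<Longrightarrow> \<exists>u\<in>U. \<exists>k\<in>K. \<exists>k'\<in>K. k + u = k' + z"
    using ex_maximal_separated[OF Z(1) K(2)] by blast
  have finU: "finite U" using U(1) Z(1) finite_subset by blast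
  have cU: "card U \<le> m * card T1" using card_mono[OF Z(1) U(1)] Z(2) by linarith
  have many: "m \<le> card {u\<in>U. u + t \<in> S1}" if t: "t \<in> T1" for t
  proof -
    have "\<forall>y\<in>Y. \<exists>l\<in>L. \<exists>u\<in>U. u + t = l + y"
    proof
      fix y assume "y \<in> Y"
      then have "y + - t \<in> Z" unfolding Z_def using symT1[OF t] by (intro sumsetI)
      then obtain u a b where u: "u \<in> U" "a \<in> K" "b \<in> K" "a + u = b + (y + - t)" using U(3) by blast
      have "u + t = - a + ((a + u) + t)" by (simp only: add.assoc minus_add_cancel)
      also have "\<dots> = (- a + b) + y" unfolding u(4) by (simp only: add.assoc left_minus add_0_right)
      finally show "\<exists>l\<in>L. \<exists>u\<in>U. u + t = l + y"
        using u by (intro bexI[of _ "- a + b"] bexI[of _ u]) (simp only: L_def sumsetI imageI)+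
    qed
    then obtain l where l: "\<forall>y\<in>Y. l y \<in> L \<and> (\<exists>u\<in>U. u + t = l y + y)" by metis
    then obtain u where u: "\<forall>y\<in>Y. u y \<in> U \<and> u y + t = l y + y" by metis
    have "card Y \<le> card {u\<in>U. u + t \<in> S1}"
    proof (rule card_inj_on_le[of u])
      show "inj_on u Y"
      proof (rule inj_onI)
        fix y y' assume y: "y \<in> Y" "y' \<in> Y" "u y = u y'"
        then have "l y + y = l y' + y'" using u by metis
        from separatedD[OF Y(3) this] show "y = y'" using y l by blast
      qed
      have "l y + y \<in> S1" if "y \<in> Y" for y unfolding S1_def using l that by (intro sumsetI) auto
      then show "u ` Y \<subseteq> {u\<in>U. u + t \<in> S1}" using u by auto
    qed (use finU in simp)
    then show ?thesis using Y by simp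
  qed
  have "U \<noteq> {}" using many[of 0] by (auto simp: T1_def m_def)
  define c where "c = \<kappa> ^ 3 * m + 1"
  have card_constraints: "card (T1 \<times> U) < 2 ^ k"
  proof -
    have "card T0 \<le> card S * card S" unfolding T0_def by (rule card_difference_set_le[OF S])
    also have "\<dots> \<le> (\<kappa> * (\<kappa> * \<kappa> * m)) * (\<kappa> * (\<kappa> * \<kappa> * m))" by (intro mult_le_mono cS)
    finally have "card T1 \<le> Suc ((\<kappa> * (\<kappa> * \<kappa> * m)) * (\<kappa> * (\<kappa> * \<kappa> * m)))"
      unfolding T1_def by (intro card_insert_le_m1) auto
    also have "\<dots> \<le> c ^ 2" by (simp add: c_def power2_eq_square power3_eq_cube algebra_simps)
    finally have cT1: "card T1 \<le> c ^ 2" .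
    have "1 * m \<le> \<kappa> ^ 3 * m" using \<kappa> by (intro mult_le_mono1) simp
    then have "m \<le> c" unfolding c_def by linarith
    have "card (T1 \<times> U) \<le> c ^ 2 * (c * c ^ 2)"
      using cT1 cU \<open>m \<le> c\<close> unfolding card_cartesian_product
      by (intro mult_le_mono) (auto intro: order_trans[OF cU] mult_le_mono)
    also have "\<dots> = c ^ 5" by (simp add: eval_nat_numeral)
    also have "c = \<kappa> ^ 3 * k + (2 * \<kappa> ^ 3 + 1)" by (simp add: c_def m_def algebra_simps)
    finally show ?thesis using k(2) by simp
  qed
  define W where "W = K \<oplus> U"
  have W: "finite W" using K finU by (simp add: W_def)
  define T2 where "T2 = uminus ` W \<oplus> W"
  have T2: "finite T2" using W by (simp add: T2_def)
  have symT2: "- t \<in> T2" if "t \<in> T2" for t using that symmetric_difference_set by (simp add: T2_def)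
  obtain C1 where C1: "C1 \<in> sets X" "discrete T0 C1" "\<And>x. x \<in> space X \<Longrightarrow> \<exists>t\<in>T1. act t x \<in> C1"
    using maximal_centers[OF T1(1) symT0] unfolding T1_def by metis
  obtain C2 where C2: "C2 \<in> sets X" "discrete T2 C2" "\<And>x. x \<in> space X \<Longrightarrow> \<exists>t\<in>insert 0 T2. act t x \<in> C2"
    using maximal_centers[OF T2 symT2] by metis
  have CX: "c \<in> space X" if "c \<in> C1 \<or> c \<in> C2" for c
    using that sets.sets_into_space[OF C1(1)] sets.sets_into_space[OF C2(1)] by blast
  have block_disj: "c = c'"
    if d: "discrete (uminus ` R \<oplus> R) C" "C \<subseteq> space X" and c: "c \<in> C" "c' \<in> C" and s: "s \<in> R" "w \<in> R"
      and e: "act s c = act w c'" for R C c c' s w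
  proof -
    have cX: "c \<in> space X" "c' \<in> space X" using c d(2) by auto
    have "c = act (- s + w) c'" using e act_eq_iff[of c' c w s] cX by auto
    moreover from this have "- s + w = 0"
      using c s by (intro discreteD[OF d(1) c(2)]) (auto intro: sumsetI)
    ultimately show ?thesis using cX by simp
  qed
  obtain M' K' where M': "M' \<in> sets X" "M' \<subseteq> M" "covers K' M'"
    and sparse: "\<And>x s s'. x \<in> space X \<Longrightarrow> s \<in> S \<union> W \<Longrightarrow> s' \<in> S \<union> W \<Longrightarrow> act s x \<in> M' \<Longrightarrow> act s' x \<in> M' \<Longrightarrow> s = s'"
    using sparse_reserve[OF M(1) K(3), of "S \<union> W"] S W by (metis finite_UnI)
  define D where "D = M - M'"
  have D: "D \<in> sets X" using M M' by (simp add: D_def)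
  note [measurable] = M(1) M'(1) D
  have SI: "a + (u + t) \<in> S" if "a \<in> K" "u + t \<in> S1" for a u t
    using that by (auto simp: S_def intro: sumsetI)
  have WI: "a + u \<in> W" if "a \<in> K" "u \<in> U" for a u
    using that by (auto simp: W_def intro: sumsetI)
  have agree_D: "agree_off M A A'" if "\<And>x. x \<notin> D \<Longrightarrow> x \<in> A' \<longleftrightarrow> x \<in> A" for A A'
    using that by (auto simp: agree_off_def D_def)
  have dense: "\<exists>a\<in>K. act (a + h) x \<in> D" if "x \<in> space X" "\<forall>a\<in>K. act (a + h) x \<notin> M'" for h x
  proof -
    have "act h x \<in> space X" using that by simp
    then have "\<exists>a\<in>K. act a (act h x) \<in> M" using K(3) unfolding covers_def by blast
    then show ?thesis using that by (auto simp: D_def)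
  qed
  define odd_at where "odd_at A h x \<longleftrightarrow> odd (card {a\<in>K. act (a + h) x \<in> A})" for A h x
  have odd_at_cong: "odd_at A h x \<longleftrightarrow> odd_at B h x"
    if "\<And>a. a \<in> K \<Longrightarrow> act (a + h) x \<in> A \<longleftrightarrow> act (a + h) x \<in> B" for A B h x
    unfolding odd_at_def using that by (metis (mono_tags, lifting) Collect_cong)
  have odd_at_shift: "odd_at A h (act t x) \<longleftrightarrow> odd_at A (h + t) x" if "x \<in> space X" for A h t x
    unfolding odd_at_def using that by (simp add: add.assoc)
  have [measurable]: "Measurable.pred X (odd_at A h)" if [measurable]: "A \<in> sets X" for A h
    unfolding odd_at_def by (rule pred_finite_Collect[OF K(1)]) measurable

  \<comment> \<open>The value False is a demand at every point of the space. Each centre of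
    \<open>C1\<close> handles all displacements \<open>t\<close> in \<open>T1\<close> and all
    exceptions \<open>u0\<close> simultaneously, through the union bound.\<close>
  have zero: "\<exists>A'. A' \<in> sets X \<and> agree_off M A A' \<and> (\<forall>B y u0. agree_off M' A' B \<longrightarrow> y \<in> space X \<longrightarrow> u0 \<in> U \<longrightarrow>
      (\<exists>u\<in>U. u \<noteq> u0 \<and> odd_at B u y))" if A: "A \<in> sets X" for A
  proof -
    define good where "good c A \<longleftrightarrow> (\<forall>t\<in>T1. \<forall>u0\<in>U. \<exists>u\<in>U. u \<noteq> u0 \<and> u + t \<in> S1 \<and>
      (\<forall>a\<in>K. act (a + (u + t)) c \<notin> M') \<and> odd_at A (u + t) c)" for c A
    have "\<exists>A'. A' \<in> sets X \<and> (\<forall>x. (\<forall>c\<in>C1. x \<notin> block S D c) \<longrightarrow> (x \<in> A' \<longleftrightarrow> x \<in> A)) \<and> (\<forall>c\<in>C1. good c A')"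
    proof (rule block_choice[OF S order_refl A C1(1) D, of good])
      show "c = c'" if "c \<in> C1" "c' \<in> C1" "s \<in> S" "w \<in> S" "act s c = act w c'" for c c' s w
        by (rule block_disj[OF _ _ that]) (use C1(2) CX T0_def in auto)
      show "{x \<in> space X. good x A} \<in> sets X" if [measurable]: "A \<in> sets X" for A
        unfolding good_def by measurable
      show "good c B" if e: "\<And>w. w \<in> S \<Longrightarrow> act w c \<in> A \<longleftrightarrow> act w c \<in> B" and g: "good c A" for c A B
      proof -
        have "odd_at A (u + t) c \<longleftrightarrow> odd_at B (u + t) c" if "u + t \<in> S1" for u t
          using e SI that by (intro odd_at_cong) blast
        then show ?thesis using g unfolding good_def by blast
      qed
      show "\<exists>q\<subseteq>block S D c. good c (A - block S D c \<union> q)" if "c \<in> C1" for c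
      proof -
        have c: "c \<in> space X" using that CX by blast
        define V where "V = block S D c"
        define P where "P t u = (\<lambda>a. act (a + (u + t)) c) ` K" for t u
        define I where "I t u0 = {u\<in>U. u \<noteq> u0 \<and> u + t \<in> S1 \<and> (\<forall>a\<in>K. act (a + (u + t)) c \<notin> M')}" for t u0
        define bad where "bad = (\<lambda>(t, u0) q. \<forall>u\<in>I t u0. even (card (P t u \<inter> ((A - V) \<union> q))))"
        have P_odd: "odd (card (P t u \<inter> Q)) \<longleftrightarrow> odd_at Q (u + t) c" for t u Q
        proof -
          have "P t u \<inter> Q = (\<lambda>a. act (a + (u + t)) c) ` {a\<in>K. act (a + (u + t)) c \<in> Q}"
            by (auto simp: P_def)
          then show ?thesis using c by (simp add: odd_at_def card_image inj_on_def)
        qed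
        have "\<exists>q\<subseteq>V. \<forall>j\<in>T1 \<times> U. \<not> bad j q"
        proof (rule union_bound[OF _ _ card_constraints])
          show finV: "finite V" unfolding V_def by (rule block_finite[OF S])
          show "finite (T1 \<times> U)" using T1 finU by simp
          fix j assume "j \<in> T1 \<times> U"
          then obtain t u0 where j: "j = (t, u0)" "t \<in> T1" "u0 \<in> U" by blast
          define X1 where "X1 = {u\<in>U. u + t \<in> S1 \<and> (\<exists>a\<in>K. act (a + (u + t)) c \<in> M')}"
          have "u = u'" if "u \<in> X1" "u' \<in> X1" for u u'
          proof -
            obtain a a' where a: "a \<in> K" "a' \<in> K" "act (a + (u + t)) c \<in> M'" "act (a' + (u' + t)) c \<in> M'"
              using \<open>u \<in> X1\<close> \<open>u' \<in> X1\<close> by (auto simp: X1_def)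
            then have "a + (u + t) = a' + (u' + t)"
              using that SI c by (intro sparse[OF c]) (auto simp: X1_def)
            then have "(a + u) + t = (a' + u') + t" by (simp only: add.assoc)
            then have "a + u = a' + u'" by (rule add_right_imp_eq)
            from separatedD[OF U(2) this] show ?thesis using a that by (auto simp: X1_def)
          qed
          then have "card X1 \<le> 1" using finU by (auto simp: card_le_Suc0_iff_eq X1_def)
          moreover have "card {u\<in>U. u + t \<in> S1} \<le> card (insert u0 (I t u0 \<union> X1))"
            using finU by (intro card_mono) (auto simp: I_def X1_def)
          moreover have "card (insert u0 (I t u0 \<union> X1)) \<le> Suc (card (I t u0 \<union> X1))"
            by (intro card_insert_le_m1) auto
          moreover have "card (I t u0 \<union> X1) \<le> card (I t u0) + card X1" by (rule card_Un_le)
          ultimately have cI: "k \<le> card (I t u0)" using many[OF j(2)] by (simp add: m_def)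
          show "card {q \<in> Pow V. bad j q} * 2 ^ k \<le> 2 ^ card V"
            unfolding bad_def j(1) prod.case
          proof (rule card_parities_even[OF finV _ _ _ _ cI])
            show "finite (I t u0)" using finU by (simp add: I_def)
            show "finite (P t u)" for u using K by (simp add: P_def)
            show "P t u \<inter> P t u' = {}" if u: "u \<in> I t u0" "u' \<in> I t u0" "u \<noteq> u'" for u u'
            proof (rule ccontr)
              assume "P t u \<inter> P t u' \<noteq> {}"
              then obtain a a' where a: "a \<in> K" "a' \<in> K" "act (a + (u + t)) c = act (a' + (u' + t)) c"
                by (auto simp: P_def)
              then have "a + (u + t) = a' + (u' + t)" using c by simp
              then have "(a + u) + t = (a' + u') + t" by (simp only: add.assoc)
              then have "a + u = a' + u'" by (rule add_right_imp_eq)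
              from separatedD[OF U(2) this] show False using a u by (auto simp: I_def)
            qed
            show "P t u \<inter> V \<noteq> {}" if u: "u \<in> I t u0" for u
            proof -
              obtain a where a: "a \<in> K" "act (a + (u + t)) c \<in> D" using dense[OF c] u by (auto simp: I_def)
              then have "act (a + (u + t)) c \<in> V"
                unfolding V_def using SI u c by (subst act_in_block_iff) (auto simp: I_def)
              then show ?thesis using a by (auto simp: P_def)
            qed
          qed
        qed
        then obtain q where q: "q \<subseteq> V" "\<And>j. j \<in> T1 \<times> U \<Longrightarrow> \<not> bad j q" by blast
        have "good c (A - V \<union> q)"
          unfolding good_def
        proof (intro ballI)
          fix t u0 assume "t \<in> T1" "u0 \<in> U"
          then have "\<not> bad (t, u0) q" by (intro q(2)) simp
          then obtain u where u: "u \<in> I t u0" "odd (card (P t u \<inter> ((A - V) \<union> q)))"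
            unfolding bad_def by blast
          show "\<exists>u\<in>U. u \<noteq> u0 \<and> u + t \<in> S1 \<and> (\<forall>a\<in>K. act (a + (u + t)) c \<notin> M') \<and> odd_at (A - V \<union> q) (u + t) c"
            using u unfolding P_odd by (auto simp: I_def)
        qed
        then show ?thesis using q(1) unfolding V_def by blast
      qed
    qed blast
    then obtain A' where A': "A' \<in> sets X" "\<And>x. \<forall>c\<in>C1. x \<notin> block S D c \<Longrightarrow> x \<in> A' \<longleftrightarrow> x \<in> A"
      "\<And>c. c \<in> C1 \<Longrightarrow> good c A'"
      by (elim exE conjE) simp
    have "\<exists>u\<in>U. u \<noteq> u0 \<and> odd_at B u y" if B: "agree_off M' A' B" and y: "y \<in> space X" and u0: "u0 \<in> U" for B y u0
    proof -
      obtain t where t: "t \<in> T1" "act t y \<in> C1" using C1(3)[OF y] by blast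
      define c where "c = act t y"
      have c: "c \<in> space X" "y = act (- t) c" using y by (simp_all add: c_def)
      obtain u where u: "u \<in> U" "u \<noteq> u0" "u + - t \<in> S1" "\<forall>a\<in>K. act (a + (u + - t)) c \<notin> M'"
        "odd_at A' (u + - t) c"
        using A'(3)[OF t(2)] symT1[OF t(1)] u0 unfolding good_def c_def[symmetric] by blast
      have "odd_at A' (u + - t) c \<longleftrightarrow> odd_at B (u + - t) c"
        using u(4) c(1) by (intro odd_at_cong agree_offD[OF B]) auto
      then show ?thesis using u c odd_at_shift[of c B u "- t"] by auto
    qed
    moreover have "agree_off M A A'"
      by (rule agree_D) (use A'(2) in \<open>auto simp: block_def\<close>)
    ultimately show ?thesis using A'(1) by blast
  qed

  \<comment> \<open>The value True only asks for one suitable point near each point, so it is enough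
    to correct the parities at the centres \<open>C2\<close>. Their windows are disjoint and the
    correction is explicit, without counting.\<close>
  have one: "\<exists>A'. A' \<in> sets X \<and> agree_off M A A' \<and> (\<forall>B c. agree_off M' A' B \<longrightarrow> c \<in> C2 \<longrightarrow>
      (\<exists>u0\<in>U. \<forall>u\<in>U. u \<noteq> u0 \<longrightarrow> \<not> odd_at B u c))" if A: "A \<in> sets X" for A
  proof -
    define good where "good c A \<longleftrightarrow> (\<exists>u0\<in>U. \<forall>u\<in>U. u \<noteq> u0 \<longrightarrow>
      (\<forall>a\<in>K. act (a + u) c \<notin> M') \<and> \<not> odd_at A u c)" for c A
    have "\<exists>A'. A' \<in> sets X \<and> (\<forall>x. (\<forall>c\<in>C2. x \<notin> block W D c) \<longrightarrow> (x \<in> A' \<longleftrightarrow> x \<in> A)) \<and> (\<forall>c\<in>C2. good c A')"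
    proof (rule block_choice[OF W order_refl A C2(1) D, of good])
      show "c = c'" if "c \<in> C2" "c' \<in> C2" "s \<in> W" "w \<in> W" "act s c = act w c'" for c c' s w
        by (rule block_disj[OF _ _ that]) (use C2(2) CX T2_def in auto)
      show "{x \<in> space X. good x A} \<in> sets X" if [measurable]: "A \<in> sets X" for A
        unfolding good_def by measurable
      show "good c B" if e: "\<And>w. w \<in> W \<Longrightarrow> act w c \<in> A \<longleftrightarrow> act w c \<in> B" and g: "good c A" for c A B
      proof -
        have "odd_at A u c \<longleftrightarrow> odd_at B u c" if "u \<in> U" for u
          using e WI that by (intro odd_at_cong) blast
        then show ?thesis using g unfolding good_def by blast
      qed
      show "\<exists>q\<subseteq>block W D c. good c (A - block W D c \<union> q)" if "c \<in> C2" for c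
      proof -
        have c: "c \<in> space X" using that CX by blast
        define V where "V = block W D c"
        obtain u0 where u0: "u0 \<in> U" "\<And>u a. u \<in> U \<Longrightarrow> a \<in> K \<Longrightarrow> act (a + u) c \<in> M' \<Longrightarrow> u = u0"
        proof (cases "\<exists>u\<in>U. \<exists>a\<in>K. act (a + u) c \<in> M'")
          case True
          then obtain u1 a1 where u1: "u1 \<in> U" "a1 \<in> K" "act (a1 + u1) c \<in> M'" by blast
          show thesis
          proof (rule that[OF u1(1)])
            fix u a assume u: "u \<in> U" "a \<in> K" "act (a + u) c \<in> M'"
            then have "a + u = a1 + u1" using u1 WI by (intro sparse[OF c]) auto
            from separatedD[OF U(2) this] show "u = u1" using u u1 by blast
          qed
        next
          case False
          then show thesis using that \<open>U \<noteq> {}\<close> by blast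
        qed
        have "\<forall>u\<in>U - {u0}. \<exists>a\<in>K. act (a + u) c \<in> D" using dense[OF c] u0(2) by blast
        then obtain f where f: "\<forall>u\<in>U - {u0}. f u \<in> K \<and> act (f u + u) c \<in> D" by metis
        \<comment> \<open>The block is emptied first; then the one point \<open>f u\<close> is
          coloured in exactly those windows where the remaining parity is odd.\<close>
        define q where "q = (\<lambda>u. act (f u + u) c) ` {u\<in>U - {u0}. odd_at (A - V) u c}"
        have qV: "q \<subseteq> V" using f WI c by (auto simp: q_def V_def act_in_block_iff)
        have "\<not> odd_at (A - V \<union> q) u c" if u: "u \<in> U" "u \<noteq> u0" for u
        proof -
          have q_iff: "act (a + u) c \<in> q \<longleftrightarrow> a = f u \<and> odd_at (A - V) u c" if a: "a \<in> K" for a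
          proof
            assume "act (a + u) c \<in> q"
            then obtain u' where u': "u' \<in> U" "u' \<noteq> u0" "odd_at (A - V) u' c" "act (a + u) c = act (f u' + u') c"
              by (auto simp: q_def)
            then have e: "a + u = f u' + u'" using c by simp
            moreover have "f u' \<in> K" using f u' by blast
            ultimately have "u = u'" using separatedD[OF U(2) e] a u u' by blast
            then show "a = f u \<and> odd_at (A - V) u c" using e u' by (auto intro: add_right_imp_eq)
          qed (use u in \<open>auto simp: q_def\<close>)
          have "f u \<in> K" "act (f u + u) c \<in> V" using f u WI c by (auto simp: V_def act_in_block_iff)
          moreover have "{a\<in>K. act (a + u) c \<in> A - V \<union> q} = {a\<in>K. act (a + u) c \<in> A - V} \<union> {a\<in>K. act (a + u) c \<in> q}"
            by blast
          moreover have "{a\<in>K. act (a + u) c \<in> q} = (if odd_at (A - V) u c then {f u} else {})"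
            using q_iff \<open>f u \<in> K\<close> by auto
          ultimately show ?thesis using K(1) unfolding odd_at_def by (auto simp del: Un_Diff_cancel2)
        qed
        then have "good c (A - V \<union> q)" using u0 unfolding good_def by blast
        then show ?thesis using qV unfolding V_def by blast
      qed
    qed blast
    then obtain A' where A': "A' \<in> sets X" "\<And>x. \<forall>c\<in>C2. x \<notin> block W D c \<Longrightarrow> x \<in> A' \<longleftrightarrow> x \<in> A"
      "\<And>c. c \<in> C2 \<Longrightarrow> good c A'"
      by (elim exE conjE) simp
    have "\<exists>u0\<in>U. \<forall>u\<in>U. u \<noteq> u0 \<longrightarrow> \<not> odd_at B u c" if B: "agree_off M' A' B" and c: "c \<in> C2" for B c
    proof -
      obtain u0 where u0: "u0 \<in> U" "\<And>u. u \<in> U \<Longrightarrow> u \<noteq> u0 \<Longrightarrow> (\<forall>a\<in>K. act (a + u) c \<notin> M') \<and> \<not> odd_at A' u c"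
        using A'(3)[OF c] unfolding good_def by blast
      have "odd_at A' u c \<longleftrightarrow> odd_at B u c" if "u \<in> U" "u \<noteq> u0" for u
        using u0(2)[OF that] CX[of c] c by (intro odd_at_cong agree_offD[OF B]) auto
      then show ?thesis using u0 by blast
    qed
    moreover have "agree_off M A A'"
      by (rule agree_D) (use A'(2) in \<open>auto simp: block_def\<close>)
    ultimately show ?thesis using A'(1) by blast
  qed

  define E where "E = W \<oplus> insert 0 T2"
  \<comment> \<open>The search over \<open>t\<close> makes the test meaningful at every point: it
    reaches a centre of \<open>C2\<close> when the bit is True, and finds nothing anywhere when it
    is False.\<close>
  define \<Omega> where "\<Omega> = {P. \<exists>t\<in>insert 0 T2. \<exists>u0\<in>U. \<forall>u\<in>U. u \<noteq> u0 \<longrightarrow> even (card {a\<in>K. a + u + t \<in> P})}"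
  have \<Omega>: "{e\<in>E. act e x \<in> B} \<in> \<Omega> \<longleftrightarrow> (\<exists>t\<in>insert 0 T2. \<exists>u0\<in>U. \<forall>u\<in>U. u \<noteq> u0 \<longrightarrow> \<not> odd_at B u (act t x))"
    if x: "x \<in> space X" for x B
  proof -
    define P where "P = {e\<in>E. act e x \<in> B}"
    have "{a\<in>K. a + u + t \<in> P} = {a\<in>K. act (a + u) (act t x) \<in> B}"
      if "t \<in> insert 0 T2" "u \<in> U" for t u
      using that x WI by (auto simp: P_def E_def intro: sumsetI)
    then have "even (card {a\<in>K. a + u + t \<in> P}) \<longleftrightarrow> \<not> odd_at B u (act t x)"
      if "t \<in> insert 0 T2" "u \<in> U" for t u
      using that by (simp only: odd_at_def not_not)
    then show ?thesis unfolding \<Omega>_def P_def[symmetric] by (simp only: mem_Collect_eq cong: bex_cong ball_cong)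
  qed
  show thesis
  proof (rule that[OF M', of E \<Omega>])
    show "finite E" using W T2 by (simp add: E_def)
    fix A b assume A: "A \<in> sets X"
    show "\<exists>A'\<in>sets X. agree_off M A A' \<and>
      (\<forall>B. agree_off M' A' B \<longrightarrow> (\<forall>x\<in>space X. {e\<in>E. act e x \<in> B} \<in> \<Omega> \<longleftrightarrow> b))"
    proof (cases b)
      case True
      obtain A' where A': "A' \<in> sets X" "agree_off M A A'"
        "\<And>B c. agree_off M' A' B \<Longrightarrow> c \<in> C2 \<Longrightarrow> \<exists>u0\<in>U. \<forall>u\<in>U. u \<noteq> u0 \<longrightarrow> \<not> odd_at B u c"
        using one[OF A] by blast
      have "{e\<in>E. act e x \<in> B} \<in> \<Omega>" if "agree_off M' A' B" "x \<in> space X" for B x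
        using C2(3)[OF that(2)] A'(3)[OF that(1)] unfolding \<Omega>[OF that(2)] by blast
      then show ?thesis using A' True by blast
    next
      case False
      obtain A' where A': "A' \<in> sets X" "agree_off M A A'"
        "\<And>B y u0. agree_off M' A' B \<Longrightarrow> y \<in> space X \<Longrightarrow> u0 \<in> U \<Longrightarrow> \<exists>u\<in>U. u \<noteq> u0 \<and> odd_at B u y"
        using zero[OF A] by blast
      have "{e\<in>E. act e x \<in> B} \<notin> \<Omega>" if "agree_off M' A' B" "x \<in> space X" for B x
        using A'(3)[OF that(1) act_space[OF that(2)]] unfolding \<Omega>[OF that(2)] by blast
      then show ?thesis using A' False by blast
    qed
  qed
qed

end

section \<open>Equivariant maps into the free part\<close>

text \<open>Only finitely many coordinates are inspected. The map \<open>h\<close> lets the lemma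
  apply both to inverted group elements and to initial segments of bit sequences.\<close>

lemma pattern_clopen:
  fixes h :: "'i \<Rightarrow> 'a"
  assumes "finite E"
  shows "closed {v :: 'a \<Rightarrow> bool. Q {e\<in>E. v (h e)}}" "open {v :: 'a \<Rightarrow> bool. Q {e\<in>E. v (h e)}}"
proof -
  have cl: "closed {v :: 'a \<Rightarrow> bool. R {e\<in>E. v (h e)}}" for R
  proof -
    have "{v :: 'a \<Rightarrow> bool. R {e\<in>E. v (h e)}} = (\<Union>L\<in>{L. L \<subseteq> E \<and> R L}. \<Inter>e\<in>E. {v. v (h e) = (e \<in> L)})"
    proof (intro set_eqI iffI)
      fix v assume "v \<in> (\<Union>L\<in>{L. L \<subseteq> E \<and> R L}. \<Inter>e\<in>E. {v. v (h e) = (e \<in> L)})"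
      then obtain L where L: "L \<subseteq> E" "R L" "\<forall>e\<in>E. v (h e) = (e \<in> L)" by auto
      then have "{e\<in>E. v (h e)} = L" by blast
      then show "v \<in> {v. R {e\<in>E. v (h e)}}" using L(2) by simp
    next
      fix v assume "v \<in> {v. R {e\<in>E. v (h e)}}"
      then show "v \<in> (\<Union>L\<in>{L. L \<subseteq> E \<and> R L}. \<Inter>e\<in>E. {v. v (h e) = (e \<in> L)})"
        by (intro UN_I[of "{e\<in>E. v (h e)}"]) auto
    qed
    moreover have "closed {v :: 'a \<Rightarrow> bool. v a = b}" for a b
      by (intro closed_Collect_eq continuous_on_const continuous_on_product_coordinates)
    ultimately show ?thesis using assms by (auto intro!: closed_UN closed_INT)
  qed
  show "closed {v :: 'a \<Rightarrow> bool. Q {e\<in>E. v (h e)}}" by (rule cl)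
  have "{v :: 'a \<Rightarrow> bool. Q {e\<in>E. v (h e)}} = - {v. \<not> Q {e\<in>E. v (h e)}}" by blast
  then show "open {v :: 'a \<Rightarrow> bool. Q {e\<in>E. v (h e)}}" using cl[of "\<lambda>L. \<not> Q L"] by (simp add: open_closed)
qed

text \<open>This makes measurability into a countable power of \<open>bool\<close> a coordinatewise
  matter.\<close>

instance bool :: second_countable_topology
proof
  have "open S = generate_topology (UNIV :: bool set set) S" for S
    by (auto simp: discrete_topology_class.open_discrete intro: generate_topology.Basis)
  then show "\<exists>B :: bool set set. countable B \<and> open = generate_topology B"
    by (intro exI[of _ UNIV]) (auto intro: countable_finite)
qed

lemma borel_measurable_bool_iff: "f \<in> M \<rightarrow>\<^sub>M (borel :: bool measure) \<longleftrightarrow> Measurable.pred M f"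
proof -
  have "S \<in> sets borel" for S :: "bool set" by (intro borel_open discrete_topology_class.open_discrete)
  then have "sets (borel :: bool measure) = sets (count_space UNIV)" by auto
  then show ?thesis by (intro arg_cong2[where f="(\<in>)"] refl measurable_cong_sets)
qed

section \<open>Iterating the stages and passing from Borel sets to equivariant maps\<close>

context free_borel_action begin

text \<open>One stage, which breaks the period \<open>g\<close> and stores the bit \<open>b\<close>.
  The enumeration of the group also meets 0, where only the bit matters. \<open>E\<close> and
  \<Omega> are arguments, so they cannot depend on the colouring or the bit.\<close>

definition refines :: "'g \<Rightarrow> 'x set \<Rightarrow> 'x set \<Rightarrow> 'g set \<Rightarrow> 'g set set \<Rightarrow> bool" where
  "refines g M M' E \<Omega> \<longleftrightarrow> finite E \<and> (\<forall>A b. A \<in> sets X \<longrightarrow> (\<exists>A'\<in>sets X. agree_off M A A' \<and>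
    (\<forall>B. agree_off M' A' B \<longrightarrow> (\<forall>x\<in>space X.
      (g \<noteq> 0 \<longrightarrow> (\<exists>e\<in>E. (act e x \<in> B) \<noteq> (act (e + g) x \<in> B))) \<and> ({e\<in>E. act e x \<in> B} \<in> \<Omega> \<longleftrightarrow> b)))))"

text \<open>The period is broken on \<open>M\<close> and the bit is then stored inside
  \<open>M1\<close>. The second colouring and all its completions agree with the first one off
  \<open>M1\<close>, so the first guarantee persists.\<close>

lemma ex_refinement:
  assumes M: "M \<in> sets X" "covers K M"
  shows "\<exists>M' E \<Omega> K'. M' \<in> sets X \<and> M' \<subseteq> M \<and> covers K' M' \<and> refines g M M' E \<Omega>"
proof -
  have "\<exists>M1 K1 E1. M1 \<in> sets X \<and> M1 \<subseteq> M \<and> covers K1 M1 \<and> finite E1 \<and> (\<forall>A. A \<in> sets X \<longrightarrow> (\<exists>A'\<in>sets X. agree_off M A A' \<and>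
      (\<forall>B. agree_off M1 A' B \<longrightarrow> (\<forall>x\<in>space X. g \<noteq> 0 \<longrightarrow> (\<exists>e\<in>E1. (act e x \<in> B) \<noteq> (act (e + g) x \<in> B))))))"
  proof (cases "g = 0")
    case True
    then show ?thesis using M by (intro exI[of _ M] exI[of _ K] exI[of _ "{}"]) (auto simp: agree_off_def)
  next
    case False
    show ?thesis
    proof (rule break_symmetry[OF M False])
      fix M1 K1 E1
      assume "M1 \<in> sets X" "M1 \<subseteq> M" "covers K1 M1" "finite E1"
        and step: "\<And>A. A \<in> sets X \<Longrightarrow> \<exists>A'\<in>sets X. agree_off M A A' \<and>
          (\<forall>B. agree_off M1 A' B \<longrightarrow> (\<forall>x\<in>space X. \<exists>e\<in>E1. (act e x \<in> B) \<noteq> (act (e + g) x \<in> B)))"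
      then show ?thesis using False by (intro exI[of _ M1] exI[of _ K1] exI[of _ E1]) simp
    qed
  qed
  then obtain M1 K1 E1 where M1: "M1 \<in> sets X" "M1 \<subseteq> M" "covers K1 M1" "finite E1"
    and A1: "\<And>A. A \<in> sets X \<Longrightarrow> \<exists>A'\<in>sets X. agree_off M A A' \<and>
      (\<forall>B. agree_off M1 A' B \<longrightarrow> (\<forall>x\<in>space X. g \<noteq> 0 \<longrightarrow> (\<exists>e\<in>E1. (act e x \<in> B) \<noteq> (act (e + g) x \<in> B))))"
    by (elim exE conjE) simp
  show ?thesis
  proof (rule encode_bit[OF M1(1,3)])
    fix M' K' E2 \<Omega>
    assume M': "M' \<in> sets X" "M' \<subseteq> M1" "covers K' M'" "finite E2"
      and A2: "\<And>A b. A \<in> sets X \<Longrightarrow> \<exists>A'\<in>sets X. agree_off M1 A A' \<and>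
        (\<forall>B. agree_off M' A' B \<longrightarrow> (\<forall>x\<in>space X. {e\<in>E2. act e x \<in> B} \<in> \<Omega> \<longleftrightarrow> b))"
    have "refines g M M' (E1 \<union> E2) {P. P \<inter> E2 \<in> \<Omega>}"
      unfolding refines_def
    proof (intro conjI allI impI)
      show "finite (E1 \<union> E2)" using M1 M' by simp
      fix A b assume "A \<in> sets X"
      then obtain A' where A': "A' \<in> sets X" "agree_off M A A'"
        "\<And>B x. agree_off M1 A' B \<Longrightarrow> x \<in> space X \<Longrightarrow> g \<noteq> 0 \<Longrightarrow> \<exists>e\<in>E1. (act e x \<in> B) \<noteq> (act (e + g) x \<in> B)"
        using A1[of A] by auto
      obtain A'' where A'': "A'' \<in> sets X" "agree_off M1 A' A''"
        "\<And>B x. agree_off M' A'' B \<Longrightarrow> x \<in> space X \<Longrightarrow> {e\<in>E2. act e x \<in> B} \<in> \<Omega> \<longleftrightarrow> b"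
        using A2[OF A'(1), of b] by auto
      show "\<exists>A'\<in>sets X. agree_off M A A' \<and> (\<forall>B. agree_off M' A' B \<longrightarrow> (\<forall>x\<in>space X.
        (g \<noteq> 0 \<longrightarrow> (\<exists>e\<in>E1 \<union> E2. (act e x \<in> B) \<noteq> (act (e + g) x \<in> B))) \<and>
        ({e\<in>E1 \<union> E2. act e x \<in> B} \<in> {P. P \<inter> E2 \<in> \<Omega>} \<longleftrightarrow> b)))"
      proof (intro bexI[of _ A''] conjI allI impI ballI A''(1))
        show "agree_off M A A''" by (rule agree_off_trans[OF A'(2) A''(2) order_refl M1(2)])
        fix B x assume B: "agree_off M' A'' B" and x: "x \<in> space X"
        show "\<exists>e\<in>E1 \<union> E2. (act e x \<in> B) \<noteq> (act (e + g) x \<in> B)" if "g \<noteq> 0"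
          using A'(3)[OF agree_off_trans[OF A''(2) B order_refl M'(2)] x that] by blast
        have "{e\<in>E1 \<union> E2. act e x \<in> B} \<inter> E2 = {e\<in>E2. act e x \<in> B}" by blast
        then show "{e\<in>E1 \<union> E2. act e x \<in> B} \<in> {P. P \<inter> E2 \<in> \<Omega>} \<longleftrightarrow> b"
          using A''(3)[OF B x] by simp
      qed
    qed
    then show ?thesis using M' M1 by blast
  qed
qed

text \<open>Only the colourings \<open>A n w\<close> depend on \<open>w\<close>, and only on its
  first \<open>n\<close> bits. Distinct sequences differ in some bit \<open>n\<close>, and then the
  test \<open>\<Omega> n\<close> or its complement separates them.\<close>

lemma coded_sets:
  assumes M0: "M0 \<in> sets X" "covers K0 M0" and A0: "A0 \<in> sets X"
  obtains B :: "(nat \<Rightarrow> bool) \<Rightarrow> 'x set" where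
    "\<And>w. B w \<in> sets X" "\<And>w. agree_off M0 A0 (B w)"
    "\<And>w g. g \<noteq> 0 \<Longrightarrow> \<exists>E. finite E \<and> (\<forall>x\<in>space X. \<exists>e\<in>E. (act e x \<in> B w) \<noteq> (act (e + g) x \<in> B w))"
    "\<And>w z. w \<noteq> z \<Longrightarrow> \<exists>E \<Omega>. finite E \<and> (\<forall>x\<in>space X. {e\<in>E. act e x \<in> B w} \<in> \<Omega>) \<and>
      (\<forall>x\<in>space X. {e\<in>E. act e x \<in> B z} \<notin> \<Omega>)"
    "Measurable.pred (borel \<Otimes>\<^sub>M X) (\<lambda>p. snd p \<in> B (fst p))"
    "\<And>x w. \<exists>n. \<forall>z. (\<forall>k<n. z k = w k) \<longrightarrow> (x \<in> B z \<longleftrightarrow> x \<in> B w)"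
proof -
  define gs :: "nat \<Rightarrow> 'g" where "gs = from_nat"
  have gs: "\<exists>n. gs n = g" for g unfolding gs_def by (metis from_nat_to_nat)
  define state where "state n M \<longleftrightarrow> M \<in> sets X \<and> (\<exists>K. covers K M) \<and> (n = 0 \<longrightarrow> M = M0)" for n :: nat and M
  define next_state where "next_state n M M' \<longleftrightarrow> M' \<subseteq> M \<and> (\<exists>E \<Omega>. refines (gs n) M M' E \<Omega>)" for n M M'
  have "\<exists>M. \<forall>n. state n (M n) \<and> next_state n (M n) (M (Suc n))"
  proof (rule dependent_nat_choice[of state next_state])
    show "\<exists>M. state 0 M" using M0 by (auto simp: state_def)
    show "\<exists>M'. state (Suc n) M' \<and> next_state n M M'" if "state n M" for M n
      using that ex_refinement[of M _ "gs n"] unfolding state_def next_state_def by (metis nat.simps(3))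
  qed
  then obtain M where st: "\<And>n. state n (M n)" and nx: "\<And>n. next_state n (M n) (M (Suc n))" by blast
  have M [measurable]: "\<And>n. M n \<in> sets X" and M_0: "M 0 = M0" using st by (auto simp: state_def)
  have M_mono: "n \<le> j \<Longrightarrow> M j \<subseteq> M n" for n j
    by (rule lift_Suc_antimono_le[where f=M]) (use nx in \<open>auto simp: next_state_def\<close>)
  have "\<forall>n. \<exists>E \<Omega>. refines (gs n) (M n) (M (Suc n)) E \<Omega>" using nx by (auto simp: next_state_def)
  then obtain E \<Omega> where ref: "\<And>n. refines (gs n) (M n) (M (Suc n)) (E n) (\<Omega> n)" by metis
  have finE: "finite (E n)" for n using ref[of n] by (simp add: refines_def)
  define ok where "ok n b A A' \<longleftrightarrow> A' \<in> sets X \<and> agree_off (M n) A A' \<and>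
    (\<forall>B. agree_off (M (Suc n)) A' B \<longrightarrow> (\<forall>x\<in>space X.
      (gs n \<noteq> 0 \<longrightarrow> (\<exists>e\<in>E n. (act e x \<in> B) \<noteq> (act (e + gs n) x \<in> B))) \<and>
      ({e\<in>E n. act e x \<in> B} \<in> \<Omega> n \<longleftrightarrow> b)))" for n b A A'
  have ex_ok: "\<exists>A'. ok n b A A'" if "A \<in> sets X" for n b A
    using ref[of n] that unfolding refines_def ok_def by blast
  \<comment> \<open>The next colouring is a fixed function of the stage, the bit and the present
    colouring, so sequences with a common initial segment produce identical sets.\<close>
  define nxt where "nxt n b A = (SOME A'. ok n b A A')" for n b A
  have nxt: "ok n b A (nxt n b A)" if "A \<in> sets X" for n b A
    unfolding nxt_def by (rule someI_ex[OF ex_ok[OF that]])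
  define A where "A n w = rec_nat A0 (\<lambda>n. nxt n (w n)) n" for n w
  have A_0: "A 0 w = A0" and A_Suc: "A (Suc n) w = nxt n (w n) (A n w)" for n w
    by (simp_all add: A_def)
  have A_sets [measurable]: "A n w \<in> sets X" for n w
  proof (induction n)
    case (Suc n)
    then show ?case using nxt[of "A n w" n "w n"] by (simp add: A_Suc ok_def)
  qed (simp add: A_0 A0)
  have A_ok: "ok n (w n) (A n w) (A (Suc n) w)" for n w unfolding A_Suc by (intro nxt A_sets)
  have A_cong: "A n w = A n z" if "\<forall>k<n. z k = w k" for n w z
    using that by (induction n) (auto simp: A_0 A_Suc)
  have stable: "x \<in> A j w \<longleftrightarrow> x \<in> A n w" if "x \<notin> M n" "n \<le> j" "x \<in> space X" for x n j w
    using that(2)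
  proof (induction j rule: dec_induct)
    case (step j)
    have "x \<notin> M j" using M_mono[OF step(1)] that(1) by blast
    then show ?case using step A_ok[of j w] that(3) unfolding ok_def by (blast dest: agree_offD)
  qed simp
  \<comment> \<open>Points lying in every \<open>M n\<close> are never coloured and get the default
    value False. Each stage admits arbitrary values there.\<close>
  define B where "B w = {x \<in> space X. \<exists>n. x \<notin> M n \<and> x \<in> A n w}" for w
  have limit: "x \<in> B w \<longleftrightarrow> x \<in> A n w" if "x \<notin> M n" "x \<in> space X" for x n w
  proof
    assume "x \<in> B w"
    then obtain j where "x \<notin> M j" "x \<in> A j w" by (auto simp: B_def)
    then show "x \<in> A n w" using stable[of x n "max n j" w] stable[of x j "max n j" w] that by simp
  qed (use that in \<open>auto simp: B_def\<close>)
  have agree: "agree_off (M n) (A n w) (B w)" for n w using limit by (auto simp: agree_off_def)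
  show thesis
  proof (rule that[of B])
    show "B w \<in> sets X" for w unfolding B_def by measurable
    show "agree_off M0 A0 (B w)" for w using agree[of 0 w] by (simp add: M_0 A_0)
    show "\<exists>E. finite E \<and> (\<forall>x\<in>space X. \<exists>e\<in>E. (act e x \<in> B w) \<noteq> (act (e + g) x \<in> B w))" if "g \<noteq> 0" for w g
    proof -
      obtain n where n: "gs n = g" using gs by blast
      have "\<forall>x\<in>space X. \<exists>e\<in>E n. (act e x \<in> B w) \<noteq> (act (e + g) x \<in> B w)"
        using A_ok[of n w] agree[of "Suc n" w] that n unfolding ok_def by blast
      then show ?thesis using finE by blast
    qed
    show "\<exists>E \<Omega>. finite E \<and> (\<forall>x\<in>space X. {e\<in>E. act e x \<in> B w} \<in> \<Omega>) \<and>
      (\<forall>x\<in>space X. {e\<in>E. act e x \<in> B z} \<notin> \<Omega>)" if "w \<noteq> z" for w z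
    proof -
      obtain n where n: "w n \<noteq> z n" using \<open>w \<noteq> z\<close> by blast
      have bit: "\<forall>x\<in>space X. {e\<in>E n. act e x \<in> B v} \<in> \<Omega> n \<longleftrightarrow> v n" for v
        using A_ok[of n v] agree[of "Suc n" v] unfolding ok_def by blast
      show ?thesis
      proof (cases "w n")
        case True
        then show ?thesis using n bit finE by (intro exI[of _ "E n"] exI[of _ "\<Omega> n"]) auto
      next
        case False
        then show ?thesis using n bit finE by (intro exI[of _ "E n"] exI[of _ "- \<Omega> n"]) auto
      qed
    qed
    show "\<exists>n. \<forall>z. (\<forall>k<n. z k = w k) \<longrightarrow> (x \<in> B z \<longleftrightarrow> x \<in> B w)" for x w
    proof (cases "\<exists>n. x \<notin> M n")
      case True
      then obtain n where "x \<notin> M n" by blast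
      then show ?thesis
        using limit[of x n] A_cong[of n _ w] by (cases "x \<in> space X") (auto simp: B_def intro!: exI[of _ n])
    qed (auto simp: B_def)
    \<comment> \<open>Truncation to \<open>n\<close> bits has finite range, so the
      \<open>n\<close>-th colouring is, jointly in the sequence and the point, a finite union of
      measurable rectangles.\<close>
    define r where "r n v = (\<lambda>k. k < n \<and> v k)" for n :: nat and v :: "nat \<Rightarrow> bool"
    have fin_r: "finite (range (r n))" for n
    proof (rule finite_subset)
      show "range (r n) \<subseteq> (\<lambda>S k. k \<in> S) ` Pow {..<n}"
      proof
        fix u assume "u \<in> range (r n)"
        then obtain v where "u = r n v" by blast
        then have "u = (\<lambda>k. k \<in> {k. k < n \<and> v k})" by (auto simp: r_def)
        then show "u \<in> (\<lambda>S k. k \<in> S) ` Pow {..<n}" by blast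
      qed
    qed simp
    have A_r: "x \<in> A n w \<longleftrightarrow> (\<exists>v\<in>range (r n). (\<forall>k<n. w k = v k) \<and> x \<in> A n v)" for n w x
    proof
      assume "x \<in> A n w"
      moreover have "A n (r n w) = A n w" by (rule A_cong) (simp add: r_def)
      ultimately show "\<exists>v\<in>range (r n). (\<forall>k<n. w k = v k) \<and> x \<in> A n v"
        by (intro bexI[of _ "r n w"]) (auto simp: r_def)
    next
      assume "\<exists>v\<in>range (r n). (\<forall>k<n. w k = v k) \<and> x \<in> A n v"
      then obtain v where "\<forall>k<n. w k = v k" "x \<in> A n v" by blast
      then show "x \<in> A n w" using A_cong[of n w v] by simp
    qed
    have coord [measurable]: "Measurable.pred (borel \<Otimes>\<^sub>M X) (\<lambda>p. fst p k)" for k :: nat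
      unfolding borel_measurable_bool_iff[symmetric]
      by (rule measurable_compose[OF measurable_fst measurable_product_coordinates])
    have pred_A [measurable]: "Measurable.pred (borel \<Otimes>\<^sub>M X) (\<lambda>p. snd p \<in> A n (fst p))" for n
    proof -
      have "Measurable.pred (borel \<Otimes>\<^sub>M X) (\<lambda>p. \<exists>v\<in>range (r n). (\<forall>k<n. fst p k = v k) \<and> snd p \<in> A n v)"
        by (intro pred_intros_finite fin_r) measurable
      also have "(\<lambda>p. \<exists>v\<in>range (r n). (\<forall>k<n. fst p k = v k) \<and> snd p \<in> A n v) = (\<lambda>p. snd p \<in> A n (fst p))"
        by (rule ext) (rule A_r[symmetric])
      finally show ?thesis .
    qed
    have "Measurable.pred (borel \<Otimes>\<^sub>M X) (\<lambda>p. \<exists>n. snd p \<notin> M n \<and> snd p \<in> A n (fst p))"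
      by measurable
    also have "?this \<longleftrightarrow> Measurable.pred (borel \<Otimes>\<^sub>M X) (\<lambda>p. snd p \<in> B (fst p))"
      by (intro measurable_cong) (auto simp: B_def space_pair_measure)
    finally show "Measurable.pred (borel \<Otimes>\<^sub>M X) (\<lambda>p. snd p \<in> B (fst p))" .
  qed
qed

text \<open>The map f_A written without images of sets; \<open>set_map_eq_coding\<close> identifies
  it with \<open>set_map\<close> on the space for Borel \<open>A\<close>.\<close>

definition coding :: "'x set \<Rightarrow> 'x \<Rightarrow> 'g \<Rightarrow> bool" where
  "coding A x = (\<lambda>g. act (- g) x \<in> A)"

lemma coding_equivariant:
  assumes [measurable]: "A \<in> sets X"
  shows "borel_equivariant X act (coding A)"
  unfolding borel_equivariant_def
proof (intro conjI allI ballI)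
  show "coding A \<in> X \<rightarrow>\<^sub>M borel"
    by (rule measurable_coordinatewise_then_product) (unfold coding_def borel_measurable_bool_iff, measurable)
  show "coding A (act g x) = shift g (coding A x)" if "x \<in> space X" for g x
    using that by (auto simp: coding_def shift_def minus_add simp del: add_uminus_conv_diff)
qed

text \<open>A test on finitely many coordinates defines a closed set, so what holds uniformly on the
  image passes to its closure. It yields both freeness of limit points and disjointness of
  closures.\<close>

lemma closure_coding_subset:
  assumes "finite E" "\<And>x. x \<in> space X \<Longrightarrow> Q {e\<in>E. act e x \<in> A}"
  shows "closure (coding A ` space X) \<subseteq> {v. Q {e\<in>E. v (- e)}}"
  using assms by (intro closure_minimal pattern_clopen) (auto simp: coding_def)

lemma closure_coding_free:
  assumes "\<And>g. g \<noteq> 0 \<Longrightarrow> \<exists>E. finite E \<and> (\<forall>x\<in>space X. \<exists>e\<in>E. (act e x \<in> A) \<noteq> (act (e + g) x \<in> A))"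
  shows "closure (coding A ` space X) \<subseteq> Free_part"
proof
  fix v assume v: "v \<in> closure (coding A ` space X)"
  have "shift g v \<noteq> v" if g: "g \<noteq> 0" for g
  proof -
    obtain E where E: "finite E" "\<forall>x\<in>space X. \<exists>e\<in>E. (act e x \<in> A) \<noteq> (act (e + g) x \<in> A)"
      using assms[OF g] by blast
    define E' where "E' = E \<union> (\<lambda>e. e + g) ` E"
    define Q where "Q P \<longleftrightarrow> (\<exists>e\<in>E. (e \<in> P) \<noteq> (e + g \<in> P))" for P
    have "v \<in> {v. Q {e\<in>E'. v (- e)}}"
    proof (rule subsetD[OF closure_coding_subset v])
      show "finite E'" using E by (simp add: E'_def)
      show "Q {e\<in>E'. act e x \<in> A}" if "x \<in> space X" for x
        using E(2) that by (auto simp: Q_def E'_def)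
    qed
    then obtain e where "v (- e) \<noteq> v (- (e + g))" by (auto simp: Q_def E'_def)
    then have "v (- e) \<noteq> shift g v (- e)" by (simp add: shift_def minus_add)
    then show ?thesis by metis
  qed
  then show "v \<in> Free_part" by (simp add: Free_part_def)
qed

lemma syndetic_covers:
  assumes "syndetic X act M"
  obtains K where "covers K M"
proof -
  obtain F where F: "finite F" "space X = (\<Union>g\<in>F. act g ` M)" "M \<subseteq> space X"
    using assms unfolding syndetic_def by blast
  have "covers (uminus ` F) M"
    unfolding covers_def
  proof (intro conjI ballI)
    fix x assume "x \<in> space X"
    then obtain g y where "g \<in> F" "y \<in> M" "x = act g y" using F(2) by blast
    then show "\<exists>k\<in>uminus ` F. act k x \<in> M" using F(3) by (intro bexI[of _ "- g"]) auto
  qed (use F in simp)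
  then show thesis by (rule that)
qed

lemma covers_syndetic:
  assumes "covers K M" "M \<subseteq> space X"
  shows "syndetic X act M"
  unfolding syndetic_def
proof (intro conjI exI[of _ "uminus ` K"] equalityI subsetI)
  fix x assume x: "x \<in> space X"
  then obtain k where k: "k \<in> K" "act k x \<in> M" using assms by (auto simp: covers_def)
  then have "x = act (- k) (act k x)" using x by simp
  then show "x \<in> (\<Union>g\<in>uminus ` K. act g ` M)" using k by blast
qed (use assms in \<open>auto simp: covers_def\<close>)

text \<open>The complement of \<open>Y\<close> is the initial open set and the preimage of True
  under \<phi> the initial colouring; agreement off the open set is then the prescription.\<close>

lemma prescribed_family:
  assumes Y: "Y \<in> sets X" "syndetic X act (space X - Y)"
    and \<phi>: "\<phi> \<in> restrict_space X Y \<rightarrow>\<^sub>M (borel :: bool measure)"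
  obtains f :: "(nat \<Rightarrow> bool) \<Rightarrow> 'x \<Rightarrow> 'g \<Rightarrow> bool" where
    "\<And>w. borel_equivariant X act (f w)" "\<And>w. closure (f w ` space X) \<subseteq> Free_part"
    "\<And>w y. y \<in> Y \<Longrightarrow> f w y 0 = \<phi> y"
    "\<And>w z. w \<noteq> z \<Longrightarrow> closure (f w ` space X) \<inter> closure (f z ` space X) = {}"
    "(\<lambda>(w, x). f w x) \<in> (borel \<Otimes>\<^sub>M X) \<rightarrow>\<^sub>M borel"
    "\<And>x. x \<in> space X \<Longrightarrow> continuous_on UNIV (\<lambda>w. f w x)"
proof -
  have YX: "Y \<subseteq> space X" using Y(1) by (rule sets.sets_into_space)
  define A0 where "A0 = {y \<in> Y. \<phi> y}"
  have "{y \<in> space (restrict_space X Y). \<phi> y} = A0"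
    using YX by (auto simp: A0_def space_restrict_space)
  then have "A0 \<in> sets (restrict_space X Y)"
    using \<phi> unfolding borel_measurable_bool_iff pred_def by metis
  then have A0: "A0 \<in> sets X" using Y(1) by (simp add: sets_restrict_space_iff)
  obtain K where K: "covers K (space X - Y)" using syndetic_covers[OF Y(2)] .
  have M0: "space X - Y \<in> sets X" using Y(1) by auto
  show thesis
  proof (rule coded_sets[OF M0 K A0])
    fix B :: "(nat \<Rightarrow> bool) \<Rightarrow> 'x set"
    assume B: "\<And>w. B w \<in> sets X" "\<And>w. agree_off (space X - Y) A0 (B w)"
      "\<And>w g. g \<noteq> 0 \<Longrightarrow> \<exists>E. finite E \<and> (\<forall>x\<in>space X. \<exists>e\<in>E. (act e x \<in> B w) \<noteq> (act (e + g) x \<in> B w))"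
      "\<And>w z. w \<noteq> z \<Longrightarrow> \<exists>E \<Omega>. finite E \<and> (\<forall>x\<in>space X. {e\<in>E. act e x \<in> B w} \<in> \<Omega>) \<and>
        (\<forall>x\<in>space X. {e\<in>E. act e x \<in> B z} \<notin> \<Omega>)"
      "Measurable.pred (borel \<Otimes>\<^sub>M X) (\<lambda>p. snd p \<in> B (fst p))"
      "\<And>x w. \<exists>n. \<forall>z. (\<forall>k<n. z k = w k) \<longrightarrow> (x \<in> B z \<longleftrightarrow> x \<in> B w)"
    show thesis
    proof (rule that[of "\<lambda>w. coding (B w)"])
      show "borel_equivariant X act (coding (B w))" for w by (intro coding_equivariant B)
      show "closure (coding (B w) ` space X) \<subseteq> Free_part" for w by (intro closure_coding_free B)
      show "coding (B w) y 0 = \<phi> y" if "y \<in> Y" for w y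
      proof -
        have "y \<in> A0 \<longleftrightarrow> y \<in> B w" using that YX by (intro agree_offD[OF B(2)]) auto
        then show ?thesis using that YX by (auto simp: coding_def A0_def)
      qed
      show "closure (coding (B w) ` space X) \<inter> closure (coding (B z) ` space X) = {}" if "w \<noteq> z" for w z
      proof -
        obtain E \<Omega> where E: "finite E" "\<forall>x\<in>space X. {e\<in>E. act e x \<in> B w} \<in> \<Omega>"
          "\<forall>x\<in>space X. {e\<in>E. act e x \<in> B z} \<notin> \<Omega>" using B(4)[OF \<open>w \<noteq> z\<close>] by blast
        have "closure (coding (B w) ` space X) \<subseteq> {v. {e\<in>E. v (- e)} \<in> \<Omega>}"
          using E by (intro closure_coding_subset) auto
        moreover have "closure (coding (B z) ` space X) \<subseteq> {v. {e\<in>E. v (- e)} \<notin> \<Omega>}"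
          using E by (intro closure_coding_subset[where Q="\<lambda>P. P \<notin> \<Omega>"]) auto
        ultimately show ?thesis by blast
      qed
      show "(\<lambda>(w, x). coding (B w) x) \<in> (borel \<Otimes>\<^sub>M X) \<rightarrow>\<^sub>M borel"
      proof (rule measurable_coordinatewise_then_product)
        fix g
        have "(\<lambda>p. (fst p, act (- g) (snd p))) \<in> borel \<Otimes>\<^sub>M X \<rightarrow>\<^sub>M (borel \<Otimes>\<^sub>M X)" by measurable
        from measurable_compose[OF this B(5)]
        show "(\<lambda>p. (case p of (w, x) \<Rightarrow> coding (B w) x) g) \<in> borel_measurable (borel \<Otimes>\<^sub>M X)"
          unfolding borel_measurable_bool_iff by (simp add: coding_def case_prod_beta)
      qed
      show "continuous_on UNIV (\<lambda>w. coding (B w) x)" if "x \<in> space X" for x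
      proof (rule continuous_on_coordinatewise_then_product)
        fix g
        have "open ((\<lambda>w. coding (B w) x g) -` S)" for S
        proof (rule open_subopen[THEN iffD2], rule ballI)
          fix w assume w: "w \<in> (\<lambda>w. coding (B w) x g) -` S"
          obtain n where n: "\<forall>z. (\<forall>k<n. z k = w k) \<longrightarrow> (act (- g) x \<in> B z \<longleftrightarrow> act (- g) x \<in> B w)"
            using B(6)[where x = "act (- g) x" and w = w] by (rule exE)
          define T where "T = {z :: nat \<Rightarrow> bool. {k\<in>{..<n}. z k} = {k. k < n \<and> w k}}"
          have T: "z \<in> T \<longleftrightarrow> (\<forall>k<n. z k = w k)" for z
            unfolding T_def mem_Collect_eq set_eq_iff lessThan_iff by blast
          have "open T" unfolding T_def by (rule pattern_clopen(2)[where h="\<lambda>k. k"]) simp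
          moreover have "w \<in> T" by (simp add: T)
          moreover have "coding (B z) x g = coding (B w) x g" if "z \<in> T" for z
            using n that unfolding T coding_def by blast
          then have "T \<subseteq> (\<lambda>w. coding (B w) x g) -` S" using w by auto
          ultimately show "\<exists>T. open T \<and> w \<in> T \<and> T \<subseteq> (\<lambda>w. coding (B w) x g) -` S" by blast
        qed
        then show "continuous_on UNIV (\<lambda>w. coding (B w) x g)" by (simp add: continuous_on_open_vimage)
      qed
    qed
  qed
qed

end

section \<open>Genericity in the measure algebra\<close>

lemma shift_shift: "shift g (shift h v) = shift (g + h) v"
  by (simp add: shift_def minus_add add.assoc del: add_uminus_conv_diff)

text \<open>Stabilisers along an orbit are conjugate: if \<open>g\<close> fixes
  \<open>shift k v\<close>, then - k + g + k fixes \<open>v\<close>.\<close>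

lemma Free_part_shift: "v \<in> Free_part \<Longrightarrow> shift k v \<in> Free_part"
  unfolding Free_part_def mem_Collect_eq
proof (intro allI impI notI)
  fix g assume free: "\<forall>g. g \<noteq> 0 \<longrightarrow> shift g v \<noteq> v" and g: "g \<noteq> 0" and e: "shift g (shift k v) = shift k v"
  have "shift (- k) (shift g (shift k v)) = shift (- k) (shift k v)" by (simp only: e)
  then have "shift (- k + (g + k)) v = v" by (simp add: shift_shift) (simp add: shift_def)
  then have "- k + (g + k) = 0" using free by blast
  then have "g + k = 0 + k" by (metis add.left_neutral add.right_neutral add_minus_cancel)
  then show False using g add_right_cancel[of g k 0] by blast
qed

section \<open>Approximate periods of a Borel set\<close>

context free_borel_action begin

lemma act_image: "A \<subseteq> space X \<Longrightarrow> act g ` A = {x \<in> space X. act (- g) x \<in> A}"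
proof (intro equalityI subsetI)
  fix x assume "x \<in> {x \<in> space X. act (- g) x \<in> A}"
  then show "x \<in> act g ` A" by (intro image_eqI[of _ _ "act (- g) x"]) auto
qed auto

lemma act_image_sets: "A \<in> sets X \<Longrightarrow> act g ` A \<in> sets X"
  using sets.sets_into_space[of A X] by (subst act_image) auto

lemma set_map_eq_coding:
  assumes "A \<in> sets X" "x \<in> space X" shows "set_map act A x = coding A x"
  using assms act_image[OF sets.sets_into_space[OF assms(1)]] by (auto simp: set_map_def coding_def)

text \<open>Equivariance recovers every coordinate from the one at the identity, so the maps already
  constructed yield Borel sets for the measure algebra.\<close>

lemma equivariant_is_coding:
  assumes "borel_equivariant X act f"
  obtains A where "A \<in> sets X" "\<And>x. x \<in> space X \<Longrightarrow> f x = coding A x"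
proof (rule that[of "{x \<in> space X. f x 0}"])
  have f: "f \<in> X \<rightarrow>\<^sub>M borel" "\<And>g x. x \<in> space X \<Longrightarrow> f (act g x) = shift g (f x)"
    using assms by (auto simp: borel_equivariant_def)
  have "(\<lambda>x. f x 0) \<in> X \<rightarrow>\<^sub>M borel"
    by (rule measurable_compose[OF f(1) measurable_product_coordinates])
  then show "{x \<in> space X. f x 0} \<in> sets X"
    unfolding borel_measurable_bool_iff pred_def .
  show "f x = coding {x \<in> space X. f x 0} x" if "x \<in> space X" for x
    using that f(2) by (auto simp: coding_def shift_def fun_eq_iff)
qed

text \<open>For \<open>F = UNIV\<close> these are the points whose image is fixed by
  \<open>shift g\<close>. A finite \<open>F\<close> gives an outer approximation that can be
  controlled in measure.\<close>

definition periodic_on :: "'g set \<Rightarrow> 'g \<Rightarrow> 'x set \<Rightarrow> 'x set" where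
  "periodic_on F g A = {x \<in> space X. \<forall>h\<in>F. act h x \<in> A \<longleftrightarrow> act (h + g) x \<in> A}"

lemma periodic_on_sets [measurable]:
  assumes [measurable]: "A \<in> sets X" shows "periodic_on F g A \<in> sets X"
  unfolding periodic_on_def by measurable

lemma coding_free_iff:
  assumes "x \<in> space X"
  shows "coding A x \<in> Free_part \<longleftrightarrow> (\<forall>g. g \<noteq> 0 \<longrightarrow> x \<notin> periodic_on UNIV g A)"
proof -
  have "shift g (coding A x) = coding A x \<longleftrightarrow> x \<in> periodic_on UNIV g A" for g
  proof -
    have "shift g (coding A x) = coding A x \<longleftrightarrow> (\<forall>h. act (- h + g) x \<in> A \<longleftrightarrow> act (- h) x \<in> A)"
      by (simp add: fun_eq_iff shift_def coding_def minus_add del: add_uminus_conv_diff)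
    also have "\<dots> \<longleftrightarrow> (\<forall>h. act (h + g) x \<in> A \<longleftrightarrow> act h x \<in> A)"
      by (metis add.inverse_inverse)
    finally show ?thesis using assms by (auto simp: periodic_on_def)
  qed
  then show ?thesis by (simp add: Free_part_def)
qed

text \<open>Membership of \<open>x\<close> reads the set only at \<open>act e x\<close> with
  \<open>e\<close> in F or F + g. If it changes, one of these points lies in the symmetric
  difference, hence \<open>x\<close> lies in a translate of it by - e.\<close>

lemma periodic_on_perturb:
  assumes A: "A \<subseteq> space X" "A' \<subseteq> space X"
  shows "periodic_on F g A \<subseteq> periodic_on F g A' \<union> (\<Union>e\<in>uminus ` (F \<union> (\<lambda>h. h + g) ` F). act e ` sym_diff A A')"
proof
  fix x assume x: "x \<in> periodic_on F g A"
  then have xX: "x \<in> space X" by (simp add: periodic_on_def)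
  show "x \<in> periodic_on F g A' \<union> (\<Union>e\<in>uminus ` (F \<union> (\<lambda>h. h + g) ` F). act e ` sym_diff A A')"
  proof (rule ccontr)
    assume n: "\<not> ?thesis"
    have same: "act e x \<in> A \<longleftrightarrow> act e x \<in> A'" if "e \<in> F \<union> (\<lambda>h. h + g) ` F" for e
    proof -
      have "x \<notin> act (- e) ` sym_diff A A'" using n that by blast
      moreover have "sym_diff A A' \<subseteq> space X" using A by blast
      ultimately show ?thesis using xX by (auto simp: act_image)
    qed
    have "x \<in> periodic_on F g A'" using x same by (auto simp: periodic_on_def)
    then show False using n by blast
  qed
qed

text \<open>This set supplies replacement colours on the invariant null set of points with a
  non-free image.\<close>

lemma ex_free_coding: "\<exists>A\<in>sets X. \<forall>x\<in>space X. coding A x \<in> Free_part"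
proof -
  have "covers {0} (space X)" by (auto simp: covers_def)
  then have "syndetic X act (space X - {})" by (intro covers_syndetic) auto
  moreover have "(\<lambda>_. False) \<in> restrict_space X {} \<rightarrow>\<^sub>M (borel :: bool measure)" by simp
  ultimately obtain f :: "(nat \<Rightarrow> bool) \<Rightarrow> 'x \<Rightarrow> 'g \<Rightarrow> bool" where
    f: "\<And>w. borel_equivariant X act (f w)" "\<And>w. closure (f w ` space X) \<subseteq> Free_part"
    using prescribed_family[of "{}" "\<lambda>_. False"] by (metis sets.empty_sets)
  obtain A where A: "A \<in> sets X" "\<And>x. x \<in> space X \<Longrightarrow> f (\<lambda>_. False) x = coding A x"
    using equivariant_is_coding[OF f(1)] by metis
  have "coding A x \<in> Free_part" if "x \<in> space X" for x
    using f(2)[of "\<lambda>_. False"] A(2)[OF that] closure_subset that by (metis image_eqI subsetD)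
  then show ?thesis using A(1) by blast
qed

end

section \<open>Quasi-invariant measures and the set of free classes\<close>

locale quasi_invariant_action = free_borel_action X act + prob_space \<mu>
  for X :: "'x measure" and act :: "'g::{group_add,countable} \<Rightarrow> 'x \<Rightarrow> 'x" and \<mu> :: "'x measure" +
  assumes sets_\<mu>: "sets \<mu> = sets X" and quasi_inv: "quasi_invariant act \<mu>"
begin

text \<open>Disjoint translates of one syndetic set; one of them has small measure.\<close>
lemma small_syndetic:
  assumes "\<epsilon> > 0"
  obtains M K where "M \<in> sets X" "covers K M" "measure \<mu> M < \<epsilon>"
proof -
  obtain n where n: "1 / real (Suc n) < \<epsilon>" using nat_approx_posE[OF assms] by blast
  obtain S :: "'g set" where S: "finite S" "card S = Suc n"
    using infinite_arbitrarily_large[OF infinite_group] by blast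
  define T0 where "T0 = uminus ` S \<oplus> S"
  have T0: "finite T0" using S by (simp add: T0_def)
  have "- t \<in> T0" if "t \<in> T0" for t using that symmetric_difference_set by (simp add: T0_def)
  then obtain C where C: "C \<in> sets X" "discrete T0 C" "\<And>x. x \<in> space X \<Longrightarrow> \<exists>t\<in>insert 0 T0. act t x \<in> C"
    using maximal_centers[OF T0] by metis
  have CX: "c \<in> space X" if "c \<in> C" for c using that sets.sets_into_space[OF C(1)] by blast
  have disj: "disjoint_family_on (\<lambda>s. act s ` C) S"
    unfolding disjoint_family_on_def
  proof (intro ballI impI, rule ccontr)
    fix s s' assume s: "s \<in> S" "s' \<in> S" "s \<noteq> s'" "act s ` C \<inter> act s' ` C \<noteq> {}"
    then obtain c c' where c: "c \<in> C" "c' \<in> C" "act s c = act s' c'" by blast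
    then have "c' = act (- s' + s) c" using act_eq_iff CX by blast
    moreover have "- s' + s \<in> T0" using s unfolding T0_def by (intro sumsetI imageI)
    ultimately have "- s' + s = 0" using discreteD[OF C(2) c(1)] c(2) by blast
    then show False using s(3) by (metis add.right_neutral add_minus_cancel)
  qed
  have meas: "(\<lambda>s. act s ` C) ` S \<subseteq> sets \<mu>" using act_image_sets[OF C(1)] by (auto simp: sets_\<mu>)
  have "\<exists>s\<in>S. measure \<mu> (act s ` C) < \<epsilon>"
  proof (rule ccontr)
    assume "\<not> ?thesis"
    then have "\<forall>s\<in>S. \<epsilon> \<le> measure \<mu> (act s ` C)" by (meson not_less)
    then have "(\<Sum>s\<in>S. \<epsilon>) \<le> (\<Sum>s\<in>S. measure \<mu> (act s ` C))" by (intro sum_mono) auto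
    also have "\<dots> = measure \<mu> (\<Union>s\<in>S. act s ` C)"
      by (rule finite_measure_finite_Union[OF S(1) meas disj, symmetric])
    also have "\<dots> \<le> 1" by (rule prob_le_1)
    finally have "real (Suc n) * \<epsilon> \<le> 1" using S by simp
    then show False using n by (simp add: field_simps)
  qed
  then obtain s where s: "s \<in> S" "measure \<mu> (act s ` C) < \<epsilon>" by blast
  have "covers ((\<lambda>t. s + t) ` insert 0 T0) (act s ` C)"
    unfolding covers_def
  proof (intro conjI ballI)
    fix x assume x: "x \<in> space X"
    then obtain t where "t \<in> insert 0 T0" "act t x \<in> C" using C(3) by blast
    moreover from this have "act (s + t) x \<in> act s ` C" using x by (intro image_eqI[of _ _ "act t x"]) auto
    ultimately show "\<exists>k\<in>(\<lambda>t. s + t) ` insert 0 T0. act k x \<in> act s ` C" by blast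
  qed (use T0 in simp)
  then show thesis using that act_image_sets[OF C(1)] s(2) by blast
qed

text \<open>Quasi-invariance in epsilon-delta form. Otherwise there are sets of measure below 1 /
  2^n whose translates keep measure at least \<epsilon>; their limsup is null by Borel-Cantelli,
  while its translate has measure at least \<epsilon>.\<close>

lemma translate_small:
  assumes "\<epsilon> > 0"
  shows "\<exists>\<delta>>0. \<forall>Z\<in>sets X. measure \<mu> Z < \<delta> \<longrightarrow> measure \<mu> (act g ` Z) < \<epsilon>"
proof (rule ccontr)
  assume n: "\<not> ?thesis"
  have "\<exists>Z\<in>sets X. measure \<mu> Z < (1 / 2) ^ n \<and> \<epsilon> \<le> measure \<mu> (act g ` Z)" for n
  proof -
    have "(1 / 2 :: real) ^ n > 0" by simp
    then show ?thesis using n by (meson not_less)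
  qed
  then obtain Z where Z: "\<And>n. Z n \<in> sets X" "\<And>n. measure \<mu> (Z n) < (1 / 2) ^ n"
    "\<And>n. \<epsilon> \<le> measure \<mu> (act g ` Z n)" by metis
  have ZX: "Z n \<subseteq> space X" for n using Z(1) sets.sets_into_space by blast
  have "limsup Z \<in> null_sets \<mu>"
  proof (rule borel_cantelli_limsup1)
    show "Z n \<in> sets \<mu>" for n using Z(1) by (simp add: sets_\<mu>)
    show "emeasure \<mu> (Z n) < \<infinity>" for n by (simp add: less_top[symmetric])
    show "summable (\<lambda>n. measure \<mu> (Z n))"
      by (rule summable_comparison_test'[of "\<lambda>n. (1 / 2) ^ n" 0])
        (use Z(2) in \<open>auto simp: summable_geometric intro: less_imp_le\<close>)
  qed
  then have null: "act g ` limsup Z \<in> null_sets \<mu>" using quasi_inv by (auto simp: quasi_invariant_def)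
  define U where "U n = (\<Union>m\<in>{n..}. act g ` Z m)" for n
  have U: "range U \<subseteq> sets \<mu>" using act_image_sets[OF Z(1)] by (auto simp: U_def sets_\<mu>)
  have "decseq U" unfolding U_def by (intro decseq_SucI UN_mono) auto
  then have lim: "(\<lambda>n. measure \<mu> (U n)) \<longlonglongrightarrow> measure \<mu> (\<Inter>n. U n)"
    by (rule finite_Lim_measure_decseq[OF U])
  have "\<epsilon> \<le> measure \<mu> (U n)" for n
    using Z(3)[of n] U by (intro order_trans[OF Z(3)[of n]] finite_measure_mono) (auto simp: U_def)
  then have "\<epsilon> \<le> measure \<mu> (\<Inter>n. U n)" by (intro LIMSEQ_le_const[OF lim]) auto
  also have "(\<Inter>n. U n) = act g ` limsup Z"
  proof -
    have ls: "limsup Z = (\<Inter>n. \<Union>m\<in>{n..}. Z m)" by (simp add: limsup_INF_SUP)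
    have "limsup Z \<subseteq> space X" unfolding ls using ZX by blast
    then have "act g ` limsup Z = {x \<in> space X. act (- g) x \<in> (\<Inter>n. \<Union>m\<in>{n..}. Z m)}"
      by (simp only: act_image ls)
    also have "\<dots> = (\<Inter>n. U n)" unfolding U_def act_image[OF ZX] by auto
    finally show ?thesis ..
  qed
  also have "measure \<mu> (act g ` limsup Z) = 0" using null by (simp add: measure_def null_setsD1)
  finally show False using assms by simp
qed

lemma translates_small:
  assumes "finite F" "\<epsilon> > 0"
  shows "\<exists>\<delta>>0. \<forall>Z\<in>sets X. measure \<mu> Z < \<delta> \<longrightarrow> measure \<mu> (\<Union>g\<in>F. act g ` Z) < \<epsilon>"
  using assms
proof (induction F arbitrary: \<epsilon> rule: finite_induct)
  case empty
  then show ?case by (intro exI[of _ 1]) simp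
next
  case (insert g F)
  then have "\<epsilon> / 2 > 0" by simp
  obtain \<delta>1 where 1: "\<delta>1 > 0" "\<And>Z. Z \<in> sets X \<Longrightarrow> measure \<mu> Z < \<delta>1 \<Longrightarrow> measure \<mu> (act g ` Z) < \<epsilon> / 2"
    using translate_small[OF \<open>\<epsilon> / 2 > 0\<close>] by blast
  obtain \<delta>2 where 2: "\<delta>2 > 0" "\<And>Z. Z \<in> sets X \<Longrightarrow> measure \<mu> Z < \<delta>2 \<Longrightarrow> measure \<mu> (\<Union>g\<in>F. act g ` Z) < \<epsilon> / 2"
    using insert.IH[OF \<open>\<epsilon> / 2 > 0\<close>] by blast
  show ?case
  proof (intro exI[of _ "min \<delta>1 \<delta>2"] conjI ballI impI)
    fix Z assume Z: "Z \<in> sets X" "measure \<mu> Z < min \<delta>1 \<delta>2"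
    have "measure \<mu> (act g ` Z \<union> (\<Union>g\<in>F. act g ` Z)) \<le> measure \<mu> (act g ` Z) + measure \<mu> (\<Union>g\<in>F. act g ` Z)"
      using act_image_sets[OF Z(1)] insert.hyps(1) by (intro measure_Un_le) (auto simp: sets_\<mu>)
    then show "measure \<mu> (\<Union>g\<in>insert g F. act g ` Z) < \<epsilon>" using 1(2)[OF Z(1)] 2(2)[OF Z(1)] Z(2) by simp
  qed (use 1 2 in simp)
qed

definition free_classes :: "'x set set set" where
  "free_classes = {malg_class \<mu> A | A. A \<in> sets X \<and> set_map act A ` space X \<subseteq> Free_part}"

lemma null_translates:
  assumes "N \<in> null_sets \<mu>" shows "(\<Union>g\<in>F. act g ` N) \<in> null_sets \<mu>"
  using assms quasi_inv by (intro null_sets_UN') (auto simp: quasi_invariant_def)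

lemma class_free_iff:
  assumes A: "A \<in> sets X"
  shows "malg_class \<mu> A \<in> free_classes \<longleftrightarrow> (\<forall>g. g \<noteq> 0 \<longrightarrow> periodic_on UNIV g A \<in> null_sets \<mu>)"
proof
  assume "malg_class \<mu> A \<in> free_classes"
  then obtain A' where A': "A' \<in> sets X" "malg_class \<mu> A = malg_class \<mu> A'"
    "set_map act A' ` space X \<subseteq> Free_part" by (auto simp: free_classes_def)
  have null: "sym_diff A A' \<in> null_sets \<mu>"
    using A'(2) A A'(1) malg_class_eq_iff[of A \<mu> A'] by (simp add: sets_\<mu>)
  show "\<forall>g. g \<noteq> 0 \<longrightarrow> periodic_on UNIV g A \<in> null_sets \<mu>"
  proof (intro allI impI)
    fix g :: 'g assume g: "g \<noteq> 0"
    have "coding A' x \<in> Free_part" if "x \<in> space X" for x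
      using A'(3) set_map_eq_coding[OF A'(1)] that by (metis image_subset_iff)
    then have "periodic_on UNIV g A' = {}"
      using coding_free_iff[of _ A'] g by (auto simp: periodic_on_def)
    then have "periodic_on UNIV g A \<subseteq> (\<Union>e\<in>uminus ` (UNIV \<union> (\<lambda>h. h + g) ` UNIV). act e ` sym_diff A A')"
      using periodic_on_perturb[of A A' UNIV g] sets.sets_into_space[OF A] sets.sets_into_space[OF A'(1)] by simp
    then show "periodic_on UNIV g A \<in> null_sets \<mu>"
      by (rule null_sets_subset[OF null_translates[OF null], rotated]) (use A periodic_on_sets in \<open>simp add: sets_\<mu>\<close>)
  qed
next
  assume null: "\<forall>g. g \<noteq> 0 \<longrightarrow> periodic_on UNIV g A \<in> null_sets \<mu>"
  \<comment> \<open>\<open>N\<close> consists of the points with a non-free image and is a union of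
    orbits. Replacing \<open>A\<close> by \<open>A1\<close> on it therefore changes the images of
    its own points only.\<close>
  define N where "N = (\<Union>g\<in>-{0}. periodic_on UNIV g A)"
  have N: "N \<in> null_sets \<mu>" unfolding N_def using null by (intro null_sets_UN') auto
  then have NX [measurable]: "N \<in> sets X" by (auto simp: sets_\<mu>)
  have N_iff: "x \<in> N \<longleftrightarrow> coding A x \<notin> Free_part" if "x \<in> space X" for x
    using coding_free_iff[OF that] by (auto simp: N_def)
  have coding_act: "coding A (act k x) = shift k (coding A x)" if "x \<in> space X" for k x
    using coding_equivariant[OF A] that by (simp add: borel_equivariant_def)
  have N_inv: "act k x \<in> N \<longleftrightarrow> x \<in> N" if x: "x \<in> space X" for k x
  proof -
    have "coding A x = shift (- k) (coding A (act k x))"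
      using x by (simp add: coding_act shift_shift) (simp add: shift_def)
    then have "coding A (act k x) \<in> Free_part \<longleftrightarrow> coding A x \<in> Free_part"
      using Free_part_shift coding_act[OF x] by metis
    then show ?thesis using N_iff x by simp
  qed
  obtain A1 where A1: "A1 \<in> sets X" "\<forall>x\<in>space X. coding A1 x \<in> Free_part"
    using ex_free_coding by blast
  define A' where "A' = (A - N) \<union> (A1 \<inter> N)"
  have A': "A' \<in> sets X" using A A1 NX by (auto simp: A'_def)
  have "coding A' x \<in> Free_part" if x: "x \<in> space X" for x
  proof (cases "x \<in> N")
    case True
    then have "coding A' x = coding A1 x" using N_inv[OF x] by (auto simp: coding_def A'_def)
    then show ?thesis using A1 x by simp
  next
    case False
    then have "coding A' x = coding A x" using N_inv[OF x] by (auto simp: coding_def A'_def)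
    then show ?thesis using N_iff[OF x] False by simp
  qed
  then have "set_map act A' ` space X \<subseteq> Free_part" using set_map_eq_coding[OF A'] by auto
  moreover have "malg_class \<mu> A = malg_class \<mu> A'"
  proof -
    have "sym_diff A A' \<in> null_sets \<mu>"
      by (rule null_sets_subset[OF N]) (use A A' in \<open>auto simp: A'_def sets_\<mu>\<close>)
    then show ?thesis using A A' malg_class_eq_iff[of A \<mu> A'] by (simp add: sets_\<mu>)
  qed
  ultimately show "malg_class \<mu> A \<in> free_classes" using A' by (auto simp: free_classes_def)
qed

interpretation malg: Metric_space "malg \<mu>" "malg_dist \<mu>"
  by (rule Metric_space_malg) (rule finite_measure_axioms)

lemma dist_class: "A \<in> sets X \<Longrightarrow> B \<in> sets X \<Longrightarrow> malg_dist \<mu> (malg_class \<mu> A) (malg_class \<mu> B) = measure \<mu> (sym_diff A B)"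
  by (intro malg_dist_class finite_measure_axioms) (simp_all add: sets_\<mu>)

lemma class_in: "A \<in> sets X \<Longrightarrow> malg_class \<mu> A \<in> malg \<mu>"
  by (intro malg_class_in) (simp add: sets_\<mu>)

lemma class_cases:
  assumes "P \<in> malg \<mu>" obtains A where "A \<in> sets X" "P = malg_class \<mu> A"
  using malg_cases[OF assms] by (metis sets_\<mu>)

lemma free_classes_subset: "free_classes \<subseteq> malg \<mu>"
  using class_in by (auto simp: free_classes_def)

lemma free_classes_dense: "malg_topology \<mu> closure_of free_classes = malg \<mu>"
proof -
  have "\<exists>Q\<in>free_classes. Q \<in> malg.mball P r" if P: "P \<in> malg \<mu>" and r: "r > 0" for P r
  proof -
    obtain A where A: "A \<in> sets X" "P = malg_class \<mu> A" using class_cases[OF P] .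
    obtain M K where M: "M \<in> sets X" "covers K M" "measure \<mu> M < r" using small_syndetic[OF r] .
    have MX: "M \<subseteq> space X" using M(1) by (rule sets.sets_into_space)
    define Y where "Y = space X - M"
    have Y: "Y \<in> sets X" "syndetic X act (space X - Y)"
      using M covers_syndetic[OF M(2) MX] MX by (auto simp: Y_def double_diff)
    note A(1) [measurable]
    have "(\<lambda>x. x \<in> A) \<in> restrict_space X Y \<rightarrow>\<^sub>M (borel :: bool measure)"
      unfolding borel_measurable_bool_iff by (intro measurable_restrict_space1) measurable
    from prescribed_family[OF Y this] obtain f :: "(nat \<Rightarrow> bool) \<Rightarrow> 'x \<Rightarrow> 'g \<Rightarrow> bool" where
      f: "\<And>w. borel_equivariant X act (f w)" "\<And>w. closure (f w ` space X) \<subseteq> Free_part"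
        "\<And>w y. y \<in> Y \<Longrightarrow> f w y 0 = (y \<in> A)" by metis
    obtain B where B: "B \<in> sets X" "\<And>x. x \<in> space X \<Longrightarrow> f (\<lambda>_. False) x = coding B x"
      using equivariant_is_coding[OF f(1)] by metis
    have "coding B x \<in> Free_part" if "x \<in> space X" for x
      using f(2)[of "\<lambda>_. False"] B(2)[OF that] closure_subset that by (metis image_eqI subsetD)
    then have "malg_class \<mu> B \<in> free_classes"
      using B(1) set_map_eq_coding[OF B(1)] by (auto simp: free_classes_def)
    moreover have "sym_diff A B \<subseteq> M"
    proof -
      have "x \<in> A \<longleftrightarrow> x \<in> B" if "x \<in> space X" "x \<notin> M" for x
        using f(3)[of x "\<lambda>_. False"] B(2)[OF that(1)] that by (simp add: Y_def coding_def)
      then show ?thesis using sets.sets_into_space[OF A(1)] sets.sets_into_space[OF B(1)] by blast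
    qed
    then have "measure \<mu> (sym_diff A B) \<le> measure \<mu> M"
      using M(1) by (intro finite_measure_mono) (simp_all add: sets_\<mu>)
    then have "malg_class \<mu> B \<in> malg.mball P r"
      using M(3) A B(1) class_in by (simp add: dist_class)
    ultimately show ?thesis by blast
  qed
  then show ?thesis unfolding malg_topology_def malg.metric_closure_of by blast
qed

text \<open>A finite window is essential for openness: finitely many translates of a small set are
  small together, infinitely many need not be. \<open>F\<close> may depend on the class.\<close>

definition nonperiodic_classes :: "'g \<Rightarrow> nat \<Rightarrow> 'x set set set" where
  "nonperiodic_classes g n = {malg_class \<mu> A | A. A \<in> sets X \<and>
    (\<exists>F. finite F \<and> measure \<mu> (periodic_on F g A) < 1 / real (Suc n))}"

lemma openin_nonperiodic_classes: "openin (malg_topology \<mu>) (nonperiodic_classes g n)"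
  unfolding malg_topology_def malg.openin_mtopology
proof (intro conjI allI impI)
  show "nonperiodic_classes g n \<subseteq> malg \<mu>" using class_in by (auto simp: nonperiodic_classes_def)
  fix P assume "P \<in> nonperiodic_classes g n"
  then obtain A F where A: "A \<in> sets X" "P = malg_class \<mu> A" "finite F"
    "measure \<mu> (periodic_on F g A) < 1 / real (Suc n)" by (auto simp: nonperiodic_classes_def)
  define \<epsilon> where "\<epsilon> = 1 / real (Suc n) - measure \<mu> (periodic_on F g A)"
  define E where "E = uminus ` (F \<union> (\<lambda>h. h + g) ` F)"
  have "\<epsilon> > 0" "finite E" using A by (auto simp: \<epsilon>_def E_def)
  then obtain \<delta> where \<delta>: "\<delta> > 0"
    "\<And>Z. Z \<in> sets X \<Longrightarrow> measure \<mu> Z < \<delta> \<Longrightarrow> measure \<mu> (\<Union>e\<in>E. act e ` Z) < \<epsilon>"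
    using translates_small by metis
  have "malg.mball P \<delta> \<subseteq> nonperiodic_classes g n"
  proof
    fix Q assume Q: "Q \<in> malg.mball P \<delta>"
    then have "Q \<in> malg \<mu>" by simp
    then obtain B where B: "B \<in> sets X" "Q = malg_class \<mu> B" by (rule class_cases)
    define Z where "Z = sym_diff B A"
    have Z: "Z \<in> sets X" using A B by (auto simp: Z_def)
    have "measure \<mu> Z < \<delta>" using Q A(1,2) B by (simp add: dist_class Z_def Un_commute)
    have UZ: "(\<Union>e\<in>E. act e ` Z) \<in> sets X"
      using act_image_sets[OF Z] \<open>finite E\<close> by auto
    have "periodic_on F g B \<subseteq> periodic_on F g A \<union> (\<Union>e\<in>E. act e ` Z)"
      unfolding Z_def E_def
      using sets.sets_into_space[OF A(1)] sets.sets_into_space[OF B(1)] by (intro periodic_on_perturb)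
    then have "measure \<mu> (periodic_on F g B) \<le> measure \<mu> (periodic_on F g A \<union> (\<Union>e\<in>E. act e ` Z))"
      using A(1) UZ by (intro finite_measure_mono) (auto simp: sets_\<mu>)
    also have "\<dots> \<le> measure \<mu> (periodic_on F g A) + measure \<mu> (\<Union>e\<in>E. act e ` Z)"
      using A(1) UZ by (intro measure_Un_le) (auto simp: sets_\<mu>)
    also have "\<dots> < 1 / real (Suc n)" using \<delta>(2)[OF Z \<open>measure \<mu> Z < \<delta>\<close>] by (simp add: \<epsilon>_def)
    finally show "Q \<in> nonperiodic_classes g n" using B A(3) unfolding nonperiodic_classes_def by blast
  qed
  then show "\<exists>r>0. malg.mball P r \<subseteq> nonperiodic_classes g n" using \<delta>(1) by blast
qed

text \<open>Finite windows exhausting the countable group give decreasing sets with intersection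
  \<open>periodic_on UNIV g A\<close>, so continuity from above applies. Conversely each finite
  window bounds that set, up to a null set for a change of representative.\<close>

lemma class_in_nonperiodic_iff:
  assumes A: "A \<in> sets X"
  shows "(\<forall>n. malg_class \<mu> A \<in> nonperiodic_classes g n) \<longleftrightarrow> periodic_on UNIV g A \<in> null_sets \<mu>"
proof
  assume null: "periodic_on UNIV g A \<in> null_sets \<mu>"
  define F :: "nat \<Rightarrow> 'g set" where "F k = from_nat ` {..<k}" for k
  have "decseq (\<lambda>k. periodic_on (F k) g A)"
    by (intro decseq_SucI) (auto simp: periodic_on_def F_def)
  moreover have "range (\<lambda>k. periodic_on (F k) g A) \<subseteq> sets \<mu>" using A by (auto simp: sets_\<mu>)
  ultimately have "(\<lambda>k. measure \<mu> (periodic_on (F k) g A)) \<longlonglongrightarrow> measure \<mu> (\<Inter>k. periodic_on (F k) g A)"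
    by (intro finite_Lim_measure_decseq)
  moreover have "(\<Inter>k. periodic_on (F k) g A) = periodic_on UNIV g A"
  proof -
    have "\<exists>k. h \<in> F k" for h
      unfolding F_def by (intro exI[of _ "Suc (to_nat h)"] image_eqI[of _ _ "to_nat h"]) auto
    then show ?thesis by (auto simp: periodic_on_def)
  qed
  moreover have "measure \<mu> (periodic_on UNIV g A) = 0" using null by (simp add: measure_def null_setsD1)
  ultimately have lim: "(\<lambda>k. measure \<mu> (periodic_on (F k) g A)) \<longlonglongrightarrow> 0" by simp
  show "\<forall>n. malg_class \<mu> A \<in> nonperiodic_classes g n"
  proof
    fix n
    have "eventually (\<lambda>k. measure \<mu> (periodic_on (F k) g A) < 1 / real (Suc n)) sequentially"
      by (rule order_tendstoD(2)[OF lim]) simp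
    from eventually_happens'[OF sequentially_bot this]
    obtain k where "measure \<mu> (periodic_on (F k) g A) < 1 / real (Suc n)" by (rule exE)
    moreover have "finite (F k)" by (simp add: F_def)
    ultimately show "malg_class \<mu> A \<in> nonperiodic_classes g n" using A unfolding nonperiodic_classes_def by blast
  qed
next
  assume all: "\<forall>n. malg_class \<mu> A \<in> nonperiodic_classes g n"
  have "measure \<mu> (periodic_on UNIV g A) < 1 / real (Suc n)" for n
  proof -
    obtain B F where B: "B \<in> sets X" "malg_class \<mu> A = malg_class \<mu> B" "finite F"
      "measure \<mu> (periodic_on F g B) < 1 / real (Suc n)"
      using all unfolding nonperiodic_classes_def by blast
    have null: "sym_diff A B \<in> null_sets \<mu>"
      using B(2) A B(1) malg_class_eq_iff[of A \<mu> B] by (simp add: sets_\<mu>)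
    define N where "N = (\<Union>e\<in>uminus ` (F \<union> (\<lambda>h. h + g) ` F). act e ` sym_diff A B)"
    have N: "N \<in> null_sets \<mu>" unfolding N_def by (rule null_translates[OF null])
    have "periodic_on UNIV g A \<subseteq> periodic_on F g A" by (auto simp: periodic_on_def)
    also have "\<dots> \<subseteq> periodic_on F g B \<union> N"
      unfolding N_def using sets.sets_into_space[OF A] sets.sets_into_space[OF B(1)] by (intro periodic_on_perturb)
    finally have "measure \<mu> (periodic_on UNIV g A) \<le> measure \<mu> (periodic_on F g B \<union> N)"
      using B(1) N by (intro finite_measure_mono) (auto simp: sets_\<mu>)
    also have "\<dots> = measure \<mu> (periodic_on F g B)"
      using B(1) N by (intro measure_Un_null_set) (auto simp: sets_\<mu>)
    finally show ?thesis using B(4) by simp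
  qed
  then have "\<not> 0 < measure \<mu> (periodic_on UNIV g A)"
    by (meson nat_approx_posE order.asym)
  then have "measure \<mu> (periodic_on UNIV g A) \<le> 0" by simp
  then show "periodic_on UNIV g A \<in> null_sets \<mu>"
    using A by (auto simp: null_sets_def sets_\<mu> emeasure_eq_measure measure_le_0_iff)
qed

lemma free_classes_gdelta: "gdelta_in (malg_topology \<mu>) free_classes"
proof -
  define I where "I = (\<lambda>(g, n). nonperiodic_classes g n) ` ((- {0 :: 'g}) \<times> (UNIV :: nat set))"
  have "P \<in> free_classes \<longleftrightarrow> P \<in> \<Inter> I" if "P \<in> malg \<mu>" for P
  proof -
    obtain A where A: "A \<in> sets X" "P = malg_class \<mu> A" using class_cases[OF \<open>P \<in> malg \<mu>\<close>] .
    have "P \<in> \<Inter> I \<longleftrightarrow> (\<forall>g. g \<noteq> 0 \<longrightarrow> (\<forall>n. P \<in> nonperiodic_classes g n))" by (auto simp: I_def)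
    then show ?thesis unfolding A(2) class_free_iff[OF A(1)] class_in_nonperiodic_iff[OF A(1)] by (rule sym)
  qed
  moreover have "\<Inter> I \<subseteq> malg \<mu>"
  proof -
    \<comment> \<open>A nonzero element makes \<open>I\<close> nonempty, which confines its
      intersection to the measure algebra.\<close>
    obtain g :: 'g where "g \<noteq> 0" using infinite_group ex_new_if_finite[of "{0 :: 'g}"] by auto
    then have "nonperiodic_classes g 0 \<in> I" by (auto simp: I_def)
    moreover have "nonperiodic_classes g 0 \<subseteq> malg \<mu>" using class_in by (auto simp: nonperiodic_classes_def)
    ultimately show ?thesis by blast
  qed
  ultimately have "free_classes = \<Inter> I" using free_classes_subset by blast
  moreover have "gdelta_in (malg_topology \<mu>) (\<Inter> I)"
  proof (rule gdelta_in_Inter)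
    show "countable I" by (simp add: I_def)
    obtain g :: 'g where "g \<noteq> 0" using infinite_group ex_new_if_finite[of "{0 :: 'g}"] by auto
    then show "I \<noteq> {}" by (auto simp: I_def)
    show "gdelta_in (malg_topology \<mu>) S" if "S \<in> I" for S
      using that openin_nonperiodic_classes by (auto simp: I_def intro: open_imp_gdelta_in)
  qed
  ultimately show ?thesis by simp
qed

end

theorem theorem1p1:
  fixes X :: "'x measure"
    and act :: "'g::{group_add,countable} \<Rightarrow> 'x \<Rightarrow> 'x"
  assumes "infinite (UNIV :: 'g set)"
    and "standard_borel X"
    and "borel_action X act"
    and "free_action X act"
  shows
    "(\<exists>f. borel_equivariant X act f \<and> closure (f ` space X) \<subseteq> Free_part)
     \<and>
     (\<forall>Y \<phi>. Y \<in> sets X \<and> syndetic X act (space X - Y) \<and>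
        \<phi> \<in> restrict_space X Y \<rightarrow>\<^sub>M (borel :: bool measure) \<longrightarrow>
        (\<exists>f. borel_equivariant X act f \<and> closure (f ` space X) \<subseteq> Free_part \<and>
             (\<forall>y\<in>Y. f y 0 = \<phi> y)))
     \<and>
     (\<forall>Y \<phi>. Y \<in> sets X \<and> syndetic X act (space X - Y) \<and>
        \<phi> \<in> restrict_space X Y \<rightarrow>\<^sub>M (borel :: bool measure) \<longrightarrow>
        (\<exists>f :: (nat \<Rightarrow> bool) \<Rightarrow> 'x \<Rightarrow> 'g \<Rightarrow> bool.
             (\<forall>w. borel_equivariant X act (f w) \<and> closure (f w ` space X) \<subseteq> Free_part \<and>
                  (\<forall>y\<in>Y. f w y 0 = \<phi> y)) \<and>
             (\<forall>w z. w \<noteq> z \<longrightarrow> closure (f w ` space X) \<inter> closure (f z ` space X) = {}) \<and>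
             (\<lambda>(w, x). f w x) \<in> (borel \<Otimes>\<^sub>M X) \<rightarrow>\<^sub>M borel \<and>
             (\<forall>x\<in>space X. continuous_on UNIV (\<lambda>w. f w x))))
     \<and>
     (\<forall>\<mu>. prob_space \<mu> \<and> sets \<mu> = sets X \<and> quasi_invariant act \<mu> \<longrightarrow>
        (let D = {malg_class \<mu> A | A. A \<in> sets X \<and> set_map act A ` space X \<subseteq> Free_part}
         in malg_topology \<mu> closure_of D = malg \<mu> \<and> gdelta_in (malg_topology \<mu>) D))"
proof -
  interpret free_borel_action X act by unfold_locales (fact assms)+
  have family: "\<exists>f :: (nat \<Rightarrow> bool) \<Rightarrow> 'x \<Rightarrow> 'g \<Rightarrow> bool.
      (\<forall>w. borel_equivariant X act (f w) \<and> closure (f w ` space X) \<subseteq> Free_part \<and> (\<forall>y\<in>Y. f w y 0 = \<phi> y)) \<and>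
      (\<forall>w z. w \<noteq> z \<longrightarrow> closure (f w ` space X) \<inter> closure (f z ` space X) = {}) \<and>
      (\<lambda>(w, x). f w x) \<in> (borel \<Otimes>\<^sub>M X) \<rightarrow>\<^sub>M borel \<and>
      (\<forall>x\<in>space X. continuous_on UNIV (\<lambda>w. f w x))"
    if "Y \<in> sets X \<and> syndetic X act (space X - Y) \<and> \<phi> \<in> restrict_space X Y \<rightarrow>\<^sub>M (borel :: bool measure)"
    for Y \<phi>
  proof (rule prescribed_family[of Y \<phi>])
    fix f :: "(nat \<Rightarrow> bool) \<Rightarrow> 'x \<Rightarrow> 'g \<Rightarrow> bool"
    assume "\<And>w. borel_equivariant X act (f w)" "\<And>w. closure (f w ` space X) \<subseteq> Free_part"
      "\<And>w y. y \<in> Y \<Longrightarrow> f w y 0 = \<phi> y"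
      "\<And>w z. w \<noteq> z \<Longrightarrow> closure (f w ` space X) \<inter> closure (f z ` space X) = {}"
      "(\<lambda>(w, x). f w x) \<in> (borel \<Otimes>\<^sub>M X) \<rightarrow>\<^sub>M borel"
      "\<And>x. x \<in> space X \<Longrightarrow> continuous_on UNIV (\<lambda>w. f w x)"
    then show ?thesis by (intro exI[of _ f]) simp
  qed (use that in auto)
  have single: "\<exists>f. borel_equivariant X act f \<and> closure (f ` space X) \<subseteq> Free_part \<and> (\<forall>y\<in>Y. f y 0 = \<phi> y)"
    if "Y \<in> sets X \<and> syndetic X act (space X - Y) \<and> \<phi> \<in> restrict_space X Y \<rightarrow>\<^sub>M (borel :: bool measure)"
    for Y \<phi>
    using family[OF that] by (elim exE conjE) blast
  \<comment> \<open>The existence claim is the case in which nothing is prescribed: for empty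
    \<open>Y\<close> the complement is the whole space.\<close>
  have "covers {0} (space X)" by (auto simp: covers_def)
  then have "syndetic X act (space X - {})" by (intro covers_syndetic) auto
  then have basic: "\<exists>f. borel_equivariant X act f \<and> closure (f ` space X) \<subseteq> Free_part"
    using single[of "{}" "\<lambda>_. False"] by auto
  have generic: "let D = {malg_class \<mu> A | A. A \<in> sets X \<and> set_map act A ` space X \<subseteq> Free_part}
      in malg_topology \<mu> closure_of D = malg \<mu> \<and> gdelta_in (malg_topology \<mu>) D"
    if \<mu>: "prob_space \<mu> \<and> sets \<mu> = sets X \<and> quasi_invariant act \<mu>" for \<mu>
  proof -
    interpret prob_space \<mu> using \<mu> by blast
    interpret quasi_invariant_action X act \<mu> by unfold_locales (use \<mu> in auto)
    show ?thesis
      unfolding Let_def using free_classes_dense free_classes_gdelta unfolding free_classes_def by (rule conjI)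
  qed
  show ?thesis
  proof (rule conjI[OF basic], rule conjI[OF _ conjI]; intro allI impI)
  qed (erule single family generic)+
qed

end
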